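(* If $\mathcal{G}$ is NIP and abelian, and both $\mu,\nu\in\mathfrak{M}_x(\mathcal{G})$ are idempotent and dfs, then $\mu * \nu$ is idempotent and dfs.
   Context: Setting: $T$ is a first-order theory in a language $\mathcal{L}$ expanding a group, $\mathcal{G}$ is a sufficiently saturated (monster) model of $T$ ("$\mathcal{G}$ is NIP" means $T$ is NIP), and "small" means small relative to the saturation of $\mathcal{G}$. The variable $x$ (and $y$ in convolutions) is a singleton variable of the sort on which the group is defined. Keisler measures: for $A\subseteq\mathcal{G}$, $\mathcal{L}_x(A)$ is the Boolean algebra of formulas in $x$ with parameters from $A$ (up to equivalence), $S_x(A)$ is the space of types over $A$, and $\mathfrak{M}_x(A)$ is the set of Keisler measures over $A$, i.e. finitely additive probability measures on $\mathcal{L}_x(A)$; each is identified with the corresponding regular Borel probability measure on $S_x(A)$. $\mu|_A$ denotes restriction. The support of $\mu\in\mathfrak{M}_x(A)$ is $S(\mu)=\{p\in S_x(A):\mu(\varphi(x))>0 \text{ for all }\varphi(x)\in p\}$. $\mu\in\mathfrak{M}_x(\mathcal{G})$ is dfs if there is a small $M\prec\mathcal{G}$ such that $\mu$ is both definable over $M$ (for every $\mathcal{L}(M)$-formula $\varphi(x;y)$, $y$ any finite tuple of variables, $\mu(\varphi(x;b))$ depends only on $\mathrm{tp}(b/M)$ and $\mathrm{tp}(b/M)\mapsto\mu(\varphi(x;b))$ is continuous on $S_y(M)$) and finitely satisfiable in $M$ (if $\mu(\varphi(x))>0$ for $\varphi(x)\in\mathcal{L}_x(\mathcal{G})$, then $\mathcal{G}\models\varphi(a)$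 for some $a\in M$). Convolution: for $\mu,\nu\in\mathfrak{M}_x(\mathcal{G})$ let $\nu_y$ be $\nu$ viewed as a measure in the variable $y$. The pair $(\mu,\nu)$ is $*$-Borel if for every $\varphi(x,\bar c)\in\mathcal{L}_x(\mathcal{G})$ there is a small $N\prec\mathcal{G}$ containing $\bar c$ such that for every $q\in S(\nu_y|_N)$ the value $F(q):=\mu(\varphi(x\cdot d,\bar c))$ is the same for all $d\models q$ in $\mathcal{G}$, and $F:S(\nu_y|_N)\to[0,1]$ is Borel (this holds whenever $\mu$ is definable). Then $(\mu*\nu)(\varphi(x,\bar c)):=\int_{S(\nu_y|_N)}F\,d\nu_N$, where $\nu_N$ is the Borel measure $\nu_y|_N$ restricted to its support (this does not depend on $N$). $\mu$ is idempotent if $(\mu,\mu)$ is $*$-Borel and $\mu*\mu=\mu$. *)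

theory Defs
  imports "HOL-Probability.Probability" "HOL-Algebra.Group"
begin

unbundle cardinal_syntax

section \<open>Many-sorted first-order logic\<close>

text \<open>
  The sorts are the elements of the type \<open>'s\<close>. Free variables are named, and a variable is a pair
  of its sort and an index; bound variables are de Bruijn indices, so that substituting terms
  without loose bound variables for free variables cannot capture anything.
  Parameters are elements of the structure occurring as constants in terms.
\<close>

type_synonym 's var = "'s \<times> nat"

datatype ('s, 'f, 'a) trm =
    Free "'s var"
  | Bound nat
  | Par 'a
  | App 'f "('s, 'f, 'a) trm list"

datatype ('s, 'f, 'r, 'a) fm =
    Bot
  | Eql "('s, 'f, 'a) trm" "('s, 'f, 'a) trm"
  | Rel 'r "('s, 'f, 'a) trm list"
  | Neg "('s, 'f, 'r, 'a) fm"
  | Conj "('s, 'f, 'r, 'a) fm" "('s, 'f, 'r, 'a) fm"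
  | Exi 's "('s, 'f, 'r, 'a) fm"

abbreviation Top :: "('s, 'f, 'r, 'a) fm" where
  "Top \<equiv> Neg Bot"

abbreviation Disj ::
  "('s, 'f, 'r, 'a) fm \<Rightarrow> ('s, 'f, 'r, 'a) fm \<Rightarrow> ('s, 'f, 'r, 'a) fm" where
  "Disj \<phi> \<psi> \<equiv> Neg (Conj (Neg \<phi>) (Neg \<psi>))"

text \<open>
  A language with a distinguished sort and a distinguished function symbol for the group operation.
  Function and relation symbols outside the domains of \<open>fun_ty\<close> and \<open>rel_ty\<close> do not belong to
  the language.
\<close>

record ('s, 'f, 'r) lang =
  fun_ty :: "'f \<Rightarrow> ('s list \<times> 's) option"
  rel_ty :: "'r \<Rightarrow> 's list option"
  gsort :: 's
  gmul :: 'f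

text \<open>The universe is the disjoint union of all sorts; \<open>srt\<close> tells the sort of an element.\<close>

record ('s, 'f, 'r, 'a) struc =
  univ :: "'a set"
  srt :: "'a \<Rightarrow> 's"
  fun_in :: "'f \<Rightarrow> 'a list \<Rightarrow> 'a"
  rel_in :: "'r \<Rightarrow> 'a list \<Rightarrow> bool"

definition is_struc :: "('s, 'f, 'r) lang \<Rightarrow> ('s, 'f, 'r, 'a) struc \<Rightarrow> bool" where
  "is_struc L G \<longleftrightarrow>
     (\<forall>s. \<exists>a\<in>univ G. srt G a = s) \<and>
     (\<forall>f ss s as. fun_ty L f = Some (ss, s) \<and> set as \<subseteq> univ G \<and> map (srt G) as = ss \<longrightarrow>
        fun_in G f as \<in> univ G \<and> srt G (fun_in G f as) = s)"

text \<open>In \<open>trm_ok L G \<Gamma> t s\<close> the list \<open>\<Gamma>\<close> holds the sorts of the bound variables.\<close>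

inductive trm_ok ::
  "('s, 'f, 'r) lang \<Rightarrow> ('s, 'f, 'r, 'a) struc \<Rightarrow> 's list \<Rightarrow> ('s, 'f, 'a) trm \<Rightarrow> 's \<Rightarrow> bool"
  for L G \<Gamma> where
    "trm_ok L G \<Gamma> (Free x) (fst x)"
  | "i < length \<Gamma> \<Longrightarrow> trm_ok L G \<Gamma> (Bound i) (\<Gamma> ! i)"
  | "trm_ok L G \<Gamma> (Par a) (srt G a)"
  | "fun_ty L f = Some (ss, s) \<Longrightarrow> list_all2 (trm_ok L G \<Gamma>) ts ss \<Longrightarrow> trm_ok L G \<Gamma> (App f ts) s"

primrec fm_ok ::
  "('s, 'f, 'r) lang \<Rightarrow> ('s, 'f, 'r, 'a) struc \<Rightarrow> 's list \<Rightarrow> ('s, 'f, 'r, 'a) fm \<Rightarrow> bool" where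
  "fm_ok L G \<Gamma> Bot \<longleftrightarrow> True"
| "fm_ok L G \<Gamma> (Eql t u) \<longleftrightarrow> (\<exists>s. trm_ok L G \<Gamma> t s \<and> trm_ok L G \<Gamma> u s)"
| "fm_ok L G \<Gamma> (Rel r ts) \<longleftrightarrow> (\<exists>ss. rel_ty L r = Some ss \<and> list_all2 (trm_ok L G \<Gamma>) ts ss)"
| "fm_ok L G \<Gamma> (Neg \<phi>) \<longleftrightarrow> fm_ok L G \<Gamma> \<phi>"
| "fm_ok L G \<Gamma> (Conj \<phi> \<psi>) \<longleftrightarrow> fm_ok L G \<Gamma> \<phi> \<and> fm_ok L G \<Gamma> \<psi>"
| "fm_ok L G \<Gamma> (Exi s \<phi>) \<longleftrightarrow> fm_ok L G (s # \<Gamma>) \<phi>"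

primrec fv_trm :: "('s, 'f, 'a) trm \<Rightarrow> 's var set" where
  "fv_trm (Free x) = {x}"
| "fv_trm (Bound i) = {}"
| "fv_trm (Par a) = {}"
| "fv_trm (App f ts) = \<Union> (set (map fv_trm ts))"

primrec fv :: "('s, 'f, 'r, 'a) fm \<Rightarrow> 's var set" where
  "fv Bot = {}"
| "fv (Eql t u) = fv_trm t \<union> fv_trm u"
| "fv (Rel r ts) = \<Union> (set (map fv_trm ts))"
| "fv (Neg \<phi>) = fv \<phi>"
| "fv (Conj \<phi> \<psi>) = fv \<phi> \<union> fv \<psi>"
| "fv (Exi s \<phi>) = fv \<phi>"

primrec params_trm :: "('s, 'f, 'a) trm \<Rightarrow> 'a set" where
  "params_trm (Free x) = {}"
| "params_trm (Bound i) = {}"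
| "params_trm (Par a) = {a}"
| "params_trm (App f ts) = \<Union> (set (map params_trm ts))"

primrec params :: "('s, 'f, 'r, 'a) fm \<Rightarrow> 'a set" where
  "params Bot = {}"
| "params (Eql t u) = params_trm t \<union> params_trm u"
| "params (Rel r ts) = \<Union> (set (map params_trm ts))"
| "params (Neg \<phi>) = params \<phi>"
| "params (Conj \<phi> \<psi>) = params \<phi> \<union> params \<psi>"
| "params (Exi s \<phi>) = params \<phi>"

primrec subst_trm ::
  "('s var \<Rightarrow> ('s, 'f, 'a) trm) \<Rightarrow> ('s, 'f, 'a) trm \<Rightarrow> ('s, 'f, 'a) trm" where
  "subst_trm \<sigma> (Free x) = \<sigma> x"
| "subst_trm \<sigma> (Bound i) = Bound i"
| "subst_trm \<sigma> (Par a) = Par a"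
| "subst_trm \<sigma> (App f ts) = App f (map (subst_trm \<sigma>) ts)"

primrec subst ::
  "('s var \<Rightarrow> ('s, 'f, 'a) trm) \<Rightarrow> ('s, 'f, 'r, 'a) fm \<Rightarrow> ('s, 'f, 'r, 'a) fm" where
  "subst \<sigma> Bot = Bot"
| "subst \<sigma> (Eql t u) = Eql (subst_trm \<sigma> t) (subst_trm \<sigma> u)"
| "subst \<sigma> (Rel r ts) = Rel r (map (subst_trm \<sigma>) ts)"
| "subst \<sigma> (Neg \<phi>) = Neg (subst \<sigma> \<phi>)"
| "subst \<sigma> (Conj \<phi> \<psi>) = Conj (subst \<sigma> \<phi>) (subst \<sigma> \<psi>)"
| "subst \<sigma> (Exi s \<phi>) = Exi s (subst \<sigma> \<phi>)"

primrec eval_trm ::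
  "('s, 'f, 'r, 'a) struc \<Rightarrow> ('s var \<Rightarrow> 'a) \<Rightarrow> 'a list \<Rightarrow> ('s, 'f, 'a) trm \<Rightarrow> 'a" where
  "eval_trm G v e (Free x) = v x"
| "eval_trm G v e (Bound i) = e ! i"
| "eval_trm G v e (Par a) = a"
| "eval_trm G v e (App f ts) = fun_in G f (map (eval_trm G v e) ts)"

primrec sat ::
  "('s, 'f, 'r, 'a) struc \<Rightarrow> ('s var \<Rightarrow> 'a) \<Rightarrow> 'a list \<Rightarrow> ('s, 'f, 'r, 'a) fm \<Rightarrow> bool" where
  "sat G v e Bot \<longleftrightarrow> False"
| "sat G v e (Eql t u) \<longleftrightarrow> eval_trm G v e t = eval_trm G v e u"
| "sat G v e (Rel r ts) \<longleftrightarrow> rel_in G r (map (eval_trm G v e) ts)"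
| "sat G v e (Neg \<phi>) \<longleftrightarrow> \<not> sat G v e \<phi>"
| "sat G v e (Conj \<phi> \<psi>) \<longleftrightarrow> sat G v e \<phi> \<and> sat G v e \<psi>"
| "sat G v e (Exi s \<phi>) \<longleftrightarrow> (\<exists>a\<in>univ G. srt G a = s \<and> sat G v (a # e) \<phi>)"

text \<open>
  \<open>forms L G V A\<close> is the set of formulas in the variables \<open>V\<close> with parameters from \<open>A\<close>.
  A tuple in the variables \<open>V\<close> is an assignment, of which only the values on \<open>V\<close> matter.
\<close>

definition forms ::
  "('s, 'f, 'r) lang \<Rightarrow> ('s, 'f, 'r, 'a) struc \<Rightarrow> 's var set \<Rightarrow> 'a set \<Rightarrow> ('s, 'f, 'r, 'a) fm set" where
  "forms L G V A = {\<phi>. fm_ok L G [] \<phi> \<and> fv \<phi> \<subseteq> V \<and> params \<phi> \<subseteq> A}"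

definition tuple :: "('s, 'f, 'r, 'a) struc \<Rightarrow> 's var set \<Rightarrow> ('s var \<Rightarrow> 'a) \<Rightarrow> bool" where
  "tuple G V b \<longleftrightarrow> (\<forall>x\<in>V. b x \<in> univ G \<and> srt G (b x) = fst x)"

definition elem_substruc ::
  "('s, 'f, 'r) lang \<Rightarrow> ('s, 'f, 'r, 'a) struc \<Rightarrow> 'a set \<Rightarrow> bool" where
  "elem_substruc L G N \<longleftrightarrow>
     N \<subseteq> univ G \<and> is_struc L (G\<lparr>univ := N\<rparr>) \<and>
     (\<forall>\<phi>\<in>forms L G UNIV {}. \<forall>v. tuple (G\<lparr>univ := N\<rparr>) UNIV v \<longrightarrow>
        (sat (G\<lparr>univ := N\<rparr>) v [] \<phi> \<longleftrightarrow> sat G v [] \<phi>))"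


section \<open>Types, saturation and NIP\<close>

definition tp ::
  "('s, 'f, 'r) lang \<Rightarrow> ('s, 'f, 'r, 'a) struc \<Rightarrow> 's var set \<Rightarrow> ('s var \<Rightarrow> 'a) \<Rightarrow> 'a set
     \<Rightarrow> ('s, 'f, 'r, 'a) fm set" where
  "tp L G V b A = {\<phi>\<in>forms L G V A. sat G b [] \<phi>}"

text \<open>Consistency with the elementary diagram of \<open>G\<close> is expressed as finite satisfiability in \<open>G\<close>.\<close>

definition types ::
  "('s, 'f, 'r) lang \<Rightarrow> ('s, 'f, 'r, 'a) struc \<Rightarrow> 's var set \<Rightarrow> 'a set
     \<Rightarrow> ('s, 'f, 'r, 'a) fm set set" where
  "types L G V A =
     {p. p \<subseteq> forms L G V A \<and>
         (\<forall>\<phi>\<in>forms L G V A. \<phi> \<in> p \<or> Neg \<phi> \<in> p) \<and>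
         (\<forall>F. finite F \<and> F \<subseteq> p \<longrightarrow> (\<exists>b. tuple G V b \<and> (\<forall>\<phi>\<in>F. sat G b [] \<phi>)))}"

definition type_top ::
  "('s, 'f, 'r) lang \<Rightarrow> ('s, 'f, 'r, 'a) struc \<Rightarrow> 's var set \<Rightarrow> 'a set
     \<Rightarrow> ('s, 'f, 'r, 'a) fm set topology" where
  "type_top L G V A =
     topology_generated_by ((\<lambda>\<phi>. {p\<in>types L G V A. \<phi> \<in> p}) ` forms L G V A)"

text \<open>
  A set \<open>A\<close> is small if \<open>|A| <o \<kappa>\<close>. As there are infinitely many variables of each sort, the set of
  formulas without parameters has the cardinality of the language plus \<open>\<aleph>\<^sub>0\<close>.
\<close>

definition sufficiently_saturated ::
  "('s, 'f, 'r) lang \<Rightarrow> 'k rel \<Rightarrow> ('s, 'f, 'r, 'a) struc \<Rightarrow> bool" where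
  "sufficiently_saturated L \<kappa> G \<longleftrightarrow>
     Card_order \<kappa> \<and> |forms L G UNIV {}| <o \<kappa> \<and>
     (\<forall>A V p. A \<subseteq> univ G \<and> |A| <o \<kappa> \<and> finite V \<and> p \<in> types L G V A \<longrightarrow>
        (\<exists>b. tuple G V b \<and> p = tp L G V b A))"

text \<open>
  NIP for the complete theory of \<open>G\<close>: no partitioned formula, with variables split into \<open>V\<close> and
  \<open>W\<close>, shatters arbitrarily large finite sets.
\<close>

definition nip :: "('s, 'f, 'r) lang \<Rightarrow> ('s, 'f, 'r, 'a) struc \<Rightarrow> bool" where
  "nip L G \<longleftrightarrow>
     (\<forall>V W \<phi>. finite V \<and> finite W \<and> V \<inter> W = {} \<and> \<phi> \<in> forms L G (V \<union> W) {} \<longrightarrow>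
        \<not> (\<forall>n::nat. \<exists>a b. (\<forall>i<n. tuple G V (a i)) \<and> (\<forall>I\<subseteq>{..<n}. tuple G W (b I)) \<and>
              (\<forall>i<n. \<forall>I\<subseteq>{..<n}.
                 sat G (\<lambda>z. if z \<in> V then a i z else b I z) [] \<phi> \<longleftrightarrow> i \<in> I)))"


section \<open>Groups\<close>

definition expands_group :: "('s, 'f, 'r) lang \<Rightarrow> ('s, 'f, 'r, 'a) struc \<Rightarrow> bool" where
  "expands_group L G \<longleftrightarrow>
     fun_ty L (gmul L) = Some ([gsort L, gsort L], gsort L) \<and>
     (\<exists>e. group \<lparr>carrier = {a\<in>univ G. srt G a = gsort L},
                 mult = (\<lambda>a b. fun_in G (gmul L) [a, b]), one = e\<rparr>)"

definition abelian_struc :: "('s, 'f, 'r) lang \<Rightarrow> ('s, 'f, 'r, 'a) struc \<Rightarrow> bool" where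
  "abelian_struc L G \<longleftrightarrow>
     (\<forall>a\<in>univ G. \<forall>b\<in>univ G. srt G a = gsort L \<and> srt G b = gsort L \<longrightarrow>
        fun_in G (gmul L) [a, b] = fun_in G (gmul L) [b, a])"


section \<open>Keisler measures\<close>

definition xvar :: "('s, 'f, 'r) lang \<Rightarrow> 's var" where
  "xvar L = (gsort L, 0)"

abbreviation xforms ::
  "('s, 'f, 'r) lang \<Rightarrow> ('s, 'f, 'r, 'a) struc \<Rightarrow> 'a set \<Rightarrow> ('s, 'f, 'r, 'a) fm set" where
  "xforms L G A \<equiv> forms L G {xvar L} A"

abbreviation xtypes ::
  "('s, 'f, 'r) lang \<Rightarrow> ('s, 'f, 'r, 'a) struc \<Rightarrow> 'a set \<Rightarrow> ('s, 'f, 'r, 'a) fm set set" where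
  "xtypes L G A \<equiv> types L G {xvar L} A"

text \<open>\<open>holds G a \<phi>\<close> is \<open>G \<Turnstile> \<phi>(a)\<close>, for a formula \<open>\<phi>\<close> with at most one free variable.\<close>

definition holds :: "('s, 'f, 'r, 'a) struc \<Rightarrow> 'a \<Rightarrow> ('s, 'f, 'r, 'a) fm \<Rightarrow> bool" where
  "holds G a \<phi> \<longleftrightarrow> sat G (\<lambda>_. a) [] \<phi>"

definition gelems :: "('s, 'f, 'r) lang \<Rightarrow> ('s, 'f, 'r, 'a) struc \<Rightarrow> 'a set" where
  "gelems L G = {a\<in>univ G. srt G a = gsort L}"

text \<open>
  A finitely additive probability measure on the Boolean algebra of formulas modulo equivalence is
  a function on formulas respecting equivalence. Its values outside \<open>xforms L G A\<close> are irrelevant, so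
  two measures over \<open>A\<close> are equal iff they agree on \<open>xforms L G A\<close>, and the restriction of a measure
  to a smaller parameter set is the same function.
\<close>

definition keisler ::
  "('s, 'f, 'r) lang \<Rightarrow> ('s, 'f, 'r, 'a) struc \<Rightarrow> 'a set \<Rightarrow> (('s, 'f, 'r, 'a) fm \<Rightarrow> real) set" where
  "keisler L G A =
     {\<mu>. (\<forall>\<phi>\<in>xforms L G A. 0 \<le> \<mu> \<phi>) \<and> \<mu> Top = 1 \<and>
         (\<forall>\<phi>\<in>xforms L G A. \<forall>\<psi>\<in>xforms L G A.
            (\<forall>a\<in>gelems L G. holds G a \<phi> \<longleftrightarrow> holds G a \<psi>) \<longrightarrow> \<mu> \<phi> = \<mu> \<psi>) \<and>
         (\<forall>\<phi>\<in>xforms L G A. \<forall>\<psi>\<in>xforms L G A.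
            (\<forall>a\<in>gelems L G. \<not> (holds G a \<phi> \<and> holds G a \<psi>)) \<longrightarrow>
            \<mu> (Disj \<phi> \<psi>) = \<mu> \<phi> + \<mu> \<psi>)}"

definition msupport ::
  "('s, 'f, 'r) lang \<Rightarrow> ('s, 'f, 'r, 'a) struc \<Rightarrow> (('s, 'f, 'r, 'a) fm \<Rightarrow> real) \<Rightarrow> 'a set
     \<Rightarrow> ('s, 'f, 'r, 'a) fm set set" where
  "msupport L G \<mu> A = {p\<in>xtypes L G A. \<forall>\<phi>\<in>p. \<mu> \<phi> > 0}"

definition borel_of_top :: "'b topology \<Rightarrow> 'b measure" where
  "borel_of_top X = sigma (topspace X) {U. openin X U}"

definition regular_borel_prob :: "'b topology \<Rightarrow> 'b measure \<Rightarrow> bool" where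
  "regular_borel_prob X m \<longleftrightarrow>
     space m = topspace X \<and> sets m = sets (borel_of_top X) \<and> prob_space m \<and>
     (\<forall>B\<in>sets m.
        emeasure m B = (SUP K\<in>{K. compactin X K \<and> K \<in> sets m \<and> K \<subseteq> B}. emeasure m K) \<and>
        emeasure m B = (INF U\<in>{U. openin X U \<and> B \<subseteq> U}. emeasure m U))"

text \<open>The regular Borel probability measure on the space of types over \<open>A\<close> identified with \<open>\<mu>|\<^sub>A\<close>.\<close>

definition borel_ext ::
  "('s, 'f, 'r) lang \<Rightarrow> ('s, 'f, 'r, 'a) struc \<Rightarrow> (('s, 'f, 'r, 'a) fm \<Rightarrow> real) \<Rightarrow> 'a set
     \<Rightarrow> ('s, 'f, 'r, 'a) fm set measure" where
  "borel_ext L G \<mu> A =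
     (THE m. regular_borel_prob (type_top L G {xvar L} A) m \<and>
             (\<forall>\<phi>\<in>xforms L G A. measure m {p\<in>xtypes L G A. \<phi> \<in> p} = \<mu> \<phi>))"


section \<open>Definable and finitely satisfiable measures\<close>

definition inst ::
  "'s var set \<Rightarrow> ('s var \<Rightarrow> 'a) \<Rightarrow> ('s, 'f, 'r, 'a) fm \<Rightarrow> ('s, 'f, 'r, 'a) fm" where
  "inst V b = subst (\<lambda>z. if z \<in> V then Par (b z) else Free z)"

text \<open>
  For small \<open>M\<close> every type over \<open>M\<close> in the variables \<open>V\<close> is realised by some \<open>b\<close>, so that \<open>F\<close> below
  is uniquely determined on the type space.
\<close>

definition definable_over ::
  "('s, 'f, 'r) lang \<Rightarrow> ('s, 'f, 'r, 'a) struc \<Rightarrow> (('s, 'f, 'r, 'a) fm \<Rightarrow> real) \<Rightarrow> 'a set \<Rightarrow> bool"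
  where
  "definable_over L G \<mu> M \<longleftrightarrow>
     (\<forall>V \<phi>. finite V \<and> xvar L \<notin> V \<and> \<phi> \<in> forms L G (insert (xvar L) V) M \<longrightarrow>
        (\<exists>F. continuous_map (type_top L G V M) euclideanreal F \<and>
             (\<forall>b. tuple G V b \<longrightarrow> \<mu> (inst V b \<phi>) = F (tp L G V b M))))"

definition fin_sat_in ::
  "('s, 'f, 'r) lang \<Rightarrow> ('s, 'f, 'r, 'a) struc \<Rightarrow> (('s, 'f, 'r, 'a) fm \<Rightarrow> real) \<Rightarrow> 'a set \<Rightarrow> bool"
  where
  "fin_sat_in L G \<mu> M \<longleftrightarrow>
     (\<forall>\<phi>\<in>xforms L G (univ G). \<mu> \<phi> > 0 \<longrightarrow> (\<exists>a\<in>gelems L G \<inter> M. holds G a \<phi>))"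

definition dfs ::
  "('s, 'f, 'r) lang \<Rightarrow> 'k rel \<Rightarrow> ('s, 'f, 'r, 'a) struc \<Rightarrow> (('s, 'f, 'r, 'a) fm \<Rightarrow> real) \<Rightarrow> bool"
  where
  "dfs L \<kappa> G \<mu> \<longleftrightarrow>
     (\<exists>M. elem_substruc L G M \<and> |M| <o \<kappa> \<and> definable_over L G \<mu> M \<and> fin_sat_in L G \<mu> M)"


section \<open>Convolution\<close>

text \<open>\<open>translate L d \<phi>\<close> is the formula \<open>\<phi>(x \<cdot> d)\<close>.\<close>

definition translate ::
  "('s, 'f, 'r) lang \<Rightarrow> 'a \<Rightarrow> ('s, 'f, 'r, 'a) fm \<Rightarrow> ('s, 'f, 'r, 'a) fm" where
  "translate L d =
     subst (\<lambda>z. if z = xvar L then App (gmul L) [Free (xvar L), Par d] else Free z)"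

definition realises ::
  "('s, 'f, 'r) lang \<Rightarrow> ('s, 'f, 'r, 'a) struc \<Rightarrow> 'a \<Rightarrow> ('s, 'f, 'r, 'a) fm set \<Rightarrow> bool" where
  "realises L G d q \<longleftrightarrow> d \<in> gelems L G \<and> (\<forall>\<psi>\<in>q. holds G d \<psi>)"

text \<open>
  The function \<open>F\<close> sending a type \<open>q\<close> to \<open>\<mu>(\<phi>(x \<cdot> d))\<close> for \<open>d \<Turnstile> q\<close>. Types enter only through their
  realisations, so there is no need to rename the variable of the second measure.
\<close>

definition fibre ::
  "('s, 'f, 'r) lang \<Rightarrow> ('s, 'f, 'r, 'a) struc \<Rightarrow> (('s, 'f, 'r, 'a) fm \<Rightarrow> real) \<Rightarrow>
     ('s, 'f, 'r, 'a) fm \<Rightarrow> ('s, 'f, 'r, 'a) fm set \<Rightarrow> real" where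
  "fibre L G \<mu> \<phi> q = \<mu> (translate L (SOME d. realises L G d q) \<phi>)"

definition admissible ::
  "('s, 'f, 'r) lang \<Rightarrow> 'k rel \<Rightarrow> ('s, 'f, 'r, 'a) struc \<Rightarrow> (('s, 'f, 'r, 'a) fm \<Rightarrow> real) \<Rightarrow>
     (('s, 'f, 'r, 'a) fm \<Rightarrow> real) \<Rightarrow> ('s, 'f, 'r, 'a) fm \<Rightarrow> 'a set \<Rightarrow> bool" where
  "admissible L \<kappa> G \<mu> \<nu> \<phi> N \<longleftrightarrow>
     elem_substruc L G N \<and> |N| <o \<kappa> \<and> params \<phi> \<subseteq> N \<and>
     (\<forall>q\<in>msupport L G \<nu> N. \<forall>d. realises L G d q \<longrightarrow> \<mu> (translate L d \<phi>) = fibre L G \<mu> \<phi> q) \<and>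
     fibre L G \<mu> \<phi> \<in> borel_measurable
       (borel_of_top (subtopology (type_top L G {xvar L} N) (msupport L G \<nu> N)))"

definition star_borel ::
  "('s, 'f, 'r) lang \<Rightarrow> 'k rel \<Rightarrow> ('s, 'f, 'r, 'a) struc \<Rightarrow> (('s, 'f, 'r, 'a) fm \<Rightarrow> real) \<Rightarrow>
     (('s, 'f, 'r, 'a) fm \<Rightarrow> real) \<Rightarrow> bool" where
  "star_borel L \<kappa> G \<mu> \<nu> \<longleftrightarrow> (\<forall>\<phi>\<in>xforms L G (univ G). \<exists>N. admissible L \<kappa> G \<mu> \<nu> \<phi> N)"

text \<open>
  The value does not depend on the choice of the admissible submodel. It is meaningful for formulas
  over \<open>G\<close> and pairs satisfying \<open>star_borel\<close>.
\<close>

definition keisler_conv ::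
  "('s, 'f, 'r) lang \<Rightarrow> 'k rel \<Rightarrow> ('s, 'f, 'r, 'a) struc \<Rightarrow> (('s, 'f, 'r, 'a) fm \<Rightarrow> real) \<Rightarrow>
     (('s, 'f, 'r, 'a) fm \<Rightarrow> real) \<Rightarrow> ('s, 'f, 'r, 'a) fm \<Rightarrow> real" where
  "keisler_conv L \<kappa> G \<mu> \<nu> \<phi> =
     (let N = SOME N. admissible L \<kappa> G \<mu> \<nu> \<phi> N
      in LINT q | restrict_space (borel_ext L G \<nu> N) (msupport L G \<nu> N). fibre L G \<mu> \<phi> q)"

definition idem_measure ::
  "('s, 'f, 'r) lang \<Rightarrow> 'k rel \<Rightarrow> ('s, 'f, 'r, 'a) struc \<Rightarrow> (('s, 'f, 'r, 'a) fm \<Rightarrow> real) \<Rightarrow> bool"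
  where
  "idem_measure L \<kappa> G \<mu> \<longleftrightarrow>
     star_borel L \<kappa> G \<mu> \<mu> \<and> (\<forall>\<phi>\<in>xforms L G (univ G). keisler_conv L \<kappa> G \<mu> \<mu> \<phi> = \<mu> \<phi>)"

end

theory Submission
  imports Defs "HOL-Real_Asymp.Real_Asymp"
begin

text \<open>
  A Keisler measure on the group is a finitely additive probability measure (a charge) on the algebra
  of definable subsets of the group, and the convolution of \<open>\<mu>\<close> and \<open>\<nu>\<close> gives a definable set \<open>A\<close> the
  integral with respect to \<open>\<nu>\<close> of \<open>d \<mapsto> \<mu> {x. x \<cdot> d \<in> A}\<close>. For definable charges convolution is associative
  (\<open>conv_assoc\<close>): both bracketings are the same iterated integral. So once \<open>\<mu>\<close> and \<open>\<nu>\<close> commute, the square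
  of \<open>\<mu> * \<nu>\<close> is \<open>(\<mu> * \<mu>) * (\<nu> * \<nu>)\<close>, which is \<open>\<mu> * \<nu>\<close> for idempotent \<open>\<mu>\<close> and \<open>\<nu>\<close> (\<open>conv_idempotent\<close>).

  In an abelian group, commuting means that the two orders of integrating the indicator function of
  \<open>x \<cdot> d \<in> A\<close> agree, and this is where NIP and finite satisfiability enter (\<open>fint_swap\<close>). Let \<open>M\<close> be a small
  model in which \<open>\<nu>\<close> is finitely satisfiable. By NIP and the Sauer-Shelah lemma, the sets
  \<open>{x. x \<cdot> d \<in> A}\<close> leave only polynomially many traces on finite samples, so \<open>\<mu>\<close> is approximated
  within \<open>\<epsilon>\<close> by the frequencies of a sample whose size depends on \<open>A\<close> and \<open>\<epsilon>\<close> only: for finitely many \<open>d\<close> by a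
  discrepancy argument (\<open>ex_uniform_sample\<close>), and then, by saturation, for all \<open>d \<in> M\<close> simultaneously
  (\<open>compact_family_vsets\<close>). Given such sample points \<open>a\<^sub>i\<close>, finite satisfiability provides
  finitely many weighted points of \<open>M\<close> that measure the finitely many sets \<open>{d. a\<^sub>i \<cdot> d \<in> A}\<close> exactly as
  \<open>\<nu>\<close> does. Up to \<open>\<epsilon>\<close>, both iterated integrals have become the same finite double sum.

  The functions to be integrated are continuous functions of types over small models; on the level of
  elements these are the functions that oscillate arbitrarily little on the cells of suitable finite
  definable covers (\<open>tmeas\<close>), and their integral against a charge is a limit of finite averages
  (\<open>fint\<close>). Convolution of Keisler measures is instead a Lebesgue integral over the support of the
  regular Borel measure on a type space, for some admissible submodel. The two agree
  (\<open>integral_fibre\<close>): the regular Borel measure exists and is unique on any Stone space, and passing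
  to a larger parameter set amounts to pushing it forward.

  Finally, over a common small elementary submodel (downward Loewenheim-Skolem), definability and
  finite satisfiability pass from \<open>\<mu>\<close> and \<open>\<nu>\<close> to \<open>\<mu> * \<nu>\<close> (\<open>uniformly_definable_conv\<close>, \<open>fin_sat_in_conv\<close>).
\<close>

section \<open>Families of sets with polynomially many traces\<close>

definition shatters :: "'x set set \<Rightarrow> 'x set \<Rightarrow> bool" where
  "shatters F Y \<longleftrightarrow> (\<forall>Z\<subseteq>Y. \<exists>A\<in>F. A \<inter> Y = Z)"

lemma shatters_mono: "shatters F Y \<Longrightarrow> Y' \<subseteq> Y \<Longrightarrow> shatters F Y'"
  unfolding shatters_def
proof (intro allI impI)
  fix Z assume *: "\<forall>Z\<subseteq>Y. \<exists>A\<in>F. A \<inter> Y = Z" "Y' \<subseteq> Y" "Z \<subseteq> Y'"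
  then obtain A where "A \<in> F" "A \<inter> Y = Z" by (meson order_trans)
  with * show "\<exists>A\<in>F. A \<inter> Y' = Z" by (intro bexI[of _ A]) auto
qed

text \<open>
  Pajor's form of the Sauer-Shelah lemma. Split \<open>F\<close> into the members avoiding \<open>x\<close> and the members
  containing \<open>x\<close>, with \<open>x\<close> removed. A set shattered by one of the parts is shattered by \<open>F\<close>, and if both
  parts shatter \<open>Y\<close>, then \<open>F\<close> moreover shatters \<open>insert x Y\<close>; so \<open>F\<close> shatters at least as many sets as
  the two parts together.
\<close>

lemma card_le_shattered:
  assumes "finite S" "F \<subseteq> Pow S"
  shows "card F \<le> card {Y \<in> Pow S. shatters F Y}"
  using assms
proof (induction S arbitrary: F rule: finite_induct)
  case empty
  then have "F = {} \<or> F = {{}}" by (simp add: subset_singleton_iff)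
  moreover have "{Y \<in> Pow {}. shatters {{}} Y} = {{} :: 'a set}" by (auto simp: shatters_def)
  ultimately show ?case by (elim disjE) simp_all
next
  case (insert x S)
  define F0 where "F0 = {A \<in> F. x \<notin> A}"
  define F1 where "F1 = (\<lambda>A. A - {x}) ` {A \<in> F. x \<in> A}"
  define sh where "sh F = {Y \<in> Pow S. shatters F Y}" for F
  have finF: "finite F" using insert.prems insert.hyps(1) finite_subset by fastforce
  have sub: "F0 \<subseteq> Pow S" "F1 \<subseteq> Pow S" using insert.prems by (auto simp: F0_def F1_def)
  have fin: "finite (sh F')" for F' using insert.hyps(1) by (auto simp: sh_def)
  have notin: "x \<notin> Y" if "Y \<in> sh F'" for Y F' using that insert.hyps(2) by (auto simp: sh_def)
  have inj: "inj_on (insert x) (sh F0 \<inter> sh F1)"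
    using notin[of _ F0] by (intro inj_onI) (metis IntD1 insert_ident)
  have disj: "(sh F0 \<union> sh F1) \<inter> insert x ` (sh F0 \<inter> sh F1) = {}"
    using notin[of "insert x _" F0] notin[of "insert x _" F1] by blast
  have "inj_on (\<lambda>A. A - {x}) {A \<in> F. x \<in> A}" by (auto simp: inj_on_def)
  then have "card F1 = card {A \<in> F. x \<in> A}" by (simp add: F1_def card_image)
  moreover have "F = F0 \<union> {A \<in> F. x \<in> A}" by (auto simp: F0_def)
  then have "card F = card F0 + card {A \<in> F. x \<in> A}"
    using finF by (subst \<open>F = _\<close>, subst card_Un_disjoint) (auto simp: F0_def)
  ultimately have "card F = card F0 + card F1" by simp
  also have "\<dots> \<le> card (sh F0) + card (sh F1)"
    using insert.IH[OF sub(1)] insert.IH[OF sub(2)] by (simp add: sh_def)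
  also have "\<dots> = card (sh F0 \<union> sh F1) + card (sh F0 \<inter> sh F1)"
    by (rule card_Un_Int) (auto simp: fin)
  also have "card (sh F0 \<inter> sh F1) = card (insert x ` (sh F0 \<inter> sh F1))"
    by (rule card_image[symmetric]) (rule inj)
  also have "card (sh F0 \<union> sh F1) + \<dots> = card ((sh F0 \<union> sh F1) \<union> insert x ` (sh F0 \<inter> sh F1))"
    using notin by (intro card_Un_disjoint[OF _ _ disj, symmetric]) (simp_all add: fin)
  also have "\<dots> \<le> card {Y \<in> Pow (insert x S). shatters F Y}"
  proof (rule card_mono)
    show "finite {Y \<in> Pow (insert x S). shatters F Y}" using insert.hyps(1) by auto
    have 0: "shatters F Y" if "Y \<in> sh F0" for Y
      using that unfolding sh_def shatters_def F0_def by blast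
    have 1: "shatters F Y" if Y: "Y \<in> sh F1" for Y
      unfolding shatters_def
    proof (intro allI impI)
      fix Z assume "Z \<subseteq> Y"
      then obtain A where A: "A \<in> F1" "A \<inter> Y = Z" using Y unfolding sh_def shatters_def by blast
      then obtain B where "B \<in> F" "A = B - {x}" by (auto simp: F1_def)
      then show "\<exists>A\<in>F. A \<inter> Y = Z" using A(2) notin[OF Y] by blast
    qed
    have 2: "shatters F (insert x Y)" if Y: "Y \<in> sh F0" "Y \<in> sh F1" for Y
      unfolding shatters_def
    proof (intro allI impI)
      fix Z assume Z: "Z \<subseteq> insert x Y"
      then have Zx: "Z - {x} \<subseteq> Y" by blast
      show "\<exists>A\<in>F. A \<inter> insert x Y = Z"
      proof (cases "x \<in> Z")
        case True
        obtain A where A: "A \<in> F1" "A \<inter> Y = Z - {x}"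
          using Y(2) Zx unfolding sh_def shatters_def by blast
        then obtain B where "B \<in> F" "x \<in> B" "A = B - {x}" by (auto simp: F1_def)
        then show ?thesis using A(2) True notin[OF Y(1)] by (intro bexI[of _ B]) blast+
      next
        case False
        obtain A where "A \<in> F0" "A \<inter> Y = Z - {x}"
          using Y(1) Zx unfolding sh_def shatters_def by blast
        then show ?thesis using False by (intro bexI[of _ A]) (auto simp: F0_def)
      qed
    qed
    show "sh F0 \<union> sh F1 \<union> insert x ` (sh F0 \<inter> sh F1) \<subseteq> {Y \<in> Pow (insert x S). shatters F Y}"
      using 0 1 2 by (auto simp: sh_def)
  qed
  finally show ?case .
qed

lemma card_subsets_le:
  "finite {Y. Y \<subseteq> {..<n::nat} \<and> card Y \<le> d} \<and> card {Y. Y \<subseteq> {..<n} \<and> card Y \<le> d} \<le> (n + 1) ^ d"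
proof (induction d)
  case 0
  have "{Y. Y \<subseteq> {..<n} \<and> card Y \<le> 0} = {{}}"
    by (auto simp: finite_subset[OF _ finite_lessThan])
  then show ?case by simp
next
  case (Suc d)
  let ?A = "\<lambda>d. {Y. Y \<subseteq> {..<n} \<and> card Y \<le> d}"
  have sub: "?A (Suc d) \<subseteq> ?A d \<union> (\<lambda>(i, Y). insert i Y) ` ({..<n} \<times> ?A d)"
  proof
    fix Y assume Y: "Y \<in> ?A (Suc d)"
    then have fin: "finite Y" by (auto intro: finite_subset)
    show "Y \<in> ?A d \<union> (\<lambda>(i, Y). insert i Y) ` ({..<n} \<times> ?A d)"
    proof (cases "Y = {}")
      case False
      then obtain i where i: "i \<in> Y" by auto
      have "Y = insert i (Y - {i})" "Y - {i} \<in> ?A d" "i < n"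
        using i Y fin by (auto simp: card_Diff_singleton)
      then show ?thesis by (intro UnI2 rev_image_eqI[of "(i, Y - {i})"]) auto
    qed auto
  qed
  have fin: "finite (?A d)" using Suc.IH by blast
  have "card (?A (Suc d)) \<le> card (?A d \<union> (\<lambda>(i, Y). insert i Y) ` ({..<n} \<times> ?A d))"
    using sub fin by (intro card_mono) auto
  also have "\<dots> \<le> card (?A d) + card ({..<n} \<times> ?A d)"
    using fin by (intro order_trans[OF card_Un_le] add_left_mono card_image_le) auto
  also have "\<dots> = (n + 1) * card (?A d)" by (simp add: card_cartesian_product)
  also have "\<dots> \<le> (n + 1) * (n + 1) ^ d" using Suc.IH by (intro mult_le_mono) auto
  finally show ?case using finite_subset[OF sub] fin by auto
qed

text \<open>
  The sets in \<open>\<C>\<close> as they are seen by the sample \<open>a 0, \<dots>, a (n - 1)\<close>.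
\<close>

definition traces :: "'x set set \<Rightarrow> nat \<Rightarrow> (nat \<Rightarrow> 'x) \<Rightarrow> nat set set" where
  "traces \<C> n a = (\<lambda>C. {i\<in>{..<n}. a i \<in> C}) ` \<C>"

lemma finite_traces: "finite (traces \<C> n a)"
  by (rule finite_subset[of _ "Pow {..<n}"]) (auto simp: traces_def)

text \<open>
  A shattered set with more than \<open>d\<close> indices would contain one with exactly \<open>d + 1\<close>; so only sets of at
  most \<open>d\<close> indices are shattered, and these are polynomially many.
\<close>

lemma card_traces_le:
  assumes "\<And>Y. Y \<subseteq> {..<n} \<Longrightarrow> shatters (traces \<C> n a) Y \<Longrightarrow> card Y \<noteq> Suc d"
  shows "card (traces \<C> n a) \<le> (n + 1) ^ d"
proof -
  have "card (traces \<C> n a) \<le> card {Y \<in> Pow {..<n}. shatters (traces \<C> n a) Y}"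
    by (rule card_le_shattered) (auto simp: traces_def)
  also have "\<dots> \<le> card {Y. Y \<subseteq> {..<n} \<and> card Y \<le> d}"
  proof (rule card_mono)
    show "finite {Y. Y \<subseteq> {..<n} \<and> card Y \<le> d}" by (auto intro: finite_subset[of _ "Pow {..<n}"])
    show "{Y \<in> Pow {..<n}. shatters (traces \<C> n a) Y} \<subseteq> {Y. Y \<subseteq> {..<n} \<and> card Y \<le> d}"
    proof safe
      fix Y assume Y: "Y \<subseteq> {..<n}" "shatters (traces \<C> n a) Y"
      show "card Y \<le> d"
      proof (rule ccontr)
        assume "\<not> card Y \<le> d"
        then obtain Y' where "Y' \<subseteq> Y" "card Y' = Suc d"
          by (metis not_less_eq_eq obtain_subset_with_card_n)
        then show False using assms[of Y'] Y shatters_mono by blast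
      qed
    qed
  qed
  also have "\<dots> \<le> (n + 1) ^ d" using card_subsets_le by blast
  finally show ?thesis .
qed

section \<open>Samples of bounded size\<close>

definition freq :: "nat \<Rightarrow> (nat \<Rightarrow> 'x) \<Rightarrow> 'x set \<Rightarrow> real" where
  "freq n a C = real (card {i\<in>{..<n}. a i \<in> C}) / n"

lemma freq_eq_sum: "freq n a C = (\<Sum>i<n. indicator C (a i)) / n"
proof -
  have "(\<Sum>i<n. indicator C (a i) :: real) = (\<Sum>i\<in>{i\<in>{..<n}. a i \<in> C}. 1)"
    by (rule sum.mono_neutral_cong_right) (auto simp: indicator_def)
  then show ?thesis by (simp add: freq_def)
qed

lemma cosh_le_exp_square:
  fixes x :: real
  assumes "0 \<le> x" "x \<le> 1"
  shows "cosh x \<le> exp (x\<^sup>2)"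
proof -
  have up: "exp x \<le> 1 + x + x\<^sup>2" using exp_bound assms by simp
  have lo: "1 + x + x\<^sup>2 / 2 \<le> exp x" using exp_lower_Taylor_quadratic assms by simp
  have "1 \<le> (1 - x + x\<^sup>2) * (1 + x + x\<^sup>2 / 2)"
  proof -
    have "(1 - x + x\<^sup>2) * (1 + x + x\<^sup>2 / 2) = 1 + x\<^sup>2 / 2 + x^3 / 2 + x^4 / 2"
      by (simp add: field_simps power2_eq_square power3_eq_cube power4_eq_xxxx)
    then show ?thesis using assms by simp
  qed
  also have "\<dots> \<le> (1 - x + x\<^sup>2) * exp x" using lo assms by (intro mult_left_mono) auto
  finally have "exp (- x) \<le> 1 - x + x\<^sup>2" by (simp add: exp_minus field_simps)
  then have "cosh x \<le> 1 + x\<^sup>2" using up by (simp add: cosh_def)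
  also have "\<dots> \<le> exp (x\<^sup>2)" by (rule exp_ge_add_one_self)
  finally show ?thesis .
qed

text \<open>
  The method of conditional expectations. When the next sign is chosen, the mean over both choices of the
  potential on the left is at most \<open>cosh l\<close> times its present value, because
  \<open>cosh (u + v) + cosh (u - v) = 2 * cosh u * cosh v\<close>. So one of the choices is good enough.
\<close>

lemma signs_small_discrepancy:
  fixes c :: "'c \<Rightarrow> nat \<Rightarrow> real"
  assumes "finite F" and "\<And>A i. A \<in> F \<Longrightarrow> \<bar>c A i\<bar> \<le> 1" and "0 \<le> l"
  shows "\<exists>s. (\<forall>i. s i \<in> {1, -1}) \<and>
           (\<Sum>A\<in>F. cosh (l * (\<Sum>i<k. s i * c A i))) \<le> card F * cosh l ^ k"
proof (induction k)
  case 0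
  show ?case by (rule exI[of _ "\<lambda>_. 1"]) simp
next
  case (Suc k)
  then obtain s where s: "\<And>i. s i \<in> {1, -1 :: real}"
    and le: "(\<Sum>A\<in>F. cosh (l * (\<Sum>i<k. s i * c A i))) \<le> card F * cosh l ^ k" by blast
  define S where "S A = l * (\<Sum>i<k. s i * c A i)" for A
  define \<Phi> where "\<Phi> e = (\<Sum>A\<in>F. cosh (S A + l * (e * c A k)))" for e :: real
  have "(\<Phi> 1 + \<Phi> (-1)) / 2 = (\<Sum>A\<in>F. cosh (S A) * cosh (l * c A k))"
    by (simp add: \<Phi>_def cosh_add cosh_diff sum_distrib_left[symmetric] flip: sum.distrib)
  also have "\<dots> \<le> (\<Sum>A\<in>F. cosh (S A) * cosh l)"
  proof (intro sum_mono mult_left_mono)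
    fix A assume "A \<in> F"
    then have "\<bar>l * c A k\<bar> \<le> l" using assms by (auto simp: abs_mult mult_left_le)
    then have "cosh \<bar>l * c A k\<bar> \<le> cosh l" using assms(3)
      by (subst cosh_real_nonneg_le_iff) auto
    then show "cosh (l * c A k) \<le> cosh l" by simp
  qed auto
  also have "\<dots> \<le> card F * cosh l ^ k * cosh l"
    using le by (simp add: S_def mult_right_mono flip: sum_distrib_right)
  finally have "\<Phi> 1 \<le> card F * cosh l ^ Suc k \<or> \<Phi> (-1) \<le> card F * cosh l ^ Suc k"
    by (auto simp: mult_ac)
  then obtain e where e: "e \<in> {1, -1 :: real}" "\<Phi> e \<le> card F * cosh l ^ Suc k" by blast
  have "(\<Sum>A\<in>F. cosh (l * (\<Sum>i<Suc k. (s(k := e)) i * c A i))) = \<Phi> e"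
    unfolding \<Phi>_def S_def by (intro sum.cong refl arg_cong[of _ _ cosh]) (simp add: distrib_left)
  then show ?case using s e by (intro exI[of _ "s(k := e)"]) auto
qed

text \<open>
  Keep one point of each pair of consecutive sample points. The frequency of \<open>C\<close> then changes by a signed
  sum of differences within the pairs, divided by \<open>2 * k\<close>. If one of these sums exceeded \<open>t * k\<close>, the
  potential with \<open>l = t / 2\<close> would be larger than the number of traces permits.
\<close>

lemma halve_sample:
  assumes "0 < t" "t \<le> 2" and few: "2 * real (card (traces \<C> (2 * k) a)) < exp (t\<^sup>2 * k / 4)"
  shows "\<exists>a'. (\<forall>i<k. a' i \<in> a ` {..<2*k}) \<and> (\<forall>C\<in>\<C>. \<bar>freq k a' C - freq (2 * k) a C\<bar> \<le> t / 2)"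
proof -
  define F where "F = traces \<C> (2 * k) a"
  define c where "c T i = (indicator T (2*i) - indicator T (2*i+1) :: real)" for T :: "nat set" and i
  have finF: "finite F" by (simp add: F_def finite_traces)
  obtain s where s: "\<And>i. s i \<in> {1, -1 :: real}"
    and le: "(\<Sum>T\<in>F. cosh (t / 2 * (\<Sum>i<k. s i * c T i))) \<le> card F * cosh (t / 2) ^ k"
    using signs_small_discrepancy[OF finF, of c "t/2" k] assms by (force simp: c_def indicator_def)
  define a' where "a' i = (if s i = 1 then a (2*i) else a (2*i+1))" for i
  have "\<bar>freq k a' C - freq (2 * k) a C\<bar> \<le> t / 2" if "C \<in> \<C>" for C
  proof (cases "k = 0")
    case False
    define T where "T = {i\<in>{..<2*k}. a i \<in> C}"
    define D where "D = (\<Sum>i<k. s i * c T i)"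
    have "T \<in> F" using that by (auto simp: F_def traces_def T_def)
    have "cosh (t / 2 * \<bar>D\<bar>) = cosh (t / 2 * D)"
      by (metis abs_mult abs_of_pos assms(1) cosh_real_abs half_gt_zero)
    also have "\<dots> \<le> (\<Sum>T\<in>F. cosh (t / 2 * (\<Sum>i<k. s i * c T i)))"
      unfolding D_def using finF \<open>T \<in> F\<close>
      by (intro member_le_sum[of T F "\<lambda>T. cosh (t / 2 * (\<Sum>i<k. s i * c T i))"]) auto
    also have "\<dots> \<le> card F * cosh (t / 2) ^ k" by (rule le)
    also have "\<dots> \<le> card F * exp ((t/2)\<^sup>2) ^ k"
      using assms by (intro mult_left_mono power_mono cosh_le_exp_square) auto
    also have "exp ((t/2)\<^sup>2) ^ k = exp (t\<^sup>2 * k / 4)"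
      by (simp add: power_divide mult.commute flip: exp_of_nat_mult)
    finally have "cosh (t / 2 * \<bar>D\<bar>) \<le> card F * exp (t\<^sup>2 * k / 4)" .
    moreover have "exp (t / 2 * \<bar>D\<bar>) / 2 \<le> cosh (t / 2 * \<bar>D\<bar>)" by (simp add: cosh_def)
    ultimately have "exp (t / 2 * \<bar>D\<bar>) \<le> 2 * real (card F) * exp (t\<^sup>2 * k / 4)" by simp
    also have "\<dots> < exp (t\<^sup>2 * k / 4) * exp (t\<^sup>2 * k / 4)"
      using few by (intro mult_strict_right_mono) (auto simp: F_def)
    also have "\<dots> = exp (t / 2 * (t * k))" by (simp add: power2_eq_square flip: exp_add)
    finally have D: "\<bar>D\<bar> \<le> t * k" using assms by simp
    have split: "(\<Sum>i<2*n. g i) = (\<Sum>i<n. g (2*i) + g (2*i+1))" for n and g :: "nat \<Rightarrow> real"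
      by (induction n) auto
    have ind: "indicator C (a i) = (indicator T i :: real)" if "i < 2 * k" for i
      using that by (auto simp: T_def indicator_def)
    have "(\<Sum>i<k. indicator C (a' i)) - (\<Sum>i<2*k. indicator C (a i)) / 2 = D / 2"
      unfolding split D_def sum_divide_distrib sum_subtractf[symmetric]
    proof (rule sum.cong)
      fix i assume "i \<in> {..<k}"
      then have "2 * i < 2 * k" "2 * i + 1 < 2 * k" by auto
      with ind[of "2*i"] ind[of "2*i+1"] s[of i]
      show "indicator C (a' i) - (indicator C (a (2 * i)) + indicator C (a (2 * i + 1))) / 2 = s i * c T i / 2"
        by (auto simp: a'_def c_def field_simps)
    qed simp
    then have "freq k a' C - freq (2 * k) a C = D / (2 * k)"
      using False by (simp add: freq_eq_sum field_simps)
    also have "\<bar>\<dots>\<bar> = \<bar>D\<bar> / (2 * k)" by simp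
    also have "\<dots> \<le> t * k / (2 * k)" using D by (intro divide_right_mono) auto
    finally show ?thesis using False by simp
  qed (use assms in \<open>simp add: freq_def\<close>)
  moreover have "a' i \<in> a ` {..<2*k}" if "i < k" for i using that by (auto simp: a'_def)
  ultimately show ?thesis by blast
qed

text \<open>
  The tolerances \<open>(3/4) ^ j\<close> are summable, and yet the exponent on the right is \<open>(9/8) ^ j / 4\<close>, which outgrows
  the logarithm of the polynomial bound for the number of traces on \<open>2 ^ (j + 1)\<close> points.
\<close>

lemma eventually_few_traces:
  "\<exists>j0. (\<forall>j\<ge>j0. 2 * (real r + (2 * 2 ^ j + 1) ^ d) < exp (((3/4) ^ j)\<^sup>2 * 2 ^ j / 4))"
proof -
  have "filterlim (\<lambda>j. (9/8::real) ^ j / 4 - ln (2 * (real r + 1) * 4 ^ d) - real j * ln (2 ^ d)) at_top sequentially"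
    by real_asymp
  then have "\<forall>\<^sub>F j in sequentially. (9/8::real) ^ j / 4 - ln (2 * (real r + 1) * 4 ^ d) - real j * ln (2 ^ d) > 0"
    unfolding filterlim_at_top_dense by (rule spec)
  then obtain j0 where j0: "\<And>j. j \<ge> j0 \<Longrightarrow> (9/8::real) ^ j / 4 > ln (2 * (real r + 1) * 4 ^ d) + real j * ln (2 ^ d)"
    by (force simp: eventually_sequentially)
  show ?thesis
  proof (intro exI[of _ j0] allI impI)
    fix j assume "j \<ge> j0"
    have two: "1 \<le> (2::real) ^ j" by (rule one_le_power) simp
    then have "(2 * 2 ^ j + 1 :: real) \<le> 4 * 2 ^ j" by linarith
    then have "(2 * 2 ^ j + 1 :: real) ^ d \<le> (4 * 2 ^ j) ^ d" by (intro power_mono) auto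
    moreover have "1 \<le> (4 * 2 ^ j :: real) ^ d" 
      using two by (intro one_le_power) linarith
    then have "real r * 1 \<le> real r * (4 * 2 ^ j) ^ d" by (intro mult_left_mono) auto
    ultimately have "2 * (real r + (2 * 2 ^ j + 1) ^ d) \<le> 2 * (real r + 1) * 4 ^ d * (2 ^ d) ^ j"
      by (simp add: algebra_simps power_mult_distrib flip: power_mult)
    also have "\<dots> = exp (ln (2 * (real r + 1) * 4 ^ d) + real j * ln (2 ^ d))"
      by (simp add: exp_add exp_of_nat_mult)
    also have "\<dots> < exp ((9/8) ^ j / 4)" using j0[OF \<open>j \<ge> j0\<close>] by simp
    also have "(9/8::real) ^ j = ((3/4) ^ j)\<^sup>2 * 2 ^ j"
      by (simp add: power2_eq_square flip: power_mult_distrib)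
    finally show "2 * (real r + (2 * 2 ^ j + 1) ^ d) < exp (((3/4) ^ j)\<^sup>2 * 2 ^ j / 4)" .
  qed
qed

text \<open>
  The total error of repeated halving is a geometric sum, so it is small in terms of the final size
  \<open>2 ^ j0\<close>, no matter how large the initial sample is.
\<close>

lemma shrink_sample:
  assumes few: "\<And>j. j \<ge> j0 \<Longrightarrow> 2 * (real r + (2 * 2 ^ j + 1) ^ d) < exp (((3/4) ^ j)\<^sup>2 * 2 ^ j / 4)"
    and traces: "\<And>n a. (\<forall>i<n. a i \<in> \<Omega>) \<Longrightarrow> card (traces \<C> n a) \<le> r + (n + 1) ^ d"
    and "J \<ge> j0" "\<forall>i<2^J. a i \<in> \<Omega>"
  shows "\<exists>a'. (\<forall>i<2^j0. a' i \<in> \<Omega>) \<and>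
           (\<forall>C\<in>\<C>. \<bar>freq (2^j0) a' C - freq (2^J) a C\<bar> \<le> 2 * (3/4)^j0 - 2 * (3/4)^J)"
  using assms(3,4)
proof (induction J arbitrary: a rule: dec_induct)
  case base
  then show ?case by (intro exI[of _ a]) auto
next
  case (step J)
  have "real (card (traces \<C> (2 * 2^J) a)) \<le> real (r + (2 * 2^J + 1) ^ d)"
    using step.prems by (intro of_nat_mono traces) auto
  then have "2 * real (card (traces \<C> (2 * 2^J) a)) < exp (((3/4) ^ J)\<^sup>2 * real (2 ^ J) / 4)"
    using few[OF step.hyps(1)] by (simp add: add.commute)
  moreover have "(3/4::real) ^ J \<le> 1" by (rule power_le_one) auto
  ultimately obtain a1 where a1: "\<forall>i<2^J. a1 i \<in> a ` {..<2*2^J}"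
    "\<forall>C\<in>\<C>. \<bar>freq (2^J) a1 C - freq (2 * 2^J) a C\<bar> \<le> (3/4)^J / 2"
    using halve_sample[of "(3/4) ^ J" \<C> "2^J" a] by auto
  have "\<forall>i<2^J. a1 i \<in> \<Omega>" using a1(1) step.prems by fastforce
  then obtain a' where a': "\<forall>i<2^j0. a' i \<in> \<Omega>"
    "\<forall>C\<in>\<C>. \<bar>freq (2^j0) a' C - freq (2^J) a1 C\<bar> \<le> 2 * (3/4)^j0 - 2 * (3/4)^J"
    using step.IH by blast
  have "\<bar>freq (2^j0) a' C - freq (2^Suc J) a C\<bar> \<le> 2 * (3/4)^j0 - 2 * (3/4)^Suc J" if "C \<in> \<C>" for C
  proof -
    have tri: "\<bar>x - z\<bar> \<le> 2 * p - 2 * (3/4 * q)"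
      if "\<bar>y - z\<bar> \<le> q / 2" "\<bar>x - y\<bar> \<le> 2 * p - 2 * q" for x y z p q :: real
      using that by linarith
    show ?thesis
      unfolding power_Suc by (rule tri[OF bspec[OF a1(2) that] bspec[OF a'(2) that]])
  qed
  then show ?case using a'(1) by blast
qed

section \<open>Finitely additive probability measures\<close>

locale charge = algebra \<Omega> \<A> for \<Omega> :: "'x set" and \<A> +
  fixes m :: "'x set \<Rightarrow> real"
  assumes nonneg: "A \<in> \<A> \<Longrightarrow> 0 \<le> m A"
    and total: "m \<Omega> = 1"
    and additive: "A \<in> \<A> \<Longrightarrow> B \<in> \<A> \<Longrightarrow> A \<inter> B = {} \<Longrightarrow> m (A \<union> B) = m A + m B"

lemma (in charge) empty_zero: "m {} = 0"
  using additive[of "{}" "{}"] by simp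

lemma (in charge) finite_additive:
  assumes "finite I" "\<And>i. i \<in> I \<Longrightarrow> B i \<in> \<A>" "disjoint_family_on B I"
  shows "m (\<Union>i\<in>I. B i) = (\<Sum>i\<in>I. m (B i))"
  using assms
proof (induction I rule: finite_induct)
  case (insert i I)
  have "B i \<inter> (\<Union>i\<in>I. B i) = {}"
    using insert.prems(2) insert.hyps(2) by (auto simp: disjoint_family_on_def)
  then show ?case
    using insert by (simp add: additive finite_UN disjoint_family_on_insert)
qed (simp add: empty_zero)

lemma (in charge) mono: "A \<in> \<A> \<Longrightarrow> B \<in> \<A> \<Longrightarrow> A \<subseteq> B \<Longrightarrow> m A \<le> m B"
  using additive[of A "B - A"] nonneg[of "B - A"] Diff[of B A] by (simp add: Un_absorb1)

lemma (in charge) le_one: "A \<in> \<A> \<Longrightarrow> m A \<le> 1"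
  using mono[of A \<Omega>] total sets_into_space by auto

text \<open>
  The points that lie in exactly those members of \<open>\<G>\<close> that belong to \<open>T\<close>.
\<close>

definition atom :: "'x set \<Rightarrow> 'x set set \<Rightarrow> 'x set set \<Rightarrow> 'x set" where
  "atom \<Omega> \<G> T = {x\<in>\<Omega>. {A\<in>\<G>. x \<in> A} = T}"

lemma (in algebra) atom_sets: "finite \<G> \<Longrightarrow> \<G> \<subseteq> M \<Longrightarrow> atom \<Omega> \<G> T \<in> M"
proof (cases "T \<subseteq> \<G>")
  case True
  assume fin: "finite \<G>" "\<G> \<subseteq> M"
  have "{x\<in>\<Omega>. \<forall>A\<in>\<H>. x \<in> A \<longleftrightarrow> A \<in> T} \<in> M" if "finite \<H>" "\<H> \<subseteq> M" for \<H>
    using that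
  proof (induction \<H> rule: finite_induct)
    case (insert A \<H>)
    have "{x\<in>\<Omega>. \<forall>B\<in>insert A \<H>. x \<in> B \<longleftrightarrow> B \<in> T}
      = {x\<in>\<Omega>. \<forall>B\<in>\<H>. x \<in> B \<longleftrightarrow> B \<in> T} \<inter> (if A \<in> T then A else \<Omega> - A)"
      by auto
    then show ?case using insert by auto
  qed auto
  from this[OF fin] show ?thesis
    by (rule back_subst[of "\<lambda>X. X \<in> M"]) (use True in \<open>auto simp: atom_def\<close>)
next
  case False
  then have "atom \<Omega> \<G> T = {}" by (auto simp: atom_def)
  then show ?thesis by simp
qed

lemma disjoint_atoms: "disjoint_family_on (atom \<Omega> \<G>) \<T>"
  by (auto simp: disjoint_family_on_def atom_def)

section \<open>Finite averages\<close>

type_synonym 'x weighted = "'x set \<times> ('x \<Rightarrow> real)"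

definition avg :: "'x weighted \<Rightarrow> ('x \<Rightarrow> real) \<Rightarrow> real" where
  "avg \<rho> f = (\<Sum>x\<in>fst \<rho>. snd \<rho> x * f x)"

text \<open>
  Finitely many weighted points of \<open>S\<close> that cannot be told apart from \<open>m\<close> by the sets in \<open>\<G>\<close>.
\<close>

definition represents :: "('x set \<Rightarrow> real) \<Rightarrow> 'x set \<Rightarrow> 'x set set \<Rightarrow> 'x weighted \<Rightarrow> bool" where
  "represents m S \<G> \<rho> \<longleftrightarrow> finite (fst \<rho>) \<and> fst \<rho> \<subseteq> S \<and> (\<forall>x\<in>fst \<rho>. 0 \<le> snd \<rho> x) \<and>
     sum (snd \<rho>) (fst \<rho>) = 1 \<and> (\<forall>A\<in>\<G>. avg \<rho> (indicator A) = m A)"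

lemma represents_mono: "represents m S \<G> \<rho> \<Longrightarrow> \<G>' \<subseteq> \<G> \<Longrightarrow> S \<subseteq> S' \<Longrightarrow> represents m S' \<G>' \<rho>"
  by (auto simp: represents_def)

lemma avg_indicator: "finite (fst \<rho>) \<Longrightarrow> avg \<rho> (indicator A) = sum (snd \<rho>) (fst \<rho> \<inter> A)"
  by (simp add: avg_def indicator_def sum.If_cases)

text \<open>
  Choose a point of \<open>S\<close> in every atom of positive measure and give it the measure of its atom.
\<close>

lemma (in charge) ex_represents:
  assumes "finite \<G>" "\<G> \<subseteq> \<A>" "S \<subseteq> \<Omega>" and meets: "\<And>A. A \<in> \<A> \<Longrightarrow> m A > 0 \<Longrightarrow> A \<inter> S \<noteq> {}"
  shows "\<exists>\<rho>. represents m S \<G> \<rho>"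
proof -
  define cell where "cell = atom \<Omega> \<G>"
  have cell: "cell T \<in> \<A>" for T unfolding cell_def by (rule atom_sets) fact+
  define \<T> where "\<T> = {T \<in> Pow \<G>. m (cell T) > 0}"
  have fin: "finite \<T>" using \<open>finite \<G>\<close> by (auto simp: \<T>_def)
  define p where "p T = (SOME x. x \<in> cell T \<inter> S)" for T
  have p: "p T \<in> cell T \<inter> S" if "T \<in> \<T>" for T
  proof -
    have "cell T \<inter> S \<noteq> {}" using meets[OF cell] that by (simp add: \<T>_def)
    then show ?thesis unfolding p_def by (rule some_in_eq[THEN iffD2])
  qed
  have sig: "{A\<in>\<G>. p T \<in> A} = T" if "T \<in> \<T>" for T
    using p[OF that] unfolding cell_def atom_def by blast
  have inj: "inj_on p \<T>" 
  proof (rule inj_onI)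
    fix T T' assume TT': "T \<in> \<T>" "T' \<in> \<T>" "p T = p T'"
    show "T = T'" using sig[OF TT'(1)] sig[OF TT'(2)] unfolding TT'(3) by (rule trans[OF sym])
  qed
  define w where "w x = m (cell {A\<in>\<G>. x \<in> A})" for x
  define \<rho> where "\<rho> = (p ` \<T>, w)"
  have val: "sum w (p ` \<T> \<inter> A) = m A" if "A \<in> insert \<Omega> \<G>" for A
  proof -
    have A: "A \<in> \<A>" using that assms by auto
    define \<U> where "\<U> = {T \<in> Pow \<G>. A \<in> T \<or> A = \<Omega>}"
    have "sum w (p ` \<T> \<inter> A) = sum w (p ` (\<T> \<inter> \<U>))"
    proof (rule arg_cong[of _ _ "sum w"])
      have "p T \<in> A \<longleftrightarrow> T \<in> \<U>" if "T \<in> \<T>" for T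
        using that p[OF that] \<open>A \<in> insert \<Omega> \<G>\<close> unfolding \<U>_def \<T>_def cell_def atom_def by blast
      then show "p ` \<T> \<inter> A = p ` (\<T> \<inter> \<U>)" by auto
    qed
    also have "\<dots> = (\<Sum>T\<in>\<T> \<inter> \<U>. m (cell T))"
    proof (subst sum.reindex)
      show "inj_on p (\<T> \<inter> \<U>)" by (rule inj_on_subset[OF inj]) simp
      have "w (p T) = m (cell T)" if "T \<in> \<T>" for T
        unfolding w_def sig[OF that] ..
      then show "sum (w \<circ> p) (\<T> \<inter> \<U>) = (\<Sum>T\<in>\<T> \<inter> \<U>. m (cell T))"
        by (intro sum.cong) auto
    qed
    also have "\<dots> = (\<Sum>T\<in>\<U>. m (cell T))"
    proof (rule sum.mono_neutral_left)
      show "\<forall>T\<in>\<U> - \<T> \<inter> \<U>. m (cell T) = 0"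
        using nonneg[OF cell] by (auto simp: \<U>_def \<T>_def not_less intro: antisym)
    qed (use \<open>finite \<G>\<close> in \<open>auto simp: \<U>_def\<close>)
    also have "\<dots> = m (\<Union>T\<in>\<U>. cell T)"
      using \<open>finite \<G>\<close> by (subst finite_additive) (simp_all add: \<U>_def cell_def[symmetric] cell, simp add: cell_def disjoint_atoms)
    also have "(\<Union>T\<in>\<U>. cell T) = {x\<in>\<Omega>. {B\<in>\<G>. x \<in> B} \<in> \<U>}"
      unfolding cell_def atom_def by blast
    also have "\<dots> = {x\<in>\<Omega>. x \<in> A}"
      using \<open>A \<in> insert \<Omega> \<G>\<close> by (intro Collect_cong) (auto simp: \<U>_def)
    also have "\<dots> = A" using sets_into_space[OF A] by blast
    finally show ?thesis .
  qed
  have "p ` \<T> \<subseteq> \<Omega>" using p assms by auto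
  then have "sum w (p ` \<T>) = 1" using val[of \<Omega>] total by (simp add: Int_absorb2)
  then have "represents m S \<G> \<rho>"
    using fin p nonneg[OF cell] val by (auto simp: represents_def \<rho>_def w_def avg_indicator)
  then show ?thesis by blast
qed

lemma (in charge) ex_represents': "finite \<G> \<Longrightarrow> \<G> \<subseteq> \<A> \<Longrightarrow> \<exists>\<rho>. represents m \<Omega> \<G> \<rho>"
  by (rule ex_represents) (use empty_zero sets_into_space in force)+

section \<open>Integration of uniformly approximable functions\<close>

text \<open>
  The uniform closure of the simple functions, expressed without reference to their values: on each cell
  of a suitable finite cover the function oscillates by at most \<open>\<epsilon>\<close>.
\<close>

definition tmeas :: "'x set \<Rightarrow> 'x set set \<Rightarrow> ('x \<Rightarrow> real) \<Rightarrow> bool" where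
  "tmeas \<Omega> \<A> f \<longleftrightarrow> (\<forall>\<epsilon>>0. \<exists>P. finite P \<and> P \<subseteq> \<A> \<and> \<Omega> \<subseteq> \<Union>P \<and>
     (\<forall>A\<in>P. \<forall>x\<in>A \<inter> \<Omega>. \<forall>y\<in>A \<inter> \<Omega>. \<bar>f x - f y\<bar> \<le> \<epsilon>))"

lemma tmeasE:
  assumes "tmeas \<Omega> \<A> f" "\<epsilon> > 0"
  obtains P where "finite P" "P \<subseteq> \<A>" "\<Omega> \<subseteq> \<Union>P"
    "\<And>A x y. A \<in> P \<Longrightarrow> x \<in> A \<inter> \<Omega> \<Longrightarrow> y \<in> A \<inter> \<Omega> \<Longrightarrow> \<bar>f x - f y\<bar> \<le> \<epsilon>"
proof -
  have "\<exists>P. finite P \<and> P \<subseteq> \<A> \<and> \<Omega> \<subseteq> \<Union>P \<and>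
     (\<forall>A\<in>P. \<forall>x\<in>A \<inter> \<Omega>. \<forall>y\<in>A \<inter> \<Omega>. \<bar>f x - f y\<bar> \<le> \<epsilon>)"
    using assms unfolding tmeas_def by simp
  then obtain P where P: "finite P" "P \<subseteq> \<A>" "\<Omega> \<subseteq> \<Union>P"
    "\<forall>A\<in>P. \<forall>x\<in>A \<inter> \<Omega>. \<forall>y\<in>A \<inter> \<Omega>. \<bar>f x - f y\<bar> \<le> \<epsilon>" by (elim exE conjE)
  show ?thesis by (rule that[OF P(1-3)]) (use P(4) in simp)
qed

lemma tmeas_cong: "(\<And>x. x \<in> \<Omega> \<Longrightarrow> f x = g x) \<Longrightarrow> tmeas \<Omega> \<A> f \<longleftrightarrow> tmeas \<Omega> \<A> g"
  unfolding tmeas_def by simp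

lemma tmeas_uniform_limit:
  assumes "\<And>\<epsilon>. \<epsilon> > 0 \<Longrightarrow> \<exists>g. tmeas \<Omega> \<A> g \<and> (\<forall>x\<in>\<Omega>. \<bar>f x - g x\<bar> \<le> \<epsilon>)"
  shows "tmeas \<Omega> \<A> f"
  unfolding tmeas_def
proof (intro allI impI)
  fix \<epsilon> :: real assume "\<epsilon> > 0"
  then obtain g where g: "tmeas \<Omega> \<A> g" "\<And>x. x \<in> \<Omega> \<Longrightarrow> \<bar>f x - g x\<bar> \<le> \<epsilon> / 3"
    using assms[of "\<epsilon> / 3"] by auto
  have e3: "\<epsilon> / 3 > 0" using \<open>\<epsilon> > 0\<close> by simp
  obtain P where P: "finite P" "P \<subseteq> \<A>" "\<Omega> \<subseteq> \<Union>P"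
    "\<And>A x y. A \<in> P \<Longrightarrow> x \<in> A \<inter> \<Omega> \<Longrightarrow> y \<in> A \<inter> \<Omega> \<Longrightarrow> \<bar>g x - g y\<bar> \<le> \<epsilon> / 3"
    by (rule tmeasE[OF g(1) e3]) (rule that)
  have "\<bar>f x - f y\<bar> \<le> \<epsilon>" if "A \<in> P" "x \<in> A \<inter> \<Omega>" "y \<in> A \<inter> \<Omega>" for A x y
  proof -
    have "\<bar>f x - g x\<bar> \<le> \<epsilon> / 3" "\<bar>f y - g y\<bar> \<le> \<epsilon> / 3" using g(2) that by auto
    then show ?thesis using P(4)[OF that] by linarith
  qed
  then show "\<exists>P. finite P \<and> P \<subseteq> \<A> \<and> \<Omega> \<subseteq> \<Union>P \<and>
      (\<forall>A\<in>P. \<forall>x\<in>A \<inter> \<Omega>. \<forall>y\<in>A \<inter> \<Omega>. \<bar>f x - f y\<bar> \<le> \<epsilon>)"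
    using P by blast
qed

lemma tmeas_compose:
  assumes f: "tmeas \<Omega>' \<A>' f" and g: "\<And>x. x \<in> \<Omega> \<Longrightarrow> g x \<in> \<Omega>'"
    and sets: "\<And>A. A \<in> \<A>' \<Longrightarrow> \<exists>B\<in>\<A>. \<forall>x\<in>\<Omega>. x \<in> B \<longleftrightarrow> g x \<in> A"
  shows "tmeas \<Omega> \<A> (\<lambda>x. f (g x))"
  unfolding tmeas_def
proof (intro allI impI)
  fix \<epsilon> :: real assume "\<epsilon> > 0"
  then obtain P where P: "finite P" "P \<subseteq> \<A>'" "\<Omega>' \<subseteq> \<Union>P"
    "\<And>A x y. A \<in> P \<Longrightarrow> x \<in> A \<inter> \<Omega>' \<Longrightarrow> y \<in> A \<inter> \<Omega>' \<Longrightarrow> \<bar>f x - f y\<bar> \<le> \<epsilon>"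
    by (rule tmeasE[OF f]) (rule that)
  have "\<forall>A\<in>P. \<exists>B. B \<in> \<A> \<and> (\<forall>x\<in>\<Omega>. x \<in> B \<longleftrightarrow> g x \<in> A)"
  proof
    fix A assume "A \<in> P"
    then have "A \<in> \<A>'" using P(2) by auto
    from sets[OF this] show "\<exists>B. B \<in> \<A> \<and> (\<forall>x\<in>\<Omega>. x \<in> B \<longleftrightarrow> g x \<in> A)" by auto
  qed
  from bchoice[OF this] obtain h where h: "\<forall>A\<in>P. h A \<in> \<A> \<and> (\<forall>x\<in>\<Omega>. x \<in> h A \<longleftrightarrow> g x \<in> A)" by (rule exE)
  have "\<Omega> \<subseteq> \<Union>(h ` P)"
  proof
    fix x assume x: "x \<in> \<Omega>"
    then obtain A where "A \<in> P" "g x \<in> A" using g P(3) by blast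
    then show "x \<in> \<Union>(h ` P)" using h x by auto
  qed
  moreover have "\<bar>f (g x) - f (g y)\<bar> \<le> \<epsilon>" if "A \<in> P" "x \<in> h A \<inter> \<Omega>" "y \<in> h A \<inter> \<Omega>" for A x y
    by (rule P(4)[OF that(1)]) (use that h g in auto)
  ultimately show "\<exists>P. finite P \<and> P \<subseteq> \<A> \<and> \<Omega> \<subseteq> \<Union>P \<and>
     (\<forall>A\<in>P. \<forall>x\<in>A \<inter> \<Omega>. \<forall>y\<in>A \<inter> \<Omega>. \<bar>f (g x) - f (g y)\<bar> \<le> \<epsilon>)"
    using P(1) h by (intro exI[of _ "h ` P"]) auto
qed

lemma tmeas_mono: "tmeas \<Omega> \<A> f \<Longrightarrow> \<A> \<subseteq> \<B> \<Longrightarrow> tmeas \<Omega> \<B> f"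
  using tmeas_compose[where g = "\<lambda>x. x"] by (metis subsetD)

context algebra begin

lemma tmeas_const: "tmeas \<Omega> M (\<lambda>_. c)"
  unfolding tmeas_def by (auto intro!: exI[of _ "{\<Omega>}"])

lemma tmeas_indicator: "A \<in> M \<Longrightarrow> tmeas \<Omega> M (indicator A)"
  unfolding tmeas_def by (auto intro!: exI[of _ "{A, \<Omega> - A}"] simp: indicator_def)

lemma tmeas_add:
  assumes "tmeas \<Omega> M f" "tmeas \<Omega> M g"
  shows "tmeas \<Omega> M (\<lambda>x. f x + g x)"
  unfolding tmeas_def
proof (intro allI impI)
  fix \<epsilon> :: real assume "\<epsilon> > 0"
  then have e: "\<epsilon> / 2 > 0" by simp
  obtain P where P: "finite P" "P \<subseteq> M" "\<Omega> \<subseteq> \<Union>P"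
    "\<And>A x y. A \<in> P \<Longrightarrow> x \<in> A \<inter> \<Omega> \<Longrightarrow> y \<in> A \<inter> \<Omega> \<Longrightarrow> \<bar>f x - f y\<bar> \<le> \<epsilon> / 2"
    by (rule tmeasE[OF assms(1) e]) (rule that)
  obtain Q where Q: "finite Q" "Q \<subseteq> M" "\<Omega> \<subseteq> \<Union>Q"
    "\<And>A x y. A \<in> Q \<Longrightarrow> x \<in> A \<inter> \<Omega> \<Longrightarrow> y \<in> A \<inter> \<Omega> \<Longrightarrow> \<bar>g x - g y\<bar> \<le> \<epsilon> / 2"
    by (rule tmeasE[OF assms(2) e]) (rule that)
  define R where "R = (\<lambda>(A, B). A \<inter> B) ` (P \<times> Q)"
  have "\<bar>f x + g x - (f y + g y)\<bar> \<le> \<epsilon>" if C: "C \<in> R" "x \<in> C \<inter> \<Omega>" "y \<in> C \<inter> \<Omega>" for C x y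
  proof -
    obtain A B where AB: "A \<in> P" "B \<in> Q" "C = A \<inter> B" using C(1) by (auto simp: R_def)
    then have "\<bar>f x - f y\<bar> \<le> \<epsilon> / 2" "\<bar>g x - g y\<bar> \<le> \<epsilon> / 2" using P(4)[of A x y] Q(4)[of B x y] C by auto
    then show ?thesis by linarith
  qed
  moreover have "finite R" "R \<subseteq> M" using P Q by (auto simp: R_def)
  moreover have "\<Omega> \<subseteq> \<Union>R" using P(3) Q(3) by (fastforce simp: R_def)
  ultimately show "\<exists>R. finite R \<and> R \<subseteq> M \<and> \<Omega> \<subseteq> \<Union>R \<and>
      (\<forall>A\<in>R. \<forall>x\<in>A \<inter> \<Omega>. \<forall>y\<in>A \<inter> \<Omega>. \<bar>f x + g x - (f y + g y)\<bar> \<le> \<epsilon>)"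
    by blast
qed

lemma tmeas_cmult:
  assumes "tmeas \<Omega> M f"
  shows "tmeas \<Omega> M (\<lambda>x. c * f x)"
  unfolding tmeas_def
proof (intro allI impI)
  fix \<epsilon> :: real assume "\<epsilon> > 0"
  then have e: "\<epsilon> / (\<bar>c\<bar> + 1) > 0" by (intro divide_pos_pos) auto
  obtain P where P: "finite P" "P \<subseteq> M" "\<Omega> \<subseteq> \<Union>P"
    "\<And>A x y. A \<in> P \<Longrightarrow> x \<in> A \<inter> \<Omega> \<Longrightarrow> y \<in> A \<inter> \<Omega> \<Longrightarrow> \<bar>f x - f y\<bar> \<le> \<epsilon> / (\<bar>c\<bar> + 1)"
    by (rule tmeasE[OF assms(1) e]) (rule that)
  have "\<bar>c * f x - c * f y\<bar> \<le> \<epsilon>" if "A \<in> P" "x \<in> A \<inter> \<Omega>" "y \<in> A \<inter> \<Omega>" for A x y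
  proof -
    have "\<bar>c * f x - c * f y\<bar> = \<bar>c\<bar> * \<bar>f x - f y\<bar>" by (simp add: abs_mult flip: right_diff_distrib)
    also have "\<dots> \<le> (\<bar>c\<bar> + 1) * (\<epsilon> / (\<bar>c\<bar> + 1))" using P(4)[OF that] by (intro mult_mono) auto
    finally show ?thesis by simp
  qed
  then show "\<exists>P. finite P \<and> P \<subseteq> M \<and> \<Omega> \<subseteq> \<Union>P \<and>
      (\<forall>A\<in>P. \<forall>x\<in>A \<inter> \<Omega>. \<forall>y\<in>A \<inter> \<Omega>. \<bar>c * f x - c * f y\<bar> \<le> \<epsilon>)"
    using P by blast
qed

lemma tmeas_sum: "finite I \<Longrightarrow> (\<And>i. i \<in> I \<Longrightarrow> tmeas \<Omega> M (f i)) \<Longrightarrow> tmeas \<Omega> M (\<lambda>x. \<Sum>i\<in>I. f i x)"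
  by (induction I rule: finite_induct) (auto intro: tmeas_const tmeas_add)

text \<open>
  The atoms of the cover are disjoint; take for each of them the value at some point.
\<close>

lemma tmeas_step:
  assumes "tmeas \<Omega> M f" "\<epsilon> > 0"
  obtains P c where "finite P" "P \<subseteq> M" "\<And>x. x \<in> \<Omega> \<Longrightarrow> \<bar>f x - (\<Sum>A\<in>P. c A * indicator A x)\<bar> \<le> \<epsilon>"
proof -
  obtain P where P: "finite P" "P \<subseteq> M" "\<Omega> \<subseteq> \<Union>P"
    "\<And>A x y. A \<in> P \<Longrightarrow> x \<in> A \<inter> \<Omega> \<Longrightarrow> y \<in> A \<inter> \<Omega> \<Longrightarrow> \<bar>f x - f y\<bar> \<le> \<epsilon>"
    by (rule tmeasE[OF assms]) (rule that)
  define R where "R = atom \<Omega> P ` Pow P"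
  define c where "c A = f (SOME x. x \<in> A)" for A
  show ?thesis
  proof (rule that[of R c])
    show "finite R" "R \<subseteq> M" using P by (auto simp: R_def intro: atom_sets)
    fix x assume x: "x \<in> \<Omega>"
    define B where "B = atom \<Omega> P {A\<in>P. x \<in> A}"
    have B: "x \<in> B" "B \<in> R" using x by (auto simp: B_def R_def atom_def)
    have uniq: "A = B" if "A \<in> R" "x \<in> A" for A
      using that by (auto simp: R_def B_def atom_def)
    have "(\<Sum>A\<in>R. c A * indicator A x) = (\<Sum>A\<in>R. if A = B then c B else 0)"
    proof (rule sum.cong)
      fix A assume "A \<in> R"
      then show "c A * indicator A x = (if A = B then c B else 0)"
        using uniq[of A] B(1) by (cases "x \<in> A") auto
    qed simp
    also have "\<dots> = c B" using \<open>finite R\<close> B by simp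
    finally have eq: "(\<Sum>A\<in>R. c A * indicator A x) = c B" .
    have y: "(SOME y. y \<in> B) \<in> B" using B by (auto intro: someI)
    obtain A where A: "A \<in> P" "x \<in> A" using P(3) x by auto
    have "(SOME y. y \<in> B) \<in> A \<inter> \<Omega>" using y A by (auto simp: B_def atom_def)
    then have "\<bar>f x - c B\<bar> \<le> \<epsilon>" unfolding c_def using A x by (intro P(4)) auto
    then show "\<bar>f x - (\<Sum>A\<in>R. c A * indicator A x)\<bar> \<le> \<epsilon>" by (simp add: eq)
  qed
qed

end

text \<open>
  Weighted finite sets of points, as they represent \<open>m\<close> on larger and larger finite families. The integral
  is the limit of averages along this filter.
\<close>

definition represent_filter :: "'x set \<Rightarrow> 'x set set \<Rightarrow> ('x set \<Rightarrow> real) \<Rightarrow> 'x weighted filter" where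
  "represent_filter \<Omega> \<A> m = (INF \<G>\<in>{\<G>. finite \<G> \<and> \<G> \<subseteq> \<A>}. principal {\<rho>. represents m \<Omega> \<G> \<rho>})"

definition fint :: "'x set \<Rightarrow> 'x set set \<Rightarrow> ('x set \<Rightarrow> real) \<Rightarrow> ('x \<Rightarrow> real) \<Rightarrow> real" where
  "fint \<Omega> \<A> m f = Lim (represent_filter \<Omega> \<A> m) (\<lambda>\<rho>. avg \<rho> f)"

lemma eventually_represent_filter:
  "eventually Q (represent_filter \<Omega> \<A> m) \<longleftrightarrow>
     (\<exists>\<G>. finite \<G> \<and> \<G> \<subseteq> \<A> \<and> (\<forall>\<rho>. represents m \<Omega> \<G> \<rho> \<longrightarrow> Q \<rho>))"
  unfolding represent_filter_def
proof (subst eventually_INF_base)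
  fix a b assume "a \<in> {\<G>. finite \<G> \<and> \<G> \<subseteq> \<A>}" "b \<in> {\<G>. finite \<G> \<and> \<G> \<subseteq> \<A>}"
  then show "\<exists>x\<in>{\<G>. finite \<G> \<and> \<G> \<subseteq> \<A>}. principal {\<rho>. represents m \<Omega> x \<rho>} \<le>
      inf (principal {\<rho>. represents m \<Omega> a \<rho>}) (principal {\<rho>. represents m \<Omega> b \<rho>})"
    by (intro bexI[of _ "a \<union> b"]) (auto simp: represents_def)
qed (auto simp: eventually_principal)

lemma eventually_represents:
  "finite \<G> \<Longrightarrow> \<G> \<subseteq> \<A> \<Longrightarrow> eventually (represents m \<Omega> \<G>) (represent_filter \<Omega> \<A> m)"
  by (auto simp: eventually_represent_filter)

lemma avg_add: "avg \<rho> (\<lambda>x. f x + g x) = avg \<rho> f + avg \<rho> g"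
  by (simp add: avg_def distrib_left sum.distrib)

lemma avg_cmult: "avg \<rho> (\<lambda>x. c * f x) = c * avg \<rho> f"
  by (simp add: avg_def sum_distrib_left mult_ac)

lemma avg_sum: "avg \<rho> (\<lambda>x. \<Sum>i\<in>I. f i x) = (\<Sum>i\<in>I. avg \<rho> (f i))"
  by (simp add: avg_def sum_distrib_left sum.swap[of _ I])

lemma avg_mono:
  assumes "represents m S \<G> \<rho>" "\<And>x. x \<in> S \<Longrightarrow> f x \<le> g x"
  shows "avg \<rho> f \<le> avg \<rho> g"
  unfolding avg_def using assms by (intro sum_mono mult_left_mono) (auto simp: represents_def)

lemma avg_const: "represents m S \<G> \<rho> \<Longrightarrow> avg \<rho> (\<lambda>_. c) = c"
  by (simp add: avg_def represents_def flip: sum_distrib_right)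

lemma avg_close:
  assumes "represents m S \<G> \<rho>" "\<And>x. x \<in> S \<Longrightarrow> \<bar>f x - g x\<bar> \<le> \<epsilon>"
  shows "\<bar>avg \<rho> f - avg \<rho> g\<bar> \<le> \<epsilon>"
proof -
  have "avg \<rho> f \<le> avg \<rho> (\<lambda>x. g x + \<epsilon>)" "avg \<rho> g \<le> avg \<rho> (\<lambda>x. f x + \<epsilon>)"
    using assms by (auto intro!: avg_mono[OF assms(1)] simp: abs_le_iff algebra_simps)
  then show ?thesis using assms(1) by (simp add: avg_add avg_const abs_le_iff)
qed

text \<open>
  Positive normalised linear functionals. They are determined by their values on indicator functions
  (\<open>mean_unique\<close>), which reduces identities between iterated integrals to identities between charges.
\<close>

definition mean :: "'x set \<Rightarrow> 'x set set \<Rightarrow> (('x \<Rightarrow> real) \<Rightarrow> real) \<Rightarrow> bool" where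
  "mean \<Omega> \<A> T \<longleftrightarrow>
     (\<forall>f g. tmeas \<Omega> \<A> f \<longrightarrow> tmeas \<Omega> \<A> g \<longrightarrow> T (\<lambda>x. f x + g x) = T f + T g) \<and>
     (\<forall>c f. tmeas \<Omega> \<A> f \<longrightarrow> T (\<lambda>x. c * f x) = c * T f) \<and>
     (\<forall>f g. tmeas \<Omega> \<A> f \<longrightarrow> tmeas \<Omega> \<A> g \<longrightarrow> (\<forall>x\<in>\<Omega>. f x \<le> g x) \<longrightarrow> T f \<le> T g) \<and>
     T (\<lambda>_. 1) = 1"

context charge begin

lemma represent_filter_nontrivial: "represent_filter \<Omega> \<A> m \<noteq> bot"
proof
  assume "represent_filter \<Omega> \<A> m = bot"
  then have "eventually (\<lambda>_. False) (represent_filter \<Omega> \<A> m)" by simp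
  then show False using ex_represents' by (auto simp: eventually_represent_filter)
qed

text \<open>
  The averages form a Cauchy filter: representing \<open>m\<close> on the sets of a step function close to \<open>f\<close> fixes
  the average of the step function, and the average of \<open>f\<close> is close to it.
\<close>

lemma tendsto_fint:
  assumes "tmeas \<Omega> \<A> f"
  shows "((\<lambda>\<rho>. avg \<rho> f) \<longlongrightarrow> fint \<Omega> \<A> m f) (represent_filter \<Omega> \<A> m)"
proof -
  let ?F = "filtermap (\<lambda>\<rho>. avg \<rho> f) (represent_filter \<Omega> \<A> m)"
  have "cauchy_filter ?F"
    unfolding cauchy_filter_metric_filtermap
  proof (intro allI impI)
    fix e :: real assume "e > 0"
    then have e4: "e / 4 > 0" by simp
    obtain P c where P: "finite P" "P \<subseteq> \<A>"
      "\<And>x. x \<in> \<Omega> \<Longrightarrow> \<bar>f x - (\<Sum>A\<in>P. c A * indicator A x)\<bar> \<le> e / 4"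
      by (rule tmeas_step[OF assms e4]) (rule that)
    have close: "\<bar>avg \<rho> f - (\<Sum>A\<in>P. c A * m A)\<bar> \<le> e / 4" if "represents m \<Omega> P \<rho>" for \<rho>
    proof -
      have "avg \<rho> (\<lambda>x. \<Sum>A\<in>P. c A * indicator A x) = (\<Sum>A\<in>P. c A * m A)"
        using that unfolding avg_sum avg_cmult by (intro sum.cong) (auto simp: represents_def)
      moreover have "\<bar>avg \<rho> f - avg \<rho> (\<lambda>x. \<Sum>A\<in>P. c A * indicator A x)\<bar> \<le> e / 4"
        by (rule avg_close[OF that]) (rule P(3))
      ultimately show ?thesis by simp
    qed
    have "dist (avg \<rho> f) (avg \<rho>' f) < e" if "represents m \<Omega> P \<rho>" "represents m \<Omega> P \<rho>'" for \<rho> \<rho>'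
      using close[OF that(1)] close[OF that(2)] \<open>e > 0\<close> unfolding dist_real_def by linarith
    then show "\<exists>Q. eventually Q (represent_filter \<Omega> \<A> m) \<and>
        (\<forall>x y. Q x \<and> Q y \<longrightarrow> dist (avg x f) (avg y f) < e)"
      using eventually_represents[OF P(1,2)] by blast
  qed
  then obtain I where "?F \<le> nhds I"
    using cauchy_filter_complete_converges[of ?F UNIV] represent_filter_nontrivial
    by (auto simp: filtermap_bot_iff complete_UNIV)
  then have *: "((\<lambda>\<rho>. avg \<rho> f) \<longlongrightarrow> I) (represent_filter \<Omega> \<A> m)" by (simp add: filterlim_def)
  then have "fint \<Omega> \<A> m f = I"
    unfolding fint_def by (rule tendsto_Lim[OF represent_filter_nontrivial])
  with * show ?thesis by simp
qed

lemma fint_unique: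
  "((\<lambda>\<rho>. avg \<rho> f) \<longlongrightarrow> I) (represent_filter \<Omega> \<A> m) \<Longrightarrow> fint \<Omega> \<A> m f = I"
  unfolding fint_def by (rule tendsto_Lim[OF represent_filter_nontrivial])

lemma eventually_represents_self: "eventually (represents m \<Omega> {}) (represent_filter \<Omega> \<A> m)"
  by (rule eventually_represents) auto

lemma fint_add: "tmeas \<Omega> \<A> f \<Longrightarrow> tmeas \<Omega> \<A> g \<Longrightarrow> fint \<Omega> \<A> m (\<lambda>x. f x + g x) = fint \<Omega> \<A> m f + fint \<Omega> \<A> m g"
  by (rule fint_unique) (auto simp: avg_add intro!: tendsto_add tendsto_fint)

lemma fint_cmult: "tmeas \<Omega> \<A> f \<Longrightarrow> fint \<Omega> \<A> m (\<lambda>x. c * f x) = c * fint \<Omega> \<A> m f"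
  by (rule fint_unique) (auto simp: avg_cmult intro!: tendsto_mult tendsto_fint)

lemma fint_mono:
  assumes "tmeas \<Omega> \<A> f" "tmeas \<Omega> \<A> g" "\<And>x. x \<in> \<Omega> \<Longrightarrow> f x \<le> g x"
  shows "fint \<Omega> \<A> m f \<le> fint \<Omega> \<A> m g"
  by (rule tendsto_le[OF represent_filter_nontrivial tendsto_fint[OF assms(2)] tendsto_fint[OF assms(1)]])
     (rule eventually_mono[OF eventually_represents_self], rule avg_mono, auto intro: assms)

lemma fint_cong:
  assumes "\<And>x. x \<in> \<Omega> \<Longrightarrow> f x = g x"
  shows "fint \<Omega> \<A> m f = fint \<Omega> \<A> m g"
proof -
  have "eventually (\<lambda>\<rho>. avg \<rho> f = avg \<rho> g) (represent_filter \<Omega> \<A> m)"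
    by (rule eventually_mono[OF eventually_represents_self])
       (auto simp: avg_def represents_def assms intro!: sum.cong)
  from tendsto_cong[OF this] show ?thesis by (simp add: fint_def t2_space_class.Lim_def)
qed

lemma fint_const: "fint \<Omega> \<A> m (\<lambda>_. c) = c"
  by (rule fint_unique, rule tendsto_eventually, rule eventually_mono[OF eventually_represents_self])
     (rule avg_const)

lemma fint_indicator: "A \<in> \<A> \<Longrightarrow> fint \<Omega> \<A> m (indicator A) = m A"
  by (rule fint_unique, rule tendsto_eventually, rule eventually_mono[OF eventually_represents[of "{A}"]])
     (auto simp: represents_def)

lemma mean_fint: "mean \<Omega> \<A> (fint \<Omega> \<A> m)"
  by (simp add: mean_def fint_add fint_cmult fint_mono fint_const)

end

context algebra begin

lemma mean_add: "mean \<Omega> M T \<Longrightarrow> tmeas \<Omega> M f \<Longrightarrow> tmeas \<Omega> M g \<Longrightarrow> T (\<lambda>x. f x + g x) = T f + T g"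
  and mean_cmult: "mean \<Omega> M T \<Longrightarrow> tmeas \<Omega> M f \<Longrightarrow> T (\<lambda>x. c * f x) = c * T f"
  and mean_mono: "mean \<Omega> M T \<Longrightarrow> tmeas \<Omega> M f \<Longrightarrow> tmeas \<Omega> M g \<Longrightarrow> (\<And>x. x \<in> \<Omega> \<Longrightarrow> f x \<le> g x) \<Longrightarrow> T f \<le> T g"
  by (auto simp: mean_def)

lemma mean_cong:
  assumes "mean \<Omega> M T" "tmeas \<Omega> M f" "\<And>x. x \<in> \<Omega> \<Longrightarrow> f x = g x"
  shows "T f = T g"
proof -
  have g: "tmeas \<Omega> M g" using assms(2) tmeas_cong[of \<Omega> f g, OF assms(3)] by simp
  show ?thesis
    by (intro antisym mean_mono[OF assms(1,2) g] mean_mono[OF assms(1) g assms(2)])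
       (simp_all add: assms(3))
qed

lemma mean_const: "mean \<Omega> M T \<Longrightarrow> T (\<lambda>_. c) = c"
  using mean_cmult[of T "\<lambda>_. 1" c] tmeas_const by (simp add: mean_def)

lemma mean_sum:
  assumes "mean \<Omega> M T" "finite I" "\<And>i. i \<in> I \<Longrightarrow> tmeas \<Omega> M (f i)"
  shows "T (\<lambda>x. \<Sum>i\<in>I. f i x) = (\<Sum>i\<in>I. T (f i))"
  using assms(2,3)
proof (induction I rule: finite_induct)
  case (insert i I)
  have "T (\<lambda>x. f i x + (\<Sum>j\<in>I. f j x)) = T (f i) + T (\<lambda>x. \<Sum>j\<in>I. f j x)"
    using insert by (intro mean_add[OF assms(1)] tmeas_sum) auto
  then show ?case using insert by simp
qed (simp add: mean_const[OF assms(1)])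

lemma mean_close:
  assumes "mean \<Omega> M T" "tmeas \<Omega> M f" "tmeas \<Omega> M g" "\<And>x. x \<in> \<Omega> \<Longrightarrow> \<bar>f x - g x\<bar> \<le> \<epsilon>"
  shows "\<bar>T f - T g\<bar> \<le> \<epsilon>"
proof -
  have "T f \<le> T (\<lambda>x. g x + \<epsilon>)" "T g \<le> T (\<lambda>x. f x + \<epsilon>)"
    using assms(4) by (auto intro!: mean_mono[OF assms(1)] tmeas_add tmeas_const assms(2,3) simp: abs_le_iff algebra_simps)
  moreover have "T (\<lambda>x. h x + \<epsilon>) = T h + \<epsilon>" if "tmeas \<Omega> M h" for h
    using mean_add[OF assms(1) that tmeas_const] mean_const[OF assms(1)] by simp
  ultimately show ?thesis using assms(2,3) by (simp add: abs_le_iff)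
qed

lemma mean_step_close:
  assumes "mean \<Omega> M T" "tmeas \<Omega> M f" "finite P" "P \<subseteq> M"
    "\<And>x. x \<in> \<Omega> \<Longrightarrow> \<bar>f x - (\<Sum>A\<in>P. c A * indicator A x)\<bar> \<le> \<epsilon>"
  shows "\<bar>T f - (\<Sum>A\<in>P. c A * T (indicator A))\<bar> \<le> \<epsilon>"
proof -
  have tm: "tmeas \<Omega> M (\<lambda>x. c A * indicator A x)" if "A \<in> P" for A
    using that assms(4) by (intro tmeas_cmult tmeas_indicator) auto
  have "T (\<lambda>x. \<Sum>A\<in>P. c A * indicator A x) = (\<Sum>A\<in>P. c A * T (indicator A))"
    using assms(4) by (subst mean_sum[OF assms(1,3) tm])
      (auto intro!: sum.cong mean_cmult[OF assms(1)] tmeas_indicator)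
  moreover have "\<bar>T f - T (\<lambda>x. \<Sum>A\<in>P. c A * indicator A x)\<bar> \<le> \<epsilon>"
    by (rule mean_close[OF assms(1,2)]) (auto intro!: tmeas_sum assms tm)
  ultimately show ?thesis by simp
qed

lemma mean_unique:
  assumes "mean \<Omega> M T" "mean \<Omega> M T'" "\<And>A. A \<in> M \<Longrightarrow> T (indicator A) = T' (indicator A)" "tmeas \<Omega> M f"
  shows "T f = T' f"
proof (rule ccontr)
  assume "T f \<noteq> T' f"
  then have e: "\<bar>T f - T' f\<bar> / 3 > 0" by simp
  obtain P c where P: "finite P" "P \<subseteq> M"
    "\<And>x. x \<in> \<Omega> \<Longrightarrow> \<bar>f x - (\<Sum>A\<in>P. c A * indicator A x)\<bar> \<le> \<bar>T f - T' f\<bar> / 3"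
    by (rule tmeas_step[OF assms(4) e]) (rule that)
  have "(\<Sum>A\<in>P. c A * T (indicator A)) = (\<Sum>A\<in>P. c A * T' (indicator A))"
    using P(2) assms(3) by (intro sum.cong) auto
  moreover have "\<bar>T f - (\<Sum>A\<in>P. c A * T (indicator A))\<bar> \<le> \<bar>T f - T' f\<bar> / 3"
    by (rule mean_step_close[OF assms(1,4) P(1,2)]) (rule P(3))
  moreover have "\<bar>T' f - (\<Sum>A\<in>P. c A * T' (indicator A))\<bar> \<le> \<bar>T f - T' f\<bar> / 3"
    by (rule mean_step_close[OF assms(2,4) P(1,2)]) (rule P(3))
  moreover have "a = b" if "\<bar>a - s\<bar> \<le> \<bar>a - b\<bar> / 3" "\<bar>b - s\<bar> \<le> \<bar>a - b\<bar> / 3" for a b s :: real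
  proof -
    have "\<bar>a - b\<bar> \<le> \<bar>a - s\<bar> + \<bar>b - s\<bar>" by arith
    then have "3 * \<bar>a - b\<bar> \<le> 2 * \<bar>a - b\<bar>" using that by argo
    then show ?thesis by simp
  qed
  ultimately show False using \<open>T f \<noteq> T' f\<close> by metis
qed

text \<open>
  A step function that is uniformly close to \<open>f\<close> approximates all values \<open>T d f\<close> simultaneously.
\<close>

lemma tmeas_mean_family:
  assumes "\<And>d. d \<in> \<Omega>' \<Longrightarrow> mean \<Omega> M (T d)" "algebra \<Omega>' M'"
    and "\<And>A. A \<in> M \<Longrightarrow> tmeas \<Omega>' M' (\<lambda>d. T d (indicator A))" "tmeas \<Omega> M f"
  shows "tmeas \<Omega>' M' (\<lambda>d. T d f)"
proof (rule tmeas_uniform_limit)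
  interpret a': algebra \<Omega>' M' by fact
  fix \<epsilon> :: real assume e: "\<epsilon> > 0"
  obtain P c
    where P: "finite P" "P \<subseteq> M" "\<And>x. x \<in> \<Omega> \<Longrightarrow> \<bar>f x - (\<Sum>A\<in>P. c A * indicator A x)\<bar> \<le> \<epsilon>"
    by (rule tmeas_step[OF assms(4) e]) (rule that)
  show "\<exists>g. tmeas \<Omega>' M' g \<and> (\<forall>d\<in>\<Omega>'. \<bar>T d f - g d\<bar> \<le> \<epsilon>)"
  proof (intro exI conjI ballI)
    show "tmeas \<Omega>' M' (\<lambda>d. \<Sum>A\<in>P. c A * T d (indicator A))"
      using P(1,2) assms(3) by (intro a'.tmeas_sum a'.tmeas_cmult) auto
    show "\<bar>T d f - (\<Sum>A\<in>P. c A * T d (indicator A))\<bar> \<le> \<epsilon>" if "d \<in> \<Omega>'" for d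
      by (rule mean_step_close[OF assms(1)[OF that] assms(4) P(1,2)]) (rule P(3))
  qed
qed

lemma charge_mean:
  assumes "mean \<Omega> M T"
  shows "charge \<Omega> M (\<lambda>A. T (indicator A))"
proof (rule charge.intro)
  show "algebra \<Omega> M" by unfold_locales
  show "charge_axioms \<Omega> M (\<lambda>A. T (indicator A))"
  proof
    fix A B assume A: "A \<in> M"
    have "T (\<lambda>_. 0) \<le> T (indicator A)"
      using A by (intro mean_mono[OF assms] tmeas_const tmeas_indicator) auto
    then show "0 \<le> T (indicator A)" by (simp add: mean_const[OF assms])
    assume B: "B \<in> M" "A \<inter> B = {}"
    then have "indicator (A \<union> B) = (\<lambda>x. indicator A x + indicator B x :: real)"
      by (auto simp: indicator_def fun_eq_iff)
    then show "T (indicator (A \<union> B)) = T (indicator A) + T (indicator B)"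
      using A B by (simp add: mean_add[OF assms] tmeas_indicator)
  next
    show "T (indicator \<Omega>) = 1"
      using mean_cong[OF assms tmeas_const[of 1], of "indicator \<Omega>"] mean_const[OF assms] by auto
  qed
qed

end

section \<open>Uniform approximation of a charge by finite samples\<close>

lemma card_nats_between:
  fixes u v :: real
  assumes "0 \<le> u" "u \<le> v"
  shows "\<bar>real (card {l::nat. u \<le> l \<and> l < v}) - (v - u)\<bar> \<le> 1"
proof -
  have "{l::nat. u \<le> l \<and> l < v} = {nat \<lceil>u\<rceil>..<nat \<lceil>v\<rceil>}"
    using assms by (auto simp: nat_le_iff ceiling_le_iff) linarith+
  moreover have le: "\<lceil>u\<rceil> \<le> \<lceil>v\<rceil>" "0 \<le> \<lceil>u\<rceil>" using assms by (auto intro: ceiling_mono)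
  ultimately have *: "int (card {l::nat. u \<le> l \<and> l < v}) = \<lceil>v\<rceil> - \<lceil>u\<rceil>"
    using nat_mono[OF le(1)] le by (simp only: card_atLeastLessThan of_nat_diff)
  have "real (card {l::nat. u \<le> l \<and> l < v}) = real_of_int (\<lceil>v\<rceil> - \<lceil>u\<rceil>)"
    unfolding *[symmetric] by simp
  then show ?thesis by linarith
qed

text \<open>
  Cut the interval from \<open>0\<close> to \<open>N\<close> into consecutive intervals whose lengths are \<open>N\<close> times the weights. The
  sample consists, for each \<open>l < N\<close>, of the point belonging to the interval that contains \<open>l\<close>. The number
  of integers in an interval differs from its length by at most one.
\<close>

lemma sample_of_weights:
  assumes "represents m S \<G> \<rho>" "0 < N"
  shows "\<exists>a. (\<forall>l<N. a l \<in> fst \<rho>) \<and> (\<forall>E. \<bar>freq N a E - avg \<rho> (indicator E)\<bar> \<le> card (fst \<rho>) / N)"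
proof -
  define s where "s = card (fst \<rho>)"
  have fin: "finite (fst \<rho>)" and w: "\<And>x. x \<in> fst \<rho> \<Longrightarrow> 0 \<le> snd \<rho> x" "sum (snd \<rho>) (fst \<rho>) = 1"
    using assms(1) by (auto simp: represents_def)
  obtain h where h: "bij_betw h {..<s} (fst \<rho>)"
    using ex_bij_betw_nat_finite[OF fin] by (auto simp: s_def atLeast0LessThan)
  then have h_in: "h i \<in> fst \<rho>" if "i < s" for i using that by (auto simp: bij_betw_def)
  define W where "W i = (\<Sum>j<i. snd \<rho> (h j))" for i
  have W: "W 0 = 0" "W s = 1" "\<And>i. W (Suc i) = W i + snd \<rho> (h i)"
    using w(2) sum.reindex_bij_betw[OF h, of "snd \<rho>"] by (auto simp: W_def)
  have W_mono: "W i \<le> W j" if "i \<le> j" "j \<le> s" for i j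
    using that w(1)[OF h_in] unfolding W_def by (intro sum_mono2) auto
  \<comment> \<open>the index of the interval that contains \<open>l\<close>\<close>
  define t where "t l = (LEAST i. real l < N * W (Suc i))" for l
  have t: "t l < s \<and> N * W (t l) \<le> l \<and> l < N * W (Suc (t l))" if "l < N" for l
  proof -
    have "s > 0" using W by (cases s) auto
    then have "real l < N * W (Suc (s - 1))" using that W(2) by simp
    then have 1: "t l \<le> s - 1" "real l < N * W (Suc (t l))"
      unfolding t_def by (auto intro: Least_le LeastI)
    have "N * W (t l) \<le> l"
    proof (cases "t l")
      case (Suc i)
      then have "\<not> real l < N * W (Suc i)" using not_less_Least[of i "\<lambda>i. real l < N * W (Suc i)"] by (simp add: t_def)
      then show ?thesis using Suc by simp
    qed (simp add: W)
    then show ?thesis using 1 \<open>s > 0\<close> by auto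
  qed
  have t_eq: "t l = i" if "i < s" "N * W i \<le> l" "l < N * W (Suc i)" "l < N" for l i
  proof (rule ccontr)
    assume "t l \<noteq> i"
    then consider "Suc (t l) \<le> i" | "Suc i \<le> t l" by linarith
    then show False
    proof cases
      case 1
      then have "real N * W (Suc (t l)) \<le> N * W i" using that by (intro mult_left_mono W_mono) auto
      then show ?thesis using t[OF that(4)] that by linarith
    next
      case 2
      then have "real N * W (Suc i) \<le> N * W (t l)" using t[OF that(4)] by (intro mult_left_mono W_mono) auto
      then show ?thesis using t[OF that(4)] that by linarith
    qed
  qed
  define a where "a l = h (t l)" for l
  have count: "\<bar>real (card {l\<in>{..<N}. t l = i}) - N * snd \<rho> (h i)\<bar> \<le> 1" if "i < s" for i
  proof -
    have top: "real N * W (Suc i) \<le> real N * 1" using W_mono[of "Suc i" s] that W(2) by (intro mult_left_mono) auto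
    have "t l = i \<and> l < N \<longleftrightarrow> N * W i \<le> real l \<and> real l < N * W (Suc i)" for l
    proof
      assume l: "N * W i \<le> real l \<and> real l < N * W (Suc i)"
      then have "l < N" using top by linarith
      then show "t l = i \<and> l < N" using t_eq[OF that] l by simp
    qed (use t[of l] in auto)
    then have "{l\<in>{..<N}. t l = i} = {l. N * W i \<le> real l \<and> real l < N * W (Suc i)}"
      by (simp add: conj_commute)
    moreover have "0 \<le> N * W i" "N * W i \<le> N * W (Suc i)"
      using W_mono[of 0 i] W_mono[of i "Suc i"] that W(1) by (auto intro: mult_left_mono)
    ultimately show ?thesis
      using card_nats_between[of "N * W i" "N * W (Suc i)"] by (simp add: W(3) algebra_simps)
  qed
  have "\<bar>freq N a E - avg \<rho> (indicator E)\<bar> \<le> s / N" for E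
  proof -
    define H where "H = {..<s} \<inter> {i. h i \<in> E}"
    have "{l\<in>{..<N}. a l \<in> E} = (\<Union>i\<in>H. {l\<in>{..<N}. t l = i})"
      using t by (auto simp: a_def H_def)
    moreover have "card (\<Union>i\<in>H. {l\<in>{..<N}. t l = i}) = (\<Sum>i\<in>H. card {l\<in>{..<N}. t l = i})"
      by (rule card_UN_disjoint) (auto simp: H_def)
    ultimately have "real (card {l\<in>{..<N}. a l \<in> E}) = (\<Sum>i\<in>H. real (card {l\<in>{..<N}. t l = i}))"
      by (simp only: of_nat_sum)
    moreover have "avg \<rho> (indicator E) = (\<Sum>i<s. snd \<rho> (h i) * indicator E (h i))"
      unfolding avg_def by (rule sum.reindex_bij_betw[OF h, symmetric])
    then have "avg \<rho> (indicator E) = (\<Sum>i\<in>H. snd \<rho> (h i))"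
      by (simp add: H_def indicator_def if_distrib sum.If_cases cong: if_cong)
    ultimately have "\<bar>freq N a E - avg \<rho> (indicator E)\<bar>
        = \<bar>\<Sum>i\<in>H. real (card {l\<in>{..<N}. t l = i}) - N * snd \<rho> (h i)\<bar> / N"
      using \<open>0 < N\<close> by (simp add: freq_def sum_subtractf field_simps flip: sum_distrib_left)
    also have "\<dots> \<le> (\<Sum>i\<in>H. 1) / N"
      using count by (intro divide_right_mono order_trans[OF sum_abs] sum_mono) (auto simp: H_def)
    also have "\<dots> \<le> s / N"
      using card_mono[of "{..<s}" H] by (intro divide_right_mono) (auto simp: H_def)
    finally show ?thesis .
  qed
  moreover have "\<forall>l<N. a l \<in> fst \<rho>" using t h_in by (auto simp: a_def)
  ultimately show ?thesis by (auto simp: s_def)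
qed

text \<open>
  The sample size \<open>k\<close> does not depend on the finite subfamily \<open>\<E>0\<close>: a sample representing \<open>m\<close> well on
  \<open>\<E>0\<close> may have to be large, but it can be shrunk to a size that depends on \<open>r\<close>, \<open>d\<close> and \<open>\<epsilon>\<close> only.
\<close>

lemma (in charge) ex_uniform_sample:
  assumes "\<E> \<subseteq> \<A>" "\<epsilon> > 0"
    and traces: "\<And>n a. (\<forall>i<n. a i \<in> \<Omega>) \<Longrightarrow> card (traces \<E> n a) \<le> r + (n + 1) ^ d"
  shows "\<exists>k>0. \<forall>\<E>0. finite \<E>0 \<and> \<E>0 \<subseteq> \<E> \<longrightarrow>
    (\<exists>a. (\<forall>i<k. a i \<in> \<Omega>) \<and> (\<forall>E\<in>\<E>0. \<bar>freq k a E - m E\<bar> \<le> \<epsilon>))"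
proof -
  obtain j1 where j1: "\<forall>j\<ge>j1. 2 * (real r + (2 * 2 ^ j + 1) ^ d) < exp (((3/4) ^ j)\<^sup>2 * 2 ^ j / 4)"
    using eventually_few_traces[of r d] by blast
  obtain j2 where j2: "(3/4::real) ^ j2 < \<epsilon> / 4"
    using real_arch_pow_inv[of "\<epsilon>/4" "3/4"] assms(2) by auto
  define j0 where "j0 = max j1 j2"
  have small: "2 * (3/4::real) ^ j0 \<le> \<epsilon> / 2"
  proof -
    have "(3/4::real) ^ j0 \<le> (3/4) ^ j2" by (rule power_decreasing) (auto simp: j0_def)
    then show ?thesis using j2 by linarith
  qed
  have "\<exists>a. (\<forall>i<2^j0. a i \<in> \<Omega>) \<and> (\<forall>E\<in>\<E>0. \<bar>freq (2^j0) a E - m E\<bar> \<le> \<epsilon>)"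
    if \<E>0: "finite \<E>0" "\<E>0 \<subseteq> \<E>" for \<E>0
  proof -
    obtain \<rho> where \<rho>: "represents m \<Omega> \<E>0 \<rho>" using ex_represents'[of \<E>0] \<E>0 assms(1) by blast
    obtain J' where J': "real (card (fst \<rho>)) * 2 / \<epsilon> < 2 ^ J'"
      using real_arch_pow[of 2] by auto
    define J where "J = max j0 J'"
    have "(2::real) ^ J' \<le> 2 ^ J" by (rule power_increasing) (auto simp: J_def)
    then have J: "card (fst \<rho>) / 2 ^ J \<le> \<epsilon> / 2"
    proof -
      have "real (card (fst \<rho>)) * 2 / \<epsilon> \<le> 2 ^ J" using J' \<open>2 ^ J' \<le> 2 ^ J\<close> by linarith
      then show ?thesis using assms(2) by (simp add: field_simps)
    qed
    obtain b where b: "\<forall>l<2^J. b l \<in> fst \<rho>"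
      "\<forall>E. \<bar>freq (2^J) b E - avg \<rho> (indicator E)\<bar> \<le> card (fst \<rho>) / 2 ^ J"
      using sample_of_weights[OF \<rho>, of "2^J"] by auto
    have "card (traces \<E>0 n a) \<le> r + (n + 1) ^ d" if "\<forall>i<n. a i \<in> \<Omega>" for n a
    proof -
      have "traces \<E>0 n a \<subseteq> traces \<E> n a" unfolding traces_def by (rule image_mono) fact
      then show ?thesis using traces[OF that] card_mono[OF finite_traces] le_trans by blast
    qed
    moreover have "\<forall>i<2^J. b i \<in> \<Omega>" using b(1) \<rho> by (auto simp: represents_def)
    ultimately obtain a where a: "\<forall>i<2^j0. a i \<in> \<Omega>"
      "\<forall>C\<in>\<E>0. \<bar>freq (2^j0) a C - freq (2^J) b C\<bar> \<le> 2 * (3/4)^j0 - 2 * (3/4)^J"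
      using shrink_sample[of j0 r d \<Omega> \<E>0 J b] j1 by (auto simp: j0_def J_def)
    have "\<bar>freq (2^j0) a E - m E\<bar> \<le> \<epsilon>" if "E \<in> \<E>0" for E
    proof -
      have "avg \<rho> (indicator E) = m E" using \<rho> that by (auto simp: represents_def)
      moreover have "(3/4::real) ^ J \<ge> 0" by simp
      ultimately show ?thesis
        using bspec[OF a(2) that] spec[OF b(2), of E] J small by linarith
    qed
    then show ?thesis using a(1) by blast
  qed
  then show ?thesis by (intro exI[of _ "2^j0"]) auto
qed

text \<open>
  Compactness for \<open>k\<close>-tuples: conditions on the membership pattern of a tuple in the sets of the family can
  be met simultaneously if any finitely many of them can. The conditions are arbitrary predicates on
  finite patterns, so nothing has to be said about how they are defined.
\<close>

definition compact_family :: "'x set \<Rightarrow> 'x set set \<Rightarrow> bool" where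
  "compact_family \<Omega> \<E> \<longleftrightarrow> (\<forall>k Q.
     (\<forall>\<E>0. finite \<E>0 \<and> \<E>0 \<subseteq> \<E> \<longrightarrow>
        (\<exists>a::nat \<Rightarrow> 'x. (\<forall>i<k. a i \<in> \<Omega>) \<and> (\<forall>E\<in>\<E>0. Q E {i\<in>{..<k}. a i \<in> E}))) \<longrightarrow>
     (\<exists>a::nat \<Rightarrow> 'x. (\<forall>i<k. a i \<in> \<Omega>) \<and> (\<forall>E\<in>\<E>. Q E {i\<in>{..<k}. a i \<in> E})))"

lemma (in charge) ex_uniform_sample_compact:
  assumes "\<E> \<subseteq> \<A>" "\<epsilon> > 0" "compact_family \<Omega> \<E>"
    and traces: "\<And>n a. (\<forall>i<n. a i \<in> \<Omega>) \<Longrightarrow> card (traces \<E> n a) \<le> r + (n + 1) ^ d"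
  shows "\<exists>k>0. \<exists>a. (\<forall>i<k. a i \<in> \<Omega>) \<and> (\<forall>E\<in>\<E>. \<bar>freq k a E - m E\<bar> \<le> \<epsilon>)"
proof -
  obtain k where "k > 0" and k: "\<forall>\<E>0. finite \<E>0 \<and> \<E>0 \<subseteq> \<E> \<longrightarrow>
    (\<exists>a. (\<forall>i<k. a i \<in> \<Omega>) \<and> (\<forall>E\<in>\<E>0. \<bar>freq k a E - m E\<bar> \<le> \<epsilon>))"
    using ex_uniform_sample[OF assms(1,2) traces] by blast
  show ?thesis
    using assms(3)[unfolded compact_family_def, rule_format,
        where k = k and Q = "\<lambda>E T. \<bar>real (card T) / k - m E\<bar> \<le> \<epsilon>"] k \<open>k > 0\<close>
    unfolding freq_def by blast
qed

section \<open>Convolution of charges on a semigroup\<close>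

locale definable_semigroup = algebra \<Omega> \<A> for \<Omega> :: "'x set" and \<A> +
  fixes mul :: "'x \<Rightarrow> 'x \<Rightarrow> 'x"  (infixl \<open>\<odot>\<close> 70)
  assumes mul_closed: "x \<in> \<Omega> \<Longrightarrow> y \<in> \<Omega> \<Longrightarrow> x \<odot> y \<in> \<Omega>"
    and mul_assoc: "x \<in> \<Omega> \<Longrightarrow> y \<in> \<Omega> \<Longrightarrow> z \<in> \<Omega> \<Longrightarrow> (x \<odot> y) \<odot> z = x \<odot> (y \<odot> z)"
    and translate_sets: "A \<in> \<A> \<Longrightarrow> d \<in> \<Omega> \<Longrightarrow> {x\<in>\<Omega>. x \<odot> d \<in> A} \<in> \<A>"
begin

definition conv :: "('x set \<Rightarrow> real) \<Rightarrow> ('x set \<Rightarrow> real) \<Rightarrow> 'x set \<Rightarrow> real" where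
  "conv \<mu> \<nu> A = fint \<Omega> \<A> \<nu> (\<lambda>d. \<mu> {x\<in>\<Omega>. x \<odot> d \<in> A})"

text \<open>
  Definability of a Keisler measure, reduced to the formulas \<open>\<phi>(x \<cdot> d)\<close> that matter for convolution.
\<close>

definition definable_charge :: "('x set \<Rightarrow> real) \<Rightarrow> bool" where
  "definable_charge \<mu> \<longleftrightarrow> charge \<Omega> \<A> \<mu> \<and> (\<forall>A\<in>\<A>. tmeas \<Omega> \<A> (\<lambda>d. \<mu> {x\<in>\<Omega>. x \<odot> d \<in> A}))"

lemma tmeas_translate:
  assumes "tmeas \<Omega> \<A> f" "d \<in> \<Omega>"
  shows "tmeas \<Omega> \<A> (\<lambda>x. f (x \<odot> d))"
proof (rule tmeas_compose[OF assms(1)])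
  show "x \<odot> d \<in> \<Omega>" if "x \<in> \<Omega>" for x by (rule mul_closed[OF that assms(2)])
  fix A assume "A \<in> \<A>"
  then show "\<exists>B\<in>\<A>. \<forall>x\<in>\<Omega>. x \<in> B \<longleftrightarrow> x \<odot> d \<in> A"
    using translate_sets[OF _ assms(2)] by (intro bexI[of _ "{x\<in>\<Omega>. x \<odot> d \<in> A}"]) auto
qed

lemma mean_translate:
  assumes "charge \<Omega> \<A> \<mu>" "d \<in> \<Omega>"
  shows "mean \<Omega> \<A> (\<lambda>f. fint \<Omega> \<A> \<mu> (\<lambda>x. f (x \<odot> d)))"
proof -
  interpret \<mu>: charge \<Omega> \<A> \<mu> by fact
  show ?thesis
    unfolding mean_def using assms(2) mul_closed
    by (auto intro!: \<mu>.fint_add \<mu>.fint_cmult \<mu>.fint_mono \<mu>.fint_const tmeas_translate)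
qed

lemma fint_translate_indicator:
  assumes "charge \<Omega> \<A> \<mu>" "d \<in> \<Omega>" "A \<in> \<A>"
  shows "fint \<Omega> \<A> \<mu> (\<lambda>x. indicator A (x \<odot> d)) = \<mu> {x\<in>\<Omega>. x \<odot> d \<in> A}"
proof -
  interpret \<mu>: charge \<Omega> \<A> \<mu> by fact
  have "fint \<Omega> \<A> \<mu> (\<lambda>x. indicator A (x \<odot> d)) = fint \<Omega> \<A> \<mu> (indicator {x\<in>\<Omega>. x \<odot> d \<in> A})"
    by (rule \<mu>.fint_cong) (simp add: indicator_def)
  then show ?thesis using \<mu>.fint_indicator translate_sets assms by simp
qed

lemma tmeas_fint_translate:
  assumes "definable_charge \<mu>" "tmeas \<Omega> \<A> f"
  shows "tmeas \<Omega> \<A> (\<lambda>d. fint \<Omega> \<A> \<mu> (\<lambda>x. f (x \<odot> d)))"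
proof (rule tmeas_mean_family[where T = "\<lambda>d f. fint \<Omega> \<A> \<mu> (\<lambda>x. f (x \<odot> d))", OF _ _ _ assms(2)])
  have \<mu>: "charge \<Omega> \<A> \<mu>" using assms(1) by (simp add: definable_charge_def)
  show "mean \<Omega> \<A> (\<lambda>f. fint \<Omega> \<A> \<mu> (\<lambda>x. f (x \<odot> d)))" if "d \<in> \<Omega>" for d
    by (rule mean_translate[OF \<mu> that])
  show "algebra \<Omega> \<A>" by unfold_locales
  show "tmeas \<Omega> \<A> (\<lambda>d. fint \<Omega> \<A> \<mu> (\<lambda>x. indicator A (x \<odot> d)))" if "A \<in> \<A>" for A
    using assms(1) that
    by (subst tmeas_cong[OF fint_translate_indicator[OF \<mu> _ that]]) (auto simp: definable_charge_def)
qed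

lemma mean_conv:
  assumes "definable_charge \<mu>" "charge \<Omega> \<A> \<nu>"
  shows "mean \<Omega> \<A> (\<lambda>f. fint \<Omega> \<A> \<nu> (\<lambda>d. fint \<Omega> \<A> \<mu> (\<lambda>x. f (x \<odot> d))))"
proof -
  interpret \<nu>: charge \<Omega> \<A> \<nu> by fact
  have \<mu>: "charge \<Omega> \<A> \<mu>" using assms(1) by (simp add: definable_charge_def)
  interpret \<mu>: charge \<Omega> \<A> \<mu> by fact
  let ?T = "\<lambda>f d. fint \<Omega> \<A> \<mu> (\<lambda>x. f (x \<odot> d))"
  note tm = tmeas_fint_translate[OF assms(1)]
  show ?thesis
    unfolding mean_def
  proof (intro conjI allI impI)
    fix f g assume fg: "tmeas \<Omega> \<A> f" "tmeas \<Omega> \<A> g"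
    have "fint \<Omega> \<A> \<nu> (?T (\<lambda>x. f x + g x)) = fint \<Omega> \<A> \<nu> (\<lambda>d. ?T f d + ?T g d)"
      using fg by (intro \<nu>.fint_cong \<mu>.fint_add tmeas_translate)
    then show "fint \<Omega> \<A> \<nu> (?T (\<lambda>x. f x + g x)) = fint \<Omega> \<A> \<nu> (?T f) + fint \<Omega> \<A> \<nu> (?T g)"
      using \<nu>.fint_add[OF tm[OF fg(1)] tm[OF fg(2)]] by simp
    show "fint \<Omega> \<A> \<nu> (?T f) \<le> fint \<Omega> \<A> \<nu> (?T g)" if "\<forall>x\<in>\<Omega>. f x \<le> g x"
      using fg that by (intro \<nu>.fint_mono \<mu>.fint_mono tm tmeas_translate) (auto intro: mul_closed)
  next
    fix c f assume f: "tmeas \<Omega> \<A> f"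
    have "fint \<Omega> \<A> \<nu> (?T (\<lambda>x. c * f x)) = fint \<Omega> \<A> \<nu> (\<lambda>d. c * ?T f d)"
      using f by (intro \<nu>.fint_cong \<mu>.fint_cmult tmeas_translate)
    then show "fint \<Omega> \<A> \<nu> (?T (\<lambda>x. c * f x)) = c * fint \<Omega> \<A> \<nu> (?T f)"
      using \<nu>.fint_cmult[OF tm[OF f]] by simp
  qed (simp add: \<mu>.fint_const \<nu>.fint_const)
qed

lemma conv_eq_fint:
  assumes "definable_charge \<mu>" "charge \<Omega> \<A> \<nu>" "A \<in> \<A>"
  shows "conv \<mu> \<nu> A = fint \<Omega> \<A> \<nu> (\<lambda>d. fint \<Omega> \<A> \<mu> (\<lambda>x. indicator A (x \<odot> d)))"
proof -
  interpret \<nu>: charge \<Omega> \<A> \<nu> by fact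
  show ?thesis unfolding conv_def
    using assms by (intro \<nu>.fint_cong fint_translate_indicator[symmetric]) (auto simp: definable_charge_def)
qed

lemma charge_conv:
  assumes "definable_charge \<mu>" "charge \<Omega> \<A> \<nu>"
  shows "charge \<Omega> \<A> (conv \<mu> \<nu>)"
proof -
  interpret c: charge \<Omega> \<A> "\<lambda>A. fint \<Omega> \<A> \<nu> (\<lambda>d. fint \<Omega> \<A> \<mu> (\<lambda>x. indicator A (x \<odot> d)))"
    by (rule charge_mean[OF mean_conv[OF assms]])
  show ?thesis
    using c.nonneg c.total c.additive conv_eq_fint[OF assms] by unfold_locales (simp_all add: Un)
qed

text \<open>
  Both sides are means with the same values on indicator functions.
\<close>

lemma fint_conv:
  assumes "definable_charge \<mu>" "charge \<Omega> \<A> \<nu>" "tmeas \<Omega> \<A> f"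
  shows "fint \<Omega> \<A> (conv \<mu> \<nu>) f = fint \<Omega> \<A> \<nu> (\<lambda>d. fint \<Omega> \<A> \<mu> (\<lambda>x. f (x \<odot> d)))"
proof -
  interpret c: charge \<Omega> \<A> "conv \<mu> \<nu>" by (rule charge_conv[OF assms(1,2)])
  show ?thesis
    by (rule mean_unique[OF c.mean_fint mean_conv[OF assms(1,2)] _ assms(3)])
       (simp add: c.fint_indicator conv_eq_fint[OF assms(1,2)])
qed

lemma conv_translate:
  assumes "definable_charge \<mu>" "charge \<Omega> \<A> \<nu>" "A \<in> \<A>" "e \<in> \<Omega>"
  shows "conv \<mu> \<nu> {x\<in>\<Omega>. x \<odot> e \<in> A} = fint \<Omega> \<A> \<nu> (\<lambda>d. \<mu> {x\<in>\<Omega>. x \<odot> (d \<odot> e) \<in> A})"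
proof -
  interpret \<nu>: charge \<Omega> \<A> \<nu> by fact
  show ?thesis unfolding conv_def
    using assms(4) mul_closed
    by (intro \<nu>.fint_cong arg_cong[of _ _ \<mu>]) (auto simp: mul_assoc)
qed

lemma definable_charge_conv:
  assumes "definable_charge \<mu>" "definable_charge \<nu>"
  shows "definable_charge (conv \<mu> \<nu>)"
proof -
  have \<nu>: "charge \<Omega> \<A> \<nu>" using assms(2) by (simp add: definable_charge_def)
  show ?thesis
    unfolding definable_charge_def
  proof (intro conjI ballI)
    show "charge \<Omega> \<A> (conv \<mu> \<nu>)" by (rule charge_conv[OF assms(1) \<nu>])
    fix A assume "A \<in> \<A>"
    then have "tmeas \<Omega> \<A> (\<lambda>d. \<mu> {x\<in>\<Omega>. x \<odot> d \<in> A})" using assms(1) by (simp add: definable_charge_def)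
    from tmeas_fint_translate[OF assms(2) this]
    show "tmeas \<Omega> \<A> (\<lambda>e. conv \<mu> \<nu> {x\<in>\<Omega>. x \<odot> e \<in> A})"
      by (subst tmeas_cong[OF conv_translate[OF assms(1) \<nu> \<open>A \<in> \<A>\<close>]])
  qed
qed

lemma conv_cong:
  assumes "charge \<Omega> \<A> \<nu>" "charge \<Omega> \<A> \<nu>'" "definable_charge \<mu>"
    and "\<And>A. A \<in> \<A> \<Longrightarrow> \<mu> A = \<mu>' A" "\<And>A. A \<in> \<A> \<Longrightarrow> \<nu> A = \<nu>' A" "A \<in> \<A>"
  shows "conv \<mu> \<nu> A = conv \<mu>' \<nu>' A"
proof -
  interpret \<nu>: charge \<Omega> \<A> \<nu> by fact
  interpret \<nu>': charge \<Omega> \<A> \<nu>' by fact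
  have "conv \<mu> \<nu> A = fint \<Omega> \<A> \<nu>' (\<lambda>d. \<mu> {x\<in>\<Omega>. x \<odot> d \<in> A})"
    unfolding conv_def
  proof (rule mean_unique[OF \<nu>.mean_fint \<nu>'.mean_fint])
    show "tmeas \<Omega> \<A> (\<lambda>d. \<mu> {x\<in>\<Omega>. x \<odot> d \<in> A})"
      using assms(3,6) by (simp add: definable_charge_def)
  qed (simp add: \<nu>.fint_indicator \<nu>'.fint_indicator assms(5))
  also have "\<dots> = conv \<mu>' \<nu>' A"
    unfolding conv_def using translate_sets assms(4,6) by (intro \<nu>'.fint_cong) simp
  finally show ?thesis .
qed

text \<open>
  Both sides are the iterated integral of \<open>\<mu> {x. x \<odot> (d \<odot> e) \<in> A}\<close> over \<open>d\<close> with respect to \<open>\<nu>\<close> and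
  \<open>e\<close> with respect to \<open>\<rho>\<close>.
\<close>

lemma conv_assoc:
  assumes "definable_charge \<mu>" "definable_charge \<nu>" "charge \<Omega> \<A> \<rho>" "A \<in> \<A>"
  shows "conv (conv \<mu> \<nu>) \<rho> A = conv \<mu> (conv \<nu> \<rho>) A"
proof -
  interpret \<rho>: charge \<Omega> \<A> \<rho> by fact
  have \<nu>: "charge \<Omega> \<A> \<nu>" using assms(2) by (simp add: definable_charge_def)
  have "tmeas \<Omega> \<A> (\<lambda>d. \<mu> {x\<in>\<Omega>. x \<odot> d \<in> A})" using assms(1,4) by (simp add: definable_charge_def)
  then have "conv \<mu> (conv \<nu> \<rho>) A = fint \<Omega> \<A> \<rho> (\<lambda>e. fint \<Omega> \<A> \<nu> (\<lambda>d. \<mu> {x\<in>\<Omega>. x \<odot> (d \<odot> e) \<in> A}))"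
    unfolding conv_def[of \<mu>] by (rule fint_conv[OF assms(2,3)])
  also have "\<dots> = conv (conv \<mu> \<nu>) \<rho> A"
    unfolding conv_def[of _ \<rho>] using assms(4)
    by (intro \<rho>.fint_cong conv_translate[OF assms(1) \<nu>, symmetric])
  finally show ?thesis by simp
qed

end

section \<open>Exchanging the order of integration\<close>

definition shattered_by :: "'x set \<Rightarrow> ('x \<Rightarrow> 'x \<Rightarrow> bool) \<Rightarrow> nat \<Rightarrow> bool" where
  "shattered_by \<Omega> R n \<longleftrightarrow> (\<exists>a b. (\<forall>i<n. a i \<in> \<Omega>) \<and> (\<forall>I\<subseteq>{..<n}. b I \<in> \<Omega>) \<and>
     (\<forall>i<n. \<forall>I\<subseteq>{..<n}. R (a i) (b I) \<longleftrightarrow> i \<in> I))"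

text \<open>
  If \<open>d + 1\<close> indices were shattered by the fibres of \<open>R\<close>, then \<open>d\<close> of the points and suitable parameters in \<open>S\<close>
  would realise all patterns for \<open>R\<close>.
\<close>

lemma card_traces_fibres:
  assumes "\<not> shattered_by \<Omega> R d" "S \<subseteq> \<Omega>" "\<forall>i<n. a i \<in> \<Omega>"
  shows "card (traces ((\<lambda>y. {x\<in>\<Omega>. R x y}) ` S) n a) \<le> (n + 1) ^ d"
proof (rule card_traces_le)
  fix Y assume Y: "Y \<subseteq> {..<n}" "shatters (traces ((\<lambda>y. {x\<in>\<Omega>. R x y}) ` S) n a) Y"
  show "card Y \<noteq> Suc d"
  proof
    assume "card Y = Suc d"
    then have "d \<le> card Y" by simp
    then obtain Z where Z: "Z \<subseteq> Y" "card Z = d" by (rule obtain_subset_with_card_n)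
    have "finite Z" using finite_subset[OF subset_trans[OF Z(1) Y(1)]] by simp
    from ex_bij_betw_nat_finite[OF this] obtain h where h: "bij_betw h {..<d} Z"
      unfolding Z(2) atLeast0LessThan by (rule exE)
    have "\<exists>y\<in>S. {i\<in>{..<n}. a i \<in> {x\<in>\<Omega>. R x y}} \<inter> Z = h ` I" if "I \<subseteq> {..<d}" for I
    proof -
      have "h ` I \<subseteq> Z" using h that by (auto simp: bij_betw_def)
      then show ?thesis using shatters_mono[OF Y(2) Z(1)] unfolding shatters_def traces_def by blast
    qed
    then have "\<forall>I\<in>Pow {..<d}. \<exists>y. y \<in> S \<and> {i\<in>{..<n}. a i \<in> {x\<in>\<Omega>. R x y}} \<inter> Z = h ` I" by blast
    then obtain b where "\<forall>I\<in>Pow {..<d}. b I \<in> S \<and> {i\<in>{..<n}. a i \<in> {x\<in>\<Omega>. R x (b I)}} \<inter> Z = h ` I"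
      by (rule bchoice[THEN exE])
    then have b: "\<And>I. I \<subseteq> {..<d} \<Longrightarrow> b I \<in> S"
      "\<And>I. I \<subseteq> {..<d} \<Longrightarrow> {i\<in>{..<n}. a i \<in> {x\<in>\<Omega>. R x (b I)}} \<inter> Z = h ` I" by auto
    have hi: "h i \<in> Z" "h i < n" "a (h i) \<in> \<Omega>" if "i < d" for i
      using that h Z(1) Y(1) assms(3) by (auto simp: bij_betw_def)
    have "R (a (h i)) (b I) \<longleftrightarrow> i \<in> I" if "i < d" "I \<subseteq> {..<d}" for i I
    proof -
      have "R (a (h i)) (b I) \<longleftrightarrow> h i \<in> h ` I" using b(2)[OF that(2)] hi[OF that(1)] by blast
      also have "\<dots> \<longleftrightarrow> i \<in> I" using h that by (intro inj_on_image_mem_iff[of h "{..<d}"]) (auto simp: bij_betw_def)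
      finally show ?thesis .
    qed
    then have "shattered_by \<Omega> R d"
      unfolding shattered_by_def using hi(3) b(1) assms(2)
      by (intro exI[of _ "\<lambda>i. a (h i)"] exI[of _ b]) blast
    then show False using assms(1) by blast
  qed
qed

lemma traces_Un: "traces (\<C> \<union> \<D>) n a = traces \<C> n a \<union> traces \<D> n a"
  by (auto simp: traces_def)

lemma card_traces_le_card: "finite \<C> \<Longrightarrow> card (traces \<C> n a) \<le> card \<C>"
  unfolding traces_def by (rule card_image_le)

lemma avg_divide: "avg \<rho> f / c = avg \<rho> (\<lambda>x. f x / c)"
  by (simp add: avg_def sum_divide_distrib)

text \<open>
  Frequencies close to \<open>m\<close> on the cells of a step function near \<open>f\<close> make the sample mean of \<open>f\<close> close to its
  integral; \<open>\<delta>\<close> has to be small compared with the sum of the coefficients.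
\<close>

lemma (in charge) ex_sample_fint:
  assumes "tmeas \<Omega> \<A> f" "\<epsilon> > 0"
  obtains \<G> \<delta> where "finite \<G>" "\<G> \<subseteq> \<A>" "\<delta> > 0"
    "\<And>k a. 0 < k \<Longrightarrow> (\<forall>i<k. a i \<in> \<Omega>) \<Longrightarrow> (\<forall>E\<in>\<G>. \<bar>freq k a E - m E\<bar> \<le> \<delta>) \<Longrightarrow>
      \<bar>(\<Sum>i<k. f (a i)) / k - fint \<Omega> \<A> m f\<bar> \<le> \<epsilon>"
proof -
  have "\<epsilon> / 3 > 0" using assms(2) by simp
  then obtain P c where P: "finite P" "P \<subseteq> \<A>"
    "\<And>x. x \<in> \<Omega> \<Longrightarrow> \<bar>f x - (\<Sum>A\<in>P. c A * indicator A x)\<bar> \<le> \<epsilon> / 3"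
    by (rule tmeas_step[OF assms(1)]) (rule that)
  \<comment> \<open>the summand \<open>1\<close> only avoids division by zero\<close>
  define \<delta> where "\<delta> = \<epsilon> / 3 / ((\<Sum>A\<in>P. \<bar>c A\<bar>) + 1)"
  have pos: "(\<Sum>A\<in>P. \<bar>c A\<bar>) + 1 > 0" by (intro add_nonneg_pos sum_nonneg) auto
  have int: "\<bar>fint \<Omega> \<A> m f - (\<Sum>A\<in>P. c A * m A)\<bar> \<le> \<epsilon> / 3"
  proof -
    have "\<bar>fint \<Omega> \<A> m f - (\<Sum>A\<in>P. c A * fint \<Omega> \<A> m (indicator A))\<bar> \<le> \<epsilon> / 3"
      by (rule mean_step_close[OF mean_fint assms(1) P(1,2)]) (rule P(3))
    moreover have "(\<Sum>A\<in>P. c A * fint \<Omega> \<A> m (indicator A)) = (\<Sum>A\<in>P. c A * m A)"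
      using P(2) by (intro sum.cong) (auto simp: fint_indicator)
    ultimately show ?thesis by simp
  qed
  show ?thesis
  proof (rule that[OF P(1,2)])
    show "\<delta> > 0" using pos assms(2) by (simp add: \<delta>_def)
    fix k :: nat and a
    assume k: "0 < k" "\<forall>i<k. a i \<in> \<Omega>" "\<forall>E\<in>P. \<bar>freq k a E - m E\<bar> \<le> \<delta>"
    have "\<bar>(\<Sum>i<k. f (a i)) / k - (\<Sum>A\<in>P. c A * freq k a A)\<bar> \<le> \<epsilon> / 3"
    proof -
      have "(\<Sum>A\<in>P. c A * freq k a A) = (\<Sum>i<k. \<Sum>A\<in>P. c A * indicator A (a i)) / k"
        unfolding freq_eq_sum sum.swap[of _ P]
        by (simp only: sum_divide_distrib sum_distrib_left times_divide_eq_right)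
      then have "(\<Sum>i<k. f (a i)) / k - (\<Sum>A\<in>P. c A * freq k a A)
        = (\<Sum>i<k. f (a i) - (\<Sum>A\<in>P. c A * indicator A (a i))) / k"
        by (simp add: sum_subtractf diff_divide_distrib)
      also have "\<bar>\<dots>\<bar> \<le> (\<Sum>i<k. \<epsilon> / 3) / k"
        unfolding abs_divide using P(3) k
        by (auto intro!: divide_right_mono order_trans[OF sum_abs] sum_mono simp del: sum_constant)
      also have "\<dots> = \<epsilon> / 3" using k by simp
      finally show ?thesis .
    qed
    moreover have "\<bar>(\<Sum>A\<in>P. c A * freq k a A) - (\<Sum>A\<in>P. c A * m A)\<bar> \<le> \<epsilon> / 3"
    proof -
      have "(\<Sum>A\<in>P. c A * freq k a A) - (\<Sum>A\<in>P. c A * m A) = (\<Sum>A\<in>P. c A * (freq k a A - m A))"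
        by (simp add: sum_subtractf right_diff_distrib)
      also have "\<bar>\<dots>\<bar> \<le> (\<Sum>A\<in>P. \<bar>c A\<bar> * \<delta>)"
        using k(3) by (intro order_trans[OF sum_abs] sum_mono) (auto simp: abs_mult intro: mult_left_mono)
      also have "\<dots> = (\<Sum>A\<in>P. \<bar>c A\<bar>) * \<delta>" by (rule sum_distrib_right[symmetric])
      also have "\<dots> \<le> ((\<Sum>A\<in>P. \<bar>c A\<bar>) + 1) * \<delta>"
        using \<open>\<delta> > 0\<close> by (intro mult_right_mono) auto
      also have "\<dots> = \<epsilon> / 3"
        using pos nonzero_eq_divide_eq[of "(\<Sum>A\<in>P. \<bar>c A\<bar>) + 1" \<delta> "\<epsilon> / 3"] by (simp add: \<delta>_def mult.commute)
      finally show ?thesis .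
    qed
    ultimately show "\<bar>(\<Sum>i<k. f (a i)) / k - fint \<Omega> \<A> m f\<bar> \<le> \<epsilon>"
      using int by linarith
  qed
qed

lemma (in charge) ex_represents_fint:
  assumes "tmeas \<Omega> \<A> f" "\<epsilon> > 0" "finite \<G>" "\<G> \<subseteq> \<A>" "S \<subseteq> \<Omega>"
    and "\<And>A. A \<in> \<A> \<Longrightarrow> m A > 0 \<Longrightarrow> A \<inter> S \<noteq> {}"
  shows "\<exists>\<rho>. represents m S \<G> \<rho> \<and> \<bar>avg \<rho> f - fint \<Omega> \<A> m f\<bar> < \<epsilon>"
proof -
  have "\<forall>\<^sub>F \<rho> in represent_filter \<Omega> \<A> m. dist (avg \<rho> f) (fint \<Omega> \<A> m f) < \<epsilon>"
    using tendstoD[OF tendsto_fint[OF assms(1)] assms(2)] .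
  then obtain \<H> where \<H>: "finite \<H>" "\<H> \<subseteq> \<A>"
    "\<And>\<rho>. represents m \<Omega> \<H> \<rho> \<Longrightarrow> dist (avg \<rho> f) (fint \<Omega> \<A> m f) < \<epsilon>"
    unfolding eventually_represent_filter by blast
  obtain \<rho> where \<rho>: "represents m S (\<G> \<union> \<H>) \<rho>"
    using ex_represents[of "\<G> \<union> \<H>" S] assms \<H> by blast
  then have "represents m S \<G> \<rho>" "represents m \<Omega> \<H> \<rho>"
    using assms(5) by (auto intro: represents_mono)
  then show ?thesis using \<H>(3)[of \<rho>] by (intro exI[of _ \<rho>]) (simp add: dist_real_def)
qed

context definable_semigroup begin

definition finsat_in :: "('x set \<Rightarrow> real) \<Rightarrow> 'x set \<Rightarrow> bool" where
  "finsat_in \<nu> S \<longleftrightarrow> S \<subseteq> \<Omega> \<and> (\<forall>A\<in>\<A>. \<nu> A > 0 \<longrightarrow> A \<inter> S \<noteq> {})"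

text \<open>
  The exchange of the two integrals of the indicator function of \<open>x \<odot> d \<in> A\<close>. First choose a sample
  \<open>a 0, \<dots>, a (k - 1)\<close> that approximates \<open>\<mu>\<close> on \<open>{x. x \<odot> d \<in> A}\<close> uniformly in \<open>d \<in> S\<close> and also computes
  the outer integral on the left. Then choose weighted points \<open>\<rho>\<close> of \<open>S\<close> that represent \<open>\<nu>\<close> on the \<open>k\<close>
  sets \<open>{d. a i \<odot> d \<in> A}\<close> and compute the outer integral on the right. The order of the choices matters: the
  points of \<open>\<rho>\<close> depend on the sample, but as they lie in \<open>S\<close> the sample was good for them beforehand.
\<close>

lemma fint_swap:
  assumes \<mu>: "definable_charge \<mu>" and \<nu>: "charge \<Omega> \<A> \<nu>" and A: "A \<in> \<A>"
    and left_sets: "\<And>x. x \<in> \<Omega> \<Longrightarrow> {d\<in>\<Omega>. x \<odot> d \<in> A} \<in> \<A>"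
    and f: "tmeas \<Omega> \<A> (\<lambda>x. \<nu> {d\<in>\<Omega>. x \<odot> d \<in> A})"
    and S: "finsat_in \<nu> S"
    and nip: "\<not> shattered_by \<Omega> (\<lambda>x d. x \<odot> d \<in> A) n"
    and compact: "\<And>\<G>. finite \<G> \<Longrightarrow> \<G> \<subseteq> \<A> \<Longrightarrow>
      compact_family \<Omega> ((\<lambda>d. {x\<in>\<Omega>. x \<odot> d \<in> A}) ` S \<union> \<G>)"
  shows "fint \<Omega> \<A> \<mu> (\<lambda>x. \<nu> {d\<in>\<Omega>. x \<odot> d \<in> A}) = fint \<Omega> \<A> \<nu> (\<lambda>d. \<mu> {x\<in>\<Omega>. x \<odot> d \<in> A})"
proof -
  have \<mu>': "charge \<Omega> \<A> \<mu>" and g: "tmeas \<Omega> \<A> (\<lambda>d. \<mu> {x\<in>\<Omega>. x \<odot> d \<in> A})"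
    using \<mu> A by (auto simp: definable_charge_def)
  interpret \<mu>: charge \<Omega> \<A> \<mu> by fact
  interpret \<nu>: charge \<Omega> \<A> \<nu> by fact
  define f where "f x = \<nu> {d\<in>\<Omega>. x \<odot> d \<in> A}" for x
  define g where "g d = \<mu> {x\<in>\<Omega>. x \<odot> d \<in> A}" for d
  have S': "S \<subseteq> \<Omega>" "\<And>A. A \<in> \<A> \<Longrightarrow> \<nu> A > 0 \<Longrightarrow> A \<inter> S \<noteq> {}" using S by (auto simp: finsat_in_def)
  have "\<bar>fint \<Omega> \<A> \<mu> f - fint \<Omega> \<A> \<nu> g\<bar> \<le> e" if "e > 0" for e
  proof -
    define \<epsilon> where "\<epsilon> = e / 3"
    have "\<epsilon> > 0" using that by (simp add: \<epsilon>_def)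
    obtain \<G> \<delta> where \<G>: "finite \<G>" "\<G> \<subseteq> \<A>" "\<delta> > 0"
      "\<And>k a. 0 < k \<Longrightarrow> (\<forall>i<k. a i \<in> \<Omega>) \<Longrightarrow> (\<forall>E\<in>\<G>. \<bar>freq k a E - \<mu> E\<bar> \<le> \<delta>) \<Longrightarrow>
        \<bar>(\<Sum>i<k. f (a i)) / k - fint \<Omega> \<A> \<mu> f\<bar> \<le> \<epsilon>"
      using \<mu>.ex_sample_fint[OF f \<open>\<epsilon> > 0\<close>] unfolding f_def by blast
    define \<E> where "\<E> = (\<lambda>d. {x\<in>\<Omega>. x \<odot> d \<in> A}) ` S \<union> \<G>"
    have "\<exists>k>0. \<exists>a. (\<forall>i<k. a i \<in> \<Omega>) \<and> (\<forall>E\<in>\<E>. \<bar>freq k a E - \<mu> E\<bar> \<le> min \<epsilon> \<delta>)"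
    proof (rule \<mu>.ex_uniform_sample_compact)
      show "\<E> \<subseteq> \<A>" using translate_sets[OF A] S'(1) \<G>(2) by (auto simp: \<E>_def)
      show "compact_family \<Omega> \<E>" unfolding \<E>_def by (rule compact[OF \<G>(1,2)])
      show "min \<epsilon> \<delta> > 0" using \<open>\<epsilon> > 0\<close> \<G>(3) by simp
      fix m and a :: "nat \<Rightarrow> 'x" assume "\<forall>i<m. a i \<in> \<Omega>"
      then have "card (traces ((\<lambda>d. {x\<in>\<Omega>. x \<odot> d \<in> A}) ` S) m a) \<le> (m + 1) ^ n"
        by (rule card_traces_fibres[OF nip S'(1)])
      then show "card (traces \<E> m a) \<le> card \<G> + (m + 1) ^ n"
        using card_traces_le_card[OF \<G>(1), of m a]
          card_Un_le[of "traces ((\<lambda>d. {x\<in>\<Omega>. x \<odot> d \<in> A}) ` S) m a" "traces \<G> m a"]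
        unfolding \<E>_def traces_Un by linarith
    qed
    then obtain k a where k: "k > 0" "\<forall>i<k. a i \<in> \<Omega>"
      and a: "\<And>E. E \<in> \<E> \<Longrightarrow> \<bar>freq k a E - \<mu> E\<bar> \<le> min \<epsilon> \<delta>" by blast
    have 1: "\<bar>(\<Sum>i<k. f (a i)) / k - fint \<Omega> \<A> \<mu> f\<bar> \<le> \<epsilon>"
      using \<G>(4)[OF k] a by (auto simp: \<E>_def)
    define \<H> where "\<H> = (\<lambda>i. {d\<in>\<Omega>. a i \<odot> d \<in> A}) ` {..<k}"
    have "finite \<H>" "\<H> \<subseteq> \<A>" using left_sets k(2) by (auto simp: \<H>_def)
    then obtain \<rho> where \<rho>: "represents \<nu> S \<H> \<rho>" and 2: "\<bar>avg \<rho> g - fint \<Omega> \<A> \<nu> g\<bar> < \<epsilon>"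
      using \<nu>.ex_represents_fint[OF g \<open>\<epsilon> > 0\<close> _ _ S'] unfolding g_def by blast
    have "(\<Sum>i<k. f (a i)) / k = avg \<rho> (\<lambda>d. freq k a {x\<in>\<Omega>. x \<odot> d \<in> A})"
    proof -
      have "f (a i) = avg \<rho> (\<lambda>d. indicator {x\<in>\<Omega>. x \<odot> d \<in> A} (a i))" if "i < k" for i
      proof -
        have "f (a i) = avg \<rho> (indicator {d\<in>\<Omega>. a i \<odot> d \<in> A})"
          using \<rho> that by (auto simp: represents_def \<H>_def f_def)
        also have "\<dots> = avg \<rho> (\<lambda>d. indicator {x\<in>\<Omega>. x \<odot> d \<in> A} (a i))"
          using \<rho> S'(1) k(2) that unfolding avg_def
          by (intro sum.cong) (auto simp: represents_def indicator_def)
        finally show ?thesis .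
      qed
      then have "(\<Sum>i<k. f (a i)) / k = (\<Sum>i<k. avg \<rho> (\<lambda>d. indicator {x\<in>\<Omega>. x \<odot> d \<in> A} (a i))) / k"
        by simp
      also have "\<dots> = avg \<rho> (\<lambda>d. freq k a {x\<in>\<Omega>. x \<odot> d \<in> A})"
        unfolding avg_sum[symmetric] freq_eq_sum by (rule avg_divide)
      finally show ?thesis .
    qed
    moreover have "\<bar>avg \<rho> (\<lambda>d. freq k a {x\<in>\<Omega>. x \<odot> d \<in> A}) - avg \<rho> g\<bar> \<le> \<epsilon>"
    proof (rule avg_close[OF \<rho>])
      fix d assume "d \<in> S"
      then have "\<bar>freq k a {x\<in>\<Omega>. x \<odot> d \<in> A} - \<mu> {x\<in>\<Omega>. x \<odot> d \<in> A}\<bar> \<le> min \<epsilon> \<delta>"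
        by (intro a) (simp add: \<E>_def)
      then show "\<bar>freq k a {x\<in>\<Omega>. x \<odot> d \<in> A} - g d\<bar> \<le> \<epsilon>" by (simp add: g_def)
    qed
    ultimately show ?thesis using 1 2 unfolding \<epsilon>_def by linarith
  qed
  then have "\<bar>fint \<Omega> \<A> \<mu> f - fint \<Omega> \<A> \<nu> g\<bar> \<le> 0" by (rule dense_ge)
  then have "fint \<Omega> \<A> \<mu> f = fint \<Omega> \<A> \<nu> g" by simp
  then show ?thesis by (simp add: f_def[abs_def] g_def[abs_def])
qed

text \<open>
  With \<open>\<nu> * \<mu> = \<mu> * \<nu>\<close>, associativity gives
  \<open>\<nu> * (\<mu> * \<nu>) = (\<mu> * \<nu>) * \<nu> = \<mu> * \<nu>\<close>, and hence \<open>(\<mu> * \<nu>) * (\<mu> * \<nu>) = \<mu> * (\<mu> * \<nu>) = \<mu> * \<nu>\<close>.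
\<close>

theorem conv_idempotent:
  assumes comm: "\<And>x y. x \<in> \<Omega> \<Longrightarrow> y \<in> \<Omega> \<Longrightarrow> x \<odot> y = y \<odot> x"
    and \<mu>: "definable_charge \<mu>" "\<And>A. A \<in> \<A> \<Longrightarrow> conv \<mu> \<mu> A = \<mu> A"
    and \<nu>: "definable_charge \<nu>" "\<And>A. A \<in> \<A> \<Longrightarrow> conv \<nu> \<nu> A = \<nu> A" "finsat_in \<nu> S"
    and nip: "\<And>A. A \<in> \<A> \<Longrightarrow> \<exists>n. \<not> shattered_by \<Omega> (\<lambda>x d. x \<odot> d \<in> A) n"
    and compact: "\<And>A \<G>. A \<in> \<A> \<Longrightarrow> finite \<G> \<Longrightarrow> \<G> \<subseteq> \<A> \<Longrightarrow>
      compact_family \<Omega> ((\<lambda>d. {x\<in>\<Omega>. x \<odot> d \<in> A}) ` S \<union> \<G>)"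
    and "A \<in> \<A>"
  shows "conv (conv \<mu> \<nu>) (conv \<mu> \<nu>) A = conv \<mu> \<nu> A"
proof -
  have ch: "charge \<Omega> \<A> \<mu>" "charge \<Omega> \<A> \<nu>" using \<mu>(1) \<nu>(1) by (auto simp: definable_charge_def)
  note def = definable_charge_conv
  have swap: "conv \<nu> \<mu> A = conv \<mu> \<nu> A" if "A \<in> \<A>" for A
  proof -
    obtain n where n: "\<not> shattered_by \<Omega> (\<lambda>x d. x \<odot> d \<in> A) n" using nip[OF \<open>A \<in> \<A>\<close>] by blast
    have comm': "{d\<in>\<Omega>. x \<odot> d \<in> A} = {d\<in>\<Omega>. d \<odot> x \<in> A}" if "x \<in> \<Omega>" for x
      using comm that by auto
    interpret \<mu>: charge \<Omega> \<A> \<mu> by (rule ch)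
    have "conv \<nu> \<mu> A = fint \<Omega> \<A> \<mu> (\<lambda>x. \<nu> {d\<in>\<Omega>. x \<odot> d \<in> A})"
      unfolding conv_def by (rule \<mu>.fint_cong) (simp add: comm')
    also have "\<dots> = fint \<Omega> \<A> \<nu> (\<lambda>d. \<mu> {x\<in>\<Omega>. x \<odot> d \<in> A})"
    proof (rule fint_swap[OF \<mu>(1) ch(2) that _ _ \<nu>(3) n compact[OF that]])
      show "{d\<in>\<Omega>. x \<odot> d \<in> A} \<in> \<A>" if "x \<in> \<Omega>" for x
        using translate_sets[OF \<open>A \<in> \<A>\<close> that] comm'[OF that] by simp
      have "tmeas \<Omega> \<A> (\<lambda>x. \<nu> {d\<in>\<Omega>. d \<odot> x \<in> A})" using \<nu>(1) that by (simp add: definable_charge_def)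
      then show "tmeas \<Omega> \<A> (\<lambda>x. \<nu> {d\<in>\<Omega>. x \<odot> d \<in> A})"
        by (subst tmeas_cong[of _ _ "\<lambda>x. \<nu> {d\<in>\<Omega>. d \<odot> x \<in> A}"]) (simp_all add: comm')
    qed
    also have "\<dots> = conv \<mu> \<nu> A" by (simp add: conv_def)
    finally show ?thesis .
  qed
  have \<mu>\<nu>: "definable_charge (conv \<mu> \<nu>)" "charge \<Omega> \<A> (conv \<mu> \<nu>)"
    and \<nu>\<mu>: "definable_charge (conv \<nu> \<mu>)"
    using def \<mu>(1) \<nu>(1) by (auto simp: definable_charge_def)
  have inner: "conv \<nu> (conv \<mu> \<nu>) B = conv \<mu> \<nu> B" if "B \<in> \<A>" for B
  proof -
    have "conv \<nu> (conv \<mu> \<nu>) B = conv (conv \<nu> \<mu>) \<nu> B"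
      by (rule conv_assoc[OF \<nu>(1) \<mu>(1) ch(2) that, symmetric])
    also have "\<dots> = conv (conv \<mu> \<nu>) \<nu> B"
      by (rule conv_cong[OF ch(2) ch(2) \<nu>\<mu> swap _ that]) auto
    also have "\<dots> = conv \<mu> (conv \<nu> \<nu>) B"
      by (rule conv_assoc[OF \<mu>(1) \<nu>(1) ch(2) that])
    also have "\<dots> = conv \<mu> \<nu> B"
      by (rule conv_cong[OF charge_conv[OF \<nu>(1) ch(2)] ch(2) \<mu>(1) _ \<nu>(2) that]) auto
    finally show ?thesis .
  qed
  have "conv (conv \<mu> \<nu>) (conv \<mu> \<nu>) A = conv \<mu> (conv \<nu> (conv \<mu> \<nu>)) A"
    by (rule conv_assoc[OF \<mu>(1) \<nu>(1) \<mu>\<nu>(2) assms(9)])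
  also have "\<dots> = conv \<mu> (conv \<mu> \<nu>) A"
    by (rule conv_cong[OF charge_conv[OF \<nu>(1) \<mu>\<nu>(2)] \<mu>\<nu>(2) \<mu>(1) _ inner assms(9)]) auto
  also have "\<dots> = conv (conv \<mu> \<mu>) \<nu> A"
    by (rule conv_assoc[OF \<mu>(1) \<mu>(1) ch(2) assms(9), symmetric])
  also have "\<dots> = conv \<mu> \<nu> A"
    by (rule conv_cong[OF ch(2) ch(2) def[OF \<mu>(1) \<mu>(1)] \<mu>(2) _ assms(9)]) auto
  finally show ?thesis .
qed

end

section \<open>Borel measures on Stone spaces\<close>

lemma borel_of_top_simps:
  "space (borel_of_top X) = topspace X" "openin X U \<Longrightarrow> U \<in> sets (borel_of_top X)"
  "closedin X K \<Longrightarrow> K \<in> sets (borel_of_top X)"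
proof -
  have sub: "{U. openin X U} \<subseteq> Pow (topspace X)" using openin_subset by auto
  show sp: "space (borel_of_top X) = topspace X"
    unfolding borel_of_top_def by (rule space_measure_of[OF sub])
  show op: "U \<in> sets (borel_of_top X)" if "openin X U" for U
    using that by (simp add: borel_of_top_def sets_measure_of[OF sub] sigma_sets.Basic)
  assume "closedin X K"
  then have K: "K = topspace X - (topspace X - K)" "openin X (topspace X - K)"
    by (auto simp: closedin_def)
  show "K \<in> sets (borel_of_top X)"
    by (subst K(1), subst sp[symmetric]) (use op[OF K(2)] in auto)
qed

lemma measurable_borel_of_topI:
  assumes "f \<in> space M \<rightarrow> topspace X" "\<And>U. openin X U \<Longrightarrow> f -` U \<inter> space M \<in> sets M"
  shows "f \<in> measurable M (borel_of_top X)"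
  unfolding borel_of_top_def by (rule measurable_measure_of) (use assms openin_subset[of X] in auto)

lemma continuous_map_measurable:
  "continuous_map X Y f \<Longrightarrow> f \<in> measurable (borel_of_top X) (borel_of_top Y)"
proof (rule measurable_borel_of_topI)
  assume f: "continuous_map X Y f"
  then show "f \<in> space (borel_of_top X) \<rightarrow> topspace Y"
    by (auto simp: borel_of_top_simps continuous_map_def)
  fix U assume "openin Y U"
  then have "openin X {x\<in>topspace X. f x \<in> U}" using f by (simp add: continuous_map_def)
  moreover have "f -` U \<inter> space (borel_of_top X) = {x\<in>topspace X. f x \<in> U}"
    by (auto simp: borel_of_top_simps)
  ultimately show "f -` U \<inter> space (borel_of_top X) \<in> sets (borel_of_top X)"
    by (simp add: borel_of_top_simps(2))
qed

lemma continuous_map_borel_measurable: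
  assumes "continuous_map X euclideanreal f"
  shows "f \<in> borel_measurable (borel_of_top X)"
proof -
  have "borel = borel_of_top euclideanreal" by (simp add: borel_def borel_of_top_def)
  then show ?thesis using continuous_map_measurable[OF assms] by simp
qed

lemma regular_borel_probD:
  assumes "regular_borel_prob X m"
  shows "space m = topspace X" "sets m = sets (borel_of_top X)" "prob_space m"
    "B \<in> sets m \<Longrightarrow> emeasure m B = (SUP K\<in>{K. compactin X K \<and> K \<in> sets m \<and> K \<subseteq> B}. emeasure m K)"
    "B \<in> sets m \<Longrightarrow> emeasure m B = (INF U\<in>{U. openin X U \<and> B \<subseteq> U}. emeasure m U)"
  using assms unfolding regular_borel_prob_def by blast+

lemma regular_borel_prob_inner:
  assumes "regular_borel_prob X m" "B \<in> sets m" "e > 0"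
  shows "\<exists>K. compactin X K \<and> K \<in> sets m \<and> K \<subseteq> B \<and> measure m B \<le> measure m K + e"
proof (cases "measure m B \<le> e")
  case True
  then show ?thesis using assms by (intro exI[of _ "{}"]) auto
next
  case False
  interpret prob_space m by (rule regular_borel_probD(3)[OF assms(1)])
  have "emeasure m B = (SUP K\<in>{K. compactin X K \<and> K \<in> sets m \<and> K \<subseteq> B}. emeasure m K)"
    by (rule regular_borel_probD(4)[OF assms(1,2)])
  moreover have "ennreal (measure m B - e) < emeasure m B"
    using False assms(3) by (simp add: emeasure_eq_measure ennreal_less_iff)
  ultimately obtain K where K: "compactin X K" "K \<in> sets m" "K \<subseteq> B" "ennreal (measure m B - e) < emeasure m K"
    by (auto simp: less_SUP_iff)
  then have "measure m B - e < measure m K"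
    using False by (simp add: emeasure_eq_measure ennreal_less_iff)
  then show ?thesis using K by (intro exI[of _ K]) auto
qed

text \<open>
  Approximation from inside by closed sets suffices: they are compact, and complements turn it into
  approximation from outside by open sets.
\<close>

lemma regular_borel_probI:
  assumes sp: "space m = topspace X" and sets: "sets m = sets (borel_of_top X)" and "prob_space m"
    and "compact_space X"
    and inner: "\<And>B e. B \<in> sets m \<Longrightarrow> e > 0 \<Longrightarrow> \<exists>K. closedin X K \<and> K \<subseteq> B \<and> measure m B \<le> measure m K + e"
  shows "regular_borel_prob X m"
  unfolding regular_borel_prob_def
proof (intro conjI ballI)
  interpret prob_space m by fact
  have cl: "K \<in> sets m" "compactin X K" if "closedin X K" for K
    using that borel_of_top_simps(3) sets \<open>compact_space X\<close> by (auto simp: closedin_compact_space)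
  fix B assume B: "B \<in> sets m"
  show "emeasure m B = (SUP K\<in>{K. compactin X K \<and> K \<in> sets m \<and> K \<subseteq> B}. emeasure m K)"
  proof (rule antisym)
    show "emeasure m B \<le> (SUP K\<in>{K. compactin X K \<and> K \<in> sets m \<and> K \<subseteq> B}. emeasure m K)"
    proof (rule ennreal_le_epsilon)
      fix e :: real assume "e > 0"
      then obtain K where K: "closedin X K" "K \<subseteq> B" "measure m B \<le> measure m K + e"
        using inner[OF B] by blast
      then have "emeasure m B \<le> emeasure m K + e"
        using \<open>e > 0\<close> by (simp add: emeasure_eq_measure flip: ennreal_plus)
      also have "\<dots> \<le> (SUP K\<in>{K. compactin X K \<and> K \<in> sets m \<and> K \<subseteq> B}. emeasure m K) + e"
        using cl[OF K(1)] K(2) by (intro add_right_mono SUP_upper) auto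
      finally show "emeasure m B \<le> (SUP K\<in>{K. compactin X K \<and> K \<in> sets m \<and> K \<subseteq> B}. emeasure m K) + e" .
    qed
  qed (use B in \<open>auto intro!: SUP_least emeasure_mono\<close>)
  show "emeasure m B = (INF U\<in>{U. openin X U \<and> B \<subseteq> U}. emeasure m U)"
  proof (rule antisym)
    have "U \<in> sets m" if "openin X U" for U using that borel_of_top_simps(2) sets by auto
    then show "emeasure m B \<le> (INF U\<in>{U. openin X U \<and> B \<subseteq> U}. emeasure m U)"
      by (auto intro!: INF_greatest emeasure_mono)
    show "(INF U\<in>{U. openin X U \<and> B \<subseteq> U}. emeasure m U) \<le> emeasure m B"
    proof (rule ennreal_le_epsilon)
      fix e :: real assume "e > 0"
      have "space m - B \<in> sets m" using B by auto
      from inner[OF this \<open>e > 0\<close>] obtain K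
        where K: "closedin X K" "K \<subseteq> space m - B" "measure m (space m - B) \<le> measure m K + e" by blast
      have U: "openin X (space m - K)" "B \<subseteq> space m - K"
        using K(1,2) sets.sets_into_space[OF B] sp by (auto simp: closedin_def)
      have "measure m (space m - K) \<le> measure m B + e"
        using K(3) B cl(1)[OF K(1)] by (simp add: prob_compl)
      then have "emeasure m (space m - K) \<le> emeasure m B + e"
        using \<open>e > 0\<close> by (simp add: emeasure_eq_measure flip: ennreal_plus)
      moreover have "(INF U\<in>{U. openin X U \<and> B \<subseteq> U}. emeasure m U) \<le> emeasure m (space m - K)"
        using U by (intro INF_lower) auto
      ultimately show "(INF U\<in>{U. openin X U \<and> B \<subseteq> U}. emeasure m U) \<le> emeasure m B + e" by simp
    qed
  qed
qed (use assms in auto)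

text \<open>
  The image of a compact set is compact, hence closed, so inner approximations can be pushed forward.
\<close>

lemma regular_borel_prob_distr:
  assumes m: "regular_borel_prob X m" and f: "continuous_map X Y f"
    and "compact_space Y" "Hausdorff_space Y"
  shows "regular_borel_prob Y (distr m (borel_of_top Y) f)"
proof (rule regular_borel_probI)
  interpret  prob_space m by (rule regular_borel_probD(3)[OF m])
  have sets: "sets m = sets (borel_of_top X)" by (rule regular_borel_probD(2)[OF m])
  have f': "f \<in> measurable m (borel_of_top Y)"
    using continuous_map_measurable[OF f] measurable_cong_sets[OF sets refl] by blast
  then show "prob_space (distr m (borel_of_top Y) f)" by (rule prob_space_distr)
  fix B and e :: real assume B: "B \<in> sets (distr m (borel_of_top Y) f)" "e > 0"
  then have "f -` B \<inter> space m \<in> sets m" using f' by auto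
  from regular_borel_prob_inner[OF m this B(2)] obtain K where K: "compactin X K" "K \<in> sets m"
    "K \<subseteq> f -` B \<inter> space m" "measure m (f -` B \<inter> space m) \<le> measure m K + e" by blast
  have "compactin Y (f ` K)" by (rule image_compactin[OF K(1) f])
  then have cl: "closedin Y (f ` K)" by (rule compactin_imp_closedin[OF assms(4)])
  have "f -` (f ` K) \<inter> space m \<in> sets m" using f' borel_of_top_simps(3)[OF cl] by auto
  then have "measure m K \<le> measure m (f -` (f ` K) \<inter> space m)"
    using sets.sets_into_space[OF K(2)] by (intro finite_measure_mono) auto
  then have "measure (distr m (borel_of_top Y) f) B \<le> measure (distr m (borel_of_top Y) f) (f ` K) + e"
    using K(4) B(1) borel_of_top_simps(3)[OF cl] by (simp add: measure_distr[OF f'])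
  then show "\<exists>K. closedin Y K \<and> K \<subseteq> B \<and>
      measure (distr m (borel_of_top Y) f) B \<le> measure (distr m (borel_of_top Y) f) K + e"
    using cl K(3) by (intro exI[of _ "f ` K"]) auto
qed (use assms in \<open>auto simp: borel_of_top_simps\<close>)

text \<open>
  Stone spaces, given with an algebra of clopen sets that is a base of the topology.
\<close>

locale clopen_base =
  fixes X :: "'p topology" and \<C> :: "'p set set"
  assumes algebra: "algebra (topspace X) \<C>"
    and open_base: "\<And>C. C \<in> \<C> \<Longrightarrow> openin X C"
    and base: "\<And>U x. openin X U \<Longrightarrow> x \<in> U \<Longrightarrow> \<exists>C\<in>\<C>. x \<in> C \<and> C \<subseteq> U"
    and compact: "compact_space X"
begin

sublocale algebra "topspace X" \<C> by (rule algebra)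

lemma closed_base: "C \<in> \<C> \<Longrightarrow> closedin X C"
  using open_base[OF compl_sets] sets_into_space by (auto simp: closedin_def)

lemma compactin_between:
  assumes "compactin X K" "openin X U" "K \<subseteq> U"
  shows "\<exists>C\<in>\<C>. K \<subseteq> C \<and> C \<subseteq> U"
proof -
  have "\<exists>\<F>. finite \<F> \<and> \<F> \<subseteq> {C\<in>\<C>. C \<subseteq> U} \<and> K \<subseteq> \<Union>\<F>"
  proof (rule compactinD[OF assms(1)])
    show "K \<subseteq> \<Union>{C\<in>\<C>. C \<subseteq> U}" using base[OF assms(2)] assms(3) by fast
  qed (use open_base in blast)
  then obtain \<F> where \<F>: "finite \<F>" "\<F> \<subseteq> {C\<in>\<C>. C \<subseteq> U}" "K \<subseteq> \<Union>\<F>" by blast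
  then have "\<Union>\<F> \<in> \<C>" by (intro finite_Union) auto
  then show ?thesis using \<F> by (intro bexI[of _ "\<Union>\<F>"]) auto
qed

text \<open>
  A compact set inside an open set \<open>U\<close> fits a clopen set in between. So on open sets both measures are
  determined by their values on clopen sets, and by outer regularity they are determined everywhere.
\<close>

lemma regular_borel_prob_unique:
  assumes m: "regular_borel_prob X m" and n: "regular_borel_prob X n"
    and eq: "\<And>C. C \<in> \<C> \<Longrightarrow> measure m C = measure n C"
  shows "m = n"
proof -
  have sets: "sets m = sets (borel_of_top X)" "sets n = sets (borel_of_top X)"
    by (rule regular_borel_probD(2)[OF m], rule regular_borel_probD(2)[OF n])
  interpret m: prob_space m by (rule regular_borel_probD(3)[OF m])
  interpret n: prob_space n by (rule regular_borel_probD(3)[OF n])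
  have le: "emeasure m1 U \<le> emeasure n1 U"
    if m1: "regular_borel_prob X m1" and n1: "regular_borel_prob X n1"
      and eq: "\<And>C. C \<in> \<C> \<Longrightarrow> emeasure m1 C = emeasure n1 C" and U: "openin X U" for m1 n1 U
  proof -
    have s: "sets m1 = sets (borel_of_top X)" "sets n1 = sets (borel_of_top X)"
      by (rule regular_borel_probD(2)[OF m1], rule regular_borel_probD(2)[OF n1])
    have "emeasure m1 U = (SUP K\<in>{K. compactin X K \<and> K \<in> sets m1 \<and> K \<subseteq> U}. emeasure m1 K)"
      by (rule regular_borel_probD(4)[OF m1]) (simp add: s borel_of_top_simps(2)[OF U])
    also have "\<dots> \<le> emeasure n1 U"
    proof (rule SUP_least)
      fix K assume "K \<in> {K. compactin X K \<and> K \<in> sets m1 \<and> K \<subseteq> U}"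
      then obtain C where C: "C \<in> \<C>" "K \<subseteq> C" "C \<subseteq> U" using compactin_between[OF _ U] by blast
      have "emeasure m1 K \<le> emeasure m1 C"
        using C s borel_of_top_simps(2)[OF open_base] by (intro emeasure_mono) auto
      also have "\<dots> = emeasure n1 C" by (rule eq[OF C(1)])
      also have "\<dots> \<le> emeasure n1 U"
        using C s borel_of_top_simps(2)[OF U] by (intro emeasure_mono) auto
      finally show "emeasure m1 K \<le> emeasure n1 U" .
    qed
    finally show ?thesis .
  qed
  have eq': "emeasure m C = emeasure n C" if "C \<in> \<C>" for C
    using eq[OF that] by (simp add: m.emeasure_eq_measure n.emeasure_eq_measure)
  have opn: "emeasure m U = emeasure n U" if "openin X U" for U
    using le[OF m n eq' that] le[OF n m eq'[symmetric] that] by (rule antisym)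
  show ?thesis
  proof (rule measure_eqI)
    show "sets m = sets n" using sets by simp
    fix B assume B: "B \<in> sets m"
    then have "emeasure m B = (INF U\<in>{U. openin X U \<and> B \<subseteq> U}. emeasure m U)"
      by (rule regular_borel_probD(5)[OF m])
    also have "\<dots> = (INF U\<in>{U. openin X U \<and> B \<subseteq> U}. emeasure n U)"
      by (rule INF_cong) (auto simp: opn)
    also have "\<dots> = emeasure n B"
      by (rule regular_borel_probD(5)[OF n, symmetric]) (use B sets in simp)
    finally show "emeasure m B = emeasure n B" .
  qed
qed

text \<open>
  The null clopen sets may be uncountably many, but a compact subset of their union is covered by finitely
  many of them. The union is the complement of the support.
\<close>

lemma measure_null_clopens:
  assumes m: "regular_borel_prob X m"
  shows "measure m (\<Union>{C\<in>\<C>. measure m C = 0}) = 0"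
proof -
  interpret m: prob_space m by (rule regular_borel_probD(3)[OF m])
  have sets: "sets m = sets (borel_of_top X)" by (rule regular_borel_probD(2)[OF m])
  let ?U = "\<Union>{C\<in>\<C>. measure m C = 0}"
  have U: "openin X ?U" using open_base by auto
  have "measure m ?U \<le> 0"
  proof (rule field_le_epsilon)
    fix e :: real assume "e > 0"
    have "?U \<in> sets m" using borel_of_top_simps(2)[OF U] sets by simp
    from regular_borel_prob_inner[OF m this \<open>e > 0\<close>] obtain K
      where K: "compactin X K" "K \<subseteq> ?U" "measure m ?U \<le> measure m K + e" by blast
    have "\<exists>\<F>. finite \<F> \<and> \<F> \<subseteq> {C\<in>\<C>. measure m C = 0} \<and> K \<subseteq> \<Union>\<F>"
      by (rule compactinD[OF K(1) _ K(2)]) (use open_base in blast)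
    then obtain \<F> where \<F>: "finite \<F>" "\<F> \<subseteq> {C\<in>\<C>. measure m C = 0}" "K \<subseteq> \<Union>\<F>" by blast
    have "C \<in> sets m" if "C \<in> \<F>" for C
      using that \<F>(2) borel_of_top_simps(2)[OF open_base] sets by auto
    then have "measure m K \<le> measure m (\<Union>C\<in>\<F>. C)" "measure m (\<Union>C\<in>\<F>. C) \<le> (\<Sum>C\<in>\<F>. measure m C)"
      using \<F> by (auto intro!: m.finite_measure_mono m.finite_measure_subadditive_finite[of \<F> "\<lambda>C. C", simplified])
    moreover have "(\<Sum>C\<in>\<F>. measure m C) = 0" using \<F>(2) by (intro sum.neutral) auto
    ultimately show "measure m ?U \<le> 0 + e" using K(3) by simp
  qed
  then show ?thesis by (simp add: measure_le_0_iff)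
qed

end

text \<open>
  The regular Borel extension of a charge on the clopen sets is obtained from Caratheodory's theorem. Its
  outer measure approximates by open sets from outside, and open sets by clopen sets from inside.
\<close>

locale clopen_charge = clopen_base X \<C> + charge "topspace X" \<C> m
  for X :: "'p topology" and \<C> m
begin

definition inner :: "'p set \<Rightarrow> ennreal" where
  "inner U = (SUP C\<in>{C\<in>\<C>. C \<subseteq> U}. ennreal (m C))"

definition outer :: "'p set \<Rightarrow> ennreal" where
  "outer A = (INF U\<in>{U. openin X U \<and> A \<subseteq> U}. inner U)"

lemma inner_mono: "U \<subseteq> V \<Longrightarrow> inner U \<le> inner V"
  unfolding inner_def by (rule SUP_subset_mono) auto

lemma le_inner: "C \<in> \<C> \<Longrightarrow> C \<subseteq> U \<Longrightarrow> ennreal (m C) \<le> inner U"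
  unfolding inner_def by (rule SUP_upper) simp

lemma inner_clopen: "C \<in> \<C> \<Longrightarrow> inner C = ennreal (m C)"
  by (rule antisym) (auto simp: inner_def intro!: SUP_least SUP_upper ennreal_leI mono)

lemma inner_le_one: "inner U \<le> 1"
  unfolding inner_def using le_one by (auto intro!: SUP_least simp: ennreal_le_1)

lemma outer_le_inner: "openin X U \<Longrightarrow> A \<subseteq> U \<Longrightarrow> outer A \<le> inner U"
  unfolding outer_def by (rule INF_lower) simp

lemma outer_open: "openin X U \<Longrightarrow> outer U = inner U"
  by (rule antisym[OF outer_le_inner]) (auto simp: outer_def intro!: INF_greatest inner_mono)

lemma outer_mono: "A \<subseteq> B \<Longrightarrow> outer A \<le> outer B"
  unfolding outer_def by (rule INF_superset_mono) auto

lemma outer_empty: "outer {} = 0"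
  using outer_open[of "{}"] inner_clopen[OF empty_sets] empty_zero by simp

text \<open>
  Inside a clopen \<open>C \<subseteq> U \<union> V\<close> there is a clopen \<open>D\<close> between the compact set \<open>C - V\<close> and \<open>U\<close>; the rest of
  \<open>C\<close> lies in \<open>V\<close>.
\<close>

lemma inner_Un:
  assumes "openin X U" "openin X V"
  shows "inner (U \<union> V) \<le> inner U + inner V"
  unfolding inner_def[of "U \<union> V"]
proof (rule SUP_least)
  fix C assume "C \<in> {C\<in>\<C>. C \<subseteq> U \<union> V}"
  then have C: "C \<in> \<C>" "C \<subseteq> U \<union> V" by auto
  have "closedin X (C - V)" using closed_base[OF C(1)] assms(2) by (rule closedin_diff)
  then have "compactin X (C - V)" using compact by (simp add: closedin_compact_space)
  then obtain D where D: "D \<in> \<C>" "C - V \<subseteq> D" "D \<subseteq> U"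
    using compactin_between[OF _ assms(1)] C(2) by blast
  have "m C = m (C \<inter> D) + m (C - D)"
    using C D additive[of "C \<inter> D" "C - D"] by (auto simp: Int_Diff_Un)
  also have "ennreal \<dots> = ennreal (m (C \<inter> D)) + ennreal (m (C - D))"
    by (rule ennreal_plus) (rule nonneg[OF Int[OF C(1) D(1)]], rule nonneg[OF Diff[OF C(1) D(1)]])
  also have "\<dots> \<le> inner U + inner V"
    using C D by (intro add_mono le_inner) auto
  finally show "ennreal (m C) \<le> inner U + inner V" .
qed

text \<open>
  A clopen subset of the union is compact, so it lies in a finite partial union.
\<close>

lemma inner_UN:
  assumes "\<And>i::nat. openin X (U i)"
  shows "inner (\<Union>i. U i) \<le> (\<Sum>i. inner (U i))"
  unfolding inner_def[of "\<Union>i. U i"]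
proof (rule SUP_least)
  fix C assume "C \<in> {C\<in>\<C>. C \<subseteq> (\<Union>i. U i)}"
  then have C: "C \<in> \<C>" "C \<subseteq> (\<Union>i. U i)" by auto
  have fin: "inner (\<Union>i<n. U i) \<le> (\<Sum>i<n. inner (U i))" for n
  proof (induction n)
    case (Suc n)
    have "inner (\<Union>i<Suc n. U i) = inner ((\<Union>i<n. U i) \<union> U n)"
      by (rule arg_cong[of _ _ inner]) (auto simp: lessThan_Suc)
    also have "\<dots> \<le> inner (\<Union>i<n. U i) + inner (U n)"
      using assms by (intro inner_Un openin_Union) auto
    also have "\<dots> \<le> (\<Sum>i<n. inner (U i)) + inner (U n)" by (rule add_right_mono) (rule Suc)
    finally show ?case by simp
  qed (use inner_clopen[OF empty_sets] empty_zero in simp)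
  have "compactin X C" using closed_base[OF C(1)] compact by (simp add: closedin_compact_space)
  then have "\<exists>\<F>. finite \<F> \<and> \<F> \<subseteq> range U \<and> C \<subseteq> \<Union>\<F>"
    by (rule compactinD[OF _ _ C(2)]) (use assms in auto)
  then obtain \<F> where "finite \<F>" "\<F> \<subseteq> range U" "C \<subseteq> \<Union>\<F>" by blast
  then obtain I where I: "finite I" "C \<subseteq> (\<Union>i\<in>I. U i)"
    by (metis finite_subset_image)
  obtain n where "\<And>i. i \<in> I \<Longrightarrow> i < n" using I(1) by (metis finite_nat_set_iff_bounded)
  then have "C \<subseteq> (\<Union>i<n. U i)" using I(2) by blast
  then have "ennreal (m C) \<le> inner (\<Union>i<n. U i)" by (rule le_inner[OF C(1)])
  also have "\<dots> \<le> (\<Sum>i<n. inner (U i))" by (rule fin)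
  also have "\<dots> \<le> (\<Sum>i. inner (U i))" by (rule sum_le_suminf) auto
  finally show "ennreal (m C) \<le> (\<Sum>i. inner (U i))" .
qed

lemma outer_subadditive: "outer (\<Union>i::nat. A i) \<le> (\<Sum>i. outer (A i))"
proof (rule ennreal_le_epsilon)
  fix e :: real assume e: "e > 0"
  have near: "\<exists>U. openin X U \<and> A i \<subseteq> U \<and> inner U \<le> outer (A i) + ennreal (e * (1/2) ^ Suc i)"
    if "A i \<subseteq> topspace X" for i
  proof -
    have "outer (A i) \<le> inner (topspace X)" using that by (intro outer_le_inner) auto
    then have "outer (A i) < \<infinity>" using inner_le_one[of "topspace X"]
      by (metis ennreal_one_less_top infinity_ennreal_def le_less_trans)
    then have "outer (A i) < outer (A i) + ennreal (e * (1/2) ^ Suc i)"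
    proof (cases "outer (A i)")
      case (real x)
      define y where "y = e * (1/2) ^ Suc i"
      have "y > 0" using e by (simp add: y_def)
      then show ?thesis
        using real unfolding y_def[symmetric] by (simp add: ennreal_less_iff flip: ennreal_plus)
    qed (use \<open>outer (A i) < \<infinity>\<close> in simp)
    then show ?thesis unfolding outer_def[of "A i"] INF_less_iff using less_imp_le by blast
  qed
  show "outer (\<Union>i. A i) \<le> (\<Sum>i. outer (A i)) + ennreal e"
  proof (cases "\<forall>i. A i \<subseteq> topspace X")
    case True
    have "\<forall>i. \<exists>U. openin X U \<and> A i \<subseteq> U \<and> inner U \<le> outer (A i) + ennreal (e * (1/2) ^ Suc i)"
      by (rule allI, rule near) (use True in simp)
    then obtain U where U: "\<forall>i. openin X (U i) \<and> A i \<subseteq> U i \<and>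
        inner (U i) \<le> outer (A i) + ennreal (e * (1/2) ^ Suc i)"
      by (rule choice[THEN exE])
    have "outer (\<Union>i. A i) \<le> inner (\<Union>i. U i)" using U by (intro outer_le_inner) auto
    also have "\<dots> \<le> (\<Sum>i. inner (U i))" using U by (intro inner_UN) auto
    also have "\<dots> \<le> (\<Sum>i. outer (A i) + ennreal (e * (1/2) ^ Suc i))" using U by (intro suminf_le) auto
    also have "\<dots> = (\<Sum>i. outer (A i)) + (\<Sum>i. ennreal e * ennreal ((1/2) ^ Suc i))"
    proof -
      have eq: "ennreal (e * (1/2) ^ Suc i) = ennreal e * ennreal ((1/2) ^ Suc i)" for i
        by (rule ennreal_mult) (use e in auto)
      show ?thesis unfolding eq by (rule suminf_add[symmetric]) (rule summableI)+
    qed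
    also have "(\<Sum>i. ennreal e * ennreal ((1/2) ^ Suc i)) = ennreal e"
    proof -
      have "(\<Sum>i. ennreal ((1/2) ^ Suc i)) = ennreal 1"
        by (rule suminf_ennreal_eq[OF _ power_half_series]) simp
      then show ?thesis by (simp only: ennreal_suminf_cmult) simp
    qed
    finally show ?thesis .
  next
    case False
    then obtain i where "\<not> A i \<subseteq> topspace X" by blast
    then have "outer (A i) = \<infinity>"
    proof -
      have none: "{U. openin X U \<and> A i \<subseteq> U} = {}"
        using openin_subset[of X] \<open>\<not> A i \<subseteq> topspace X\<close> by blast
      show ?thesis unfolding outer_def none by simp
    qed
    then have "\<infinity> \<le> (\<Sum>i. outer (A i))" 
      using sum_le_suminf[of "\<lambda>i. outer (A i)" "{i}"] by simp
    then show ?thesis by (simp add: top_unique)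
  qed
qed

text \<open>
  Open sets are Caratheodory measurable: fill \<open>U \<inter> V\<close> with a clopen \<open>C\<close> and then the open set \<open>V - C\<close>,
  which contains \<open>V - U\<close>, with another clopen set.
\<close>

lemma outer_split:
  assumes U: "openin X U" and "A \<subseteq> topspace X"
  shows "outer (U \<inter> A) + outer (A - U) \<le> outer A"
  unfolding outer_def[of A]
proof (rule INF_greatest)
  fix V assume "V \<in> {V. openin X V \<and> A \<subseteq> V}"
  then have V: "openin X V" "A \<subseteq> V" by auto
  have "outer (U \<inter> A) + outer (A - U) \<le> inner (U \<inter> V) + outer (V - U)"
    using U V by (intro add_mono outer_le_inner outer_mono) auto
  also have "\<dots> = (SUP C\<in>{C\<in>\<C>. C \<subseteq> U \<inter> V}. ennreal (m C) + outer (V - U))"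
    unfolding inner_def by (rule ennreal_SUP_add_left[symmetric]) auto
  also have "\<dots> \<le> inner V"
  proof (rule SUP_least)
    fix C assume "C \<in> {C\<in>\<C>. C \<subseteq> U \<inter> V}"
    then have C: "C \<in> \<C>" "C \<subseteq> U \<inter> V" by auto
    have "outer (V - U) \<le> inner (V - C)"
      using C V closed_base[OF C(1)] by (intro outer_le_inner openin_diff) auto
    then have "ennreal (m C) + outer (V - U) \<le> ennreal (m C) + inner (V - C)" by (rule add_left_mono)
    also have "\<dots> = (SUP D\<in>{D\<in>\<C>. D \<subseteq> V - C}. ennreal (m C) + ennreal (m D))"
      unfolding inner_def by (rule ennreal_SUP_add_right) auto
    also have "\<dots> \<le> inner V"
    proof (rule SUP_least)
      fix D assume "D \<in> {D\<in>\<C>. D \<subseteq> V - C}"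
      then have D: "D \<in> \<C>" "D \<subseteq> V - C" by auto
      have "ennreal (m C) + ennreal (m D) = ennreal (m (C \<union> D))"
        using C(2) D nonneg[OF C(1)] nonneg[OF D(1)] by (subst additive[OF C(1) D(1)]) auto
      also have "\<dots> \<le> inner V" using C D by (intro le_inner) auto
      finally show "ennreal (m C) + ennreal (m D) \<le> inner V" .
    qed
    finally show "ennreal (m C) + outer (V - U) \<le> inner V" .
  qed
  finally show "outer (U \<inter> A) + outer (A - U) \<le> inner V" .
qed

lemma ex_regular_borel_prob:
  "\<exists>n. regular_borel_prob X n \<and> (\<forall>C\<in>\<C>. measure n C = m C)"
proof -
  let ?P = "Pow (topspace X)"
  interpret P: sigma_algebra "topspace X" ?P by (rule sigma_algebra_Pow)
  have pos: "positive ?P outer" by (simp add: positive_def outer_empty)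
  have csub: "countably_subadditive ?P outer"
    by (simp add: countably_subadditive_def outer_subadditive)
  have "outer_measure_space ?P outer"
    unfolding outer_measure_space_def using pos csub by (auto simp: increasing_def outer_mono)
  from P.caratheodory_lemma[OF this]
  have ms: "measure_space (topspace X) (lambda_system (topspace X) ?P outer) outer" .
  have sub: "subadditive ?P outer" by (rule P.countably_subadditive_subadditive[OF pos csub])
  have opn: "U \<in> lambda_system (topspace X) ?P outer" if U: "openin X U" for U
    unfolding lambda_system_def
  proof (intro CollectI conjI ballI)
    show "U \<in> ?P" using openin_subset[OF U] by simp
    fix A assume A: "A \<in> ?P"
    have eq: "(topspace X - U) \<inter> A = A - U" using A by auto
    have "outer A = outer ((U \<inter> A) \<union> (A - U))" by (rule arg_cong[of _ _ outer]) auto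
    also have "\<dots> \<le> outer (U \<inter> A) + outer (A - U)"
      using A by (intro subadditiveD[OF sub]) auto
    finally show "outer (U \<inter> A) + outer ((topspace X - U) \<inter> A) = outer A"
      using outer_split[OF U, of A] A unfolding eq by (intro antisym) auto
  qed
  let ?B = "sets (borel_of_top X)"
  have sets_B: "?B = sigma_sets (topspace X) {U. openin X U}"
    unfolding borel_of_top_def using openin_subset by (intro sets_measure_of) auto
  have sB: "sigma_algebra (topspace X) ?B"
    using sets.sigma_algebra_axioms[of "borel_of_top X"] by (simp add: borel_of_top_simps)
  have "?B \<subseteq> lambda_system (topspace X) ?P outer"
    unfolding sets_B using ms opn
    by (intro sigma_algebra.sigma_sets_subset) (auto simp: measure_space_def)
  from measure_down[OF ms sB this] have ms': "measure_space (topspace X) ?B outer" .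
  define n where "n = measure_of (topspace X) ?B outer"
  have B_Pow: "?B \<subseteq> ?P" using sets.space_closed[of "borel_of_top X"] by (simp add: borel_of_top_simps)
  have sp: "space n = topspace X" and sets: "sets n = ?B"
    using B_Pow sigma_algebra.sets_measure_of_eq[OF sB] by (simp_all add: n_def space_measure_of)
  have em: "emeasure n A = outer A" if "A \<in> ?B" for A
    unfolding n_def using ms' that by (intro emeasure_measure_of_sigma) (auto simp: measure_space_def)
  have clop: "emeasure n C = ennreal (m C)" if "C \<in> \<C>" for C
    using em[OF borel_of_top_simps(2)[OF open_base[OF that]]] outer_open[OF open_base[OF that]]
      inner_clopen[OF that] by simp
  have "prob_space n" by (rule prob_spaceI) (simp add: sp clop[OF top] total)
  then interpret n: prob_space n .
  have "regular_borel_prob X n"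
  proof (rule regular_borel_probI[OF sp sets \<open>prob_space n\<close> compact])
    fix B and e :: real assume B: "B \<in> sets n" and e: "e > 0"
    have B': "space n - B \<in> sets n" using B by auto
    have "emeasure n (space n - B) < emeasure n (space n - B) + ennreal e"
      using e by (simp add: n.emeasure_eq_measure ennreal_less_iff flip: ennreal_plus)
    then have "outer (space n - B) < emeasure n (space n - B) + ennreal e"
      using em[of "space n - B"] B' unfolding sets by simp
    then obtain U where U: "openin X U" "space n - B \<subseteq> U" "inner U < emeasure n (space n - B) + ennreal e"
      unfolding outer_def INF_less_iff by blast
    have Us: "U \<in> sets n" using borel_of_top_simps(2)[OF U(1)] sets by simp
    have "emeasure n U = inner U" using em[of U] Us sets outer_open[OF U(1)] by simp
    then have "measure n U \<le> measure n (space n - B) + e"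
      using U(3) e unfolding \<open>emeasure n U = inner U\<close>[symmetric]
      by (simp add: n.emeasure_eq_measure ennreal_less_iff flip: ennreal_plus)
    then have "measure n B \<le> measure n (space n - U) + e"
      using B Us by (simp add: n.prob_compl)
    moreover have "closedin X (space n - U)" unfolding sp by (rule closedin_diff[OF closedin_topspace U(1)])
    moreover have "space n - U \<subseteq> B" using U(2) by auto
    ultimately show "\<exists>K. closedin X K \<and> K \<subseteq> B \<and> measure n B \<le> measure n K + e" by blast
  qed
  then show ?thesis using clop nonneg by (intro exI[of _ n]) (simp add: measure_def)
qed

end

section \<open>Substitution\<close>

lemma eval_trm_cong: "(\<And>x. x \<in> fv_trm t \<Longrightarrow> v x = w x) \<Longrightarrow> eval_trm G v e t = eval_trm G w e t"
proof (induction t)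
  case (App f ts)
  have "map (eval_trm G v e) ts = map (eval_trm G w e) ts"
    using App by (intro map_cong refl App.IH) auto
  then show ?case by (simp only: eval_trm.simps)
qed auto

lemma sat_cong: "(\<And>x. x \<in> fv \<phi> \<Longrightarrow> v x = w x) \<Longrightarrow> sat G v e \<phi> \<longleftrightarrow> sat G w e \<phi>"
proof (induction \<phi> arbitrary: e)
  case (Eql t u)
  have "eval_trm G v e t = eval_trm G w e t" "eval_trm G v e u = eval_trm G w e u"
    using Eql by (auto intro!: eval_trm_cong)
  then show ?case by simp
next
  case (Rel r ts)
  have "map (eval_trm G v e) ts = map (eval_trm G w e) ts"
    using Rel by (intro map_cong refl eval_trm_cong) auto
  then show ?case by (simp only: sat.simps)
next
  case (Conj \<phi> \<psi>)
  then have "sat G v e \<phi> \<longleftrightarrow> sat G w e \<phi>" "sat G v e \<psi> \<longleftrightarrow> sat G w e \<psi>" by auto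
  then show ?case by simp
next
  case (Exi s \<phi>)
  then have "sat G v (a # e) \<phi> \<longleftrightarrow> sat G w (a # e) \<phi>" for a by auto
  then show ?case by simp
qed auto

lemma eval_subst_trm:
  "(\<And>z. z \<in> fv_trm t \<Longrightarrow> eval_trm G v e (\<sigma> z) = w z) \<Longrightarrow>
     eval_trm G v e (subst_trm \<sigma> t) = eval_trm G w e t"
proof (induction t)
  case (App f ts)
  have "map (eval_trm G v e \<circ> subst_trm \<sigma>) ts = map (eval_trm G w e) ts"
  proof (rule map_cong[OF refl])
    fix t assume t: "t \<in> set ts"
    show "(eval_trm G v e \<circ> subst_trm \<sigma>) t = eval_trm G w e t"
      unfolding comp_def by (rule App.IH[OF t], rule App.prems) (use t in auto)
  qed
  then show ?case by (simp only: eval_trm.simps subst_trm.simps map_map)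
qed auto

lemma sat_subst:
  "(\<And>z e. z \<in> fv \<phi> \<Longrightarrow> eval_trm G v e (\<sigma> z) = w z) \<Longrightarrow> sat G v e (subst \<sigma> \<phi>) \<longleftrightarrow> sat G w e \<phi>"
proof (induction \<phi> arbitrary: e)
  case (Eql t u)
  have "eval_trm G v e (subst_trm \<sigma> t) = eval_trm G w e t" "eval_trm G v e (subst_trm \<sigma> u) = eval_trm G w e u"
    using Eql by (auto intro!: eval_subst_trm)
  then show ?case by simp
next
  case (Rel r ts)
  have "map (eval_trm G v e \<circ> subst_trm \<sigma>) ts = map (eval_trm G w e) ts"
    using Rel by (intro map_cong refl) (auto intro!: eval_subst_trm)
  then show ?case by (simp only: sat.simps subst.simps map_map)
next
  case (Conj \<phi> \<psi>)
  then have "sat G v e (subst \<sigma> \<phi>) \<longleftrightarrow> sat G w e \<phi>" "sat G v e (subst \<sigma> \<psi>) \<longleftrightarrow> sat G w e \<psi>" by auto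
  then show ?case by simp
next
  case (Exi s \<phi>)
  then have "sat G v (a # e) (subst \<sigma> \<phi>) \<longleftrightarrow> sat G w (a # e) \<phi>" for a by auto
  then show ?case by simp
qed auto

lemma subst_trm_cong: "(\<And>z. z \<in> fv_trm t \<Longrightarrow> \<sigma> z = \<tau> z) \<Longrightarrow> subst_trm \<sigma> t = subst_trm \<tau> t"
  by (induction t) auto

lemma subst_cong: "(\<And>z. z \<in> fv \<phi> \<Longrightarrow> \<sigma> z = \<tau> z) \<Longrightarrow> subst \<sigma> \<phi> = subst \<tau> \<phi>"
proof (induction \<phi>)
  case (Eql t u)
  have "subst_trm \<sigma> t = subst_trm \<tau> t" "subst_trm \<sigma> u = subst_trm \<tau> u"
    using Eql by (auto intro!: subst_trm_cong)
  then show ?case by simp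
next
  case (Rel r ts)
  have "map (subst_trm \<sigma>) ts = map (subst_trm \<tau>) ts"
    using Rel by (intro map_cong refl subst_trm_cong) auto
  then show ?case by (simp only: subst.simps)
qed auto

lemma subst_trm_comp: "subst_trm \<sigma> (subst_trm \<tau> t) = subst_trm (\<lambda>z. subst_trm \<sigma> (\<tau> z)) t"
  by (induction t) auto

lemma subst_comp: "subst \<sigma> (subst \<tau> \<phi>) = subst (\<lambda>z. subst_trm \<sigma> (\<tau> z)) \<phi>"
  by (induction \<phi>) (auto simp: subst_trm_comp)

lemma fv_subst_trm: "fv_trm (subst_trm \<sigma> t) = (\<Union>z\<in>fv_trm t. fv_trm (\<sigma> z))"
  by (induction t) auto

lemma fv_subst: "fv (subst \<sigma> \<phi>) = (\<Union>z\<in>fv \<phi>. fv_trm (\<sigma> z))"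
  by (induction \<phi>) (auto simp: fv_subst_trm)

lemma params_subst_trm: "params_trm (subst_trm \<sigma> t) = params_trm t \<union> (\<Union>z\<in>fv_trm t. params_trm (\<sigma> z))"
  by (induction t) auto

lemma params_subst: "params (subst \<sigma> \<phi>) = params \<phi> \<union> (\<Union>z\<in>fv \<phi>. params_trm (\<sigma> z))"
  by (induction \<phi>) (auto simp: params_subst_trm)

lemma trm_ok_subst:
  "trm_ok L G \<Gamma> t s \<Longrightarrow> (\<And>z. z \<in> fv_trm t \<Longrightarrow> trm_ok L G \<Gamma> (\<sigma> z) (fst z)) \<Longrightarrow>
     trm_ok L G \<Gamma> (subst_trm \<sigma> t) s"
proof (induction rule: trm_ok.induct)
  case (4 f ss s ts)
  have "list_all2 (trm_ok L G \<Gamma>) (map (subst_trm \<sigma>) ts) ss"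
    unfolding list_all2_conv_all_nth
  proof (intro conjI allI impI)
    show "length (map (subst_trm \<sigma>) ts) = length ss" using 4(2) by (simp add: list_all2_conv_all_nth)
    fix i assume "i < length (map (subst_trm \<sigma>) ts)"
    then have i: "i < length ts" by simp
    have "z \<in> fv_trm (App f ts)" if "z \<in> fv_trm (ts ! i)" for z
      using that nth_mem[OF i] by auto
    then have "trm_ok L G \<Gamma> (subst_trm \<sigma> (ts ! i)) (ss ! i)"
      using 4(2,3) i by (auto simp: list_all2_conv_all_nth)
    then show "trm_ok L G \<Gamma> (map (subst_trm \<sigma>) ts ! i) (ss ! i)" using i by simp
  qed
  then show ?case using 4(1) by (auto intro: trm_ok.intros)
qed (auto intro: trm_ok.intros)

lemma fm_ok_subst:
  "fm_ok L G \<Gamma> \<phi> \<Longrightarrow> (\<And>z \<Gamma>. z \<in> fv \<phi> \<Longrightarrow> trm_ok L G \<Gamma> (\<sigma> z) (fst z)) \<Longrightarrow> fm_ok L G \<Gamma> (subst \<sigma> \<phi>)"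
proof (induction \<phi> arbitrary: \<Gamma>)
  case (Eql t u)
  then obtain s where s: "trm_ok L G \<Gamma> t s" "trm_ok L G \<Gamma> u s" by auto
  have "trm_ok L G \<Gamma> (subst_trm \<sigma> t) s" "trm_ok L G \<Gamma> (subst_trm \<sigma> u) s"
    using Eql.prems(2) by (auto intro!: trm_ok_subst s)
  then show ?case by auto
next
  case (Rel r ts)
  then obtain ss where ss: "rel_ty L r = Some ss" "list_all2 (trm_ok L G \<Gamma>) ts ss" by auto
  have "list_all2 (trm_ok L G \<Gamma>) (map (subst_trm \<sigma>) ts) ss"
    unfolding list_all2_conv_all_nth
  proof (intro conjI allI impI)
    show "length (map (subst_trm \<sigma>) ts) = length ss" using ss(2) by (simp add: list_all2_conv_all_nth)
    fix i assume "i < length (map (subst_trm \<sigma>) ts)"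
    then have i: "i < length ts" by simp
    have "z \<in> fv (Rel r ts)" if "z \<in> fv_trm (ts ! i)" for z
      using that nth_mem[OF i] by auto
    then have "trm_ok L G \<Gamma> (subst_trm \<sigma> (ts ! i)) (ss ! i)"
      using ss(2) i Rel.prems(2) by (intro trm_ok_subst) (auto simp: list_all2_conv_all_nth)
    then show "trm_ok L G \<Gamma> (map (subst_trm \<sigma>) ts ! i) (ss ! i)" using i by simp
  qed
  then show ?case using ss(1) by auto
qed auto

lemma forms_subst:
  assumes "\<phi> \<in> forms L G V A" "A \<subseteq> B"
    and "\<And>z. z \<in> V \<Longrightarrow> (\<forall>\<Gamma>. trm_ok L G \<Gamma> (\<sigma> z) (fst z)) \<and> fv_trm (\<sigma> z) \<subseteq> W \<and> params_trm (\<sigma> z) \<subseteq> B"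
  shows "subst \<sigma> \<phi> \<in> forms L G W B"
proof -
  have \<phi>: "fm_ok L G [] \<phi>" "fv \<phi> \<subseteq> V" "params \<phi> \<subseteq> A" using assms(1) by (auto simp: forms_def)
  have "fm_ok L G [] (subst \<sigma> \<phi>)" using \<phi>(2) assms(3) by (intro fm_ok_subst \<phi>(1)) blast
  moreover have "fv (subst \<sigma> \<phi>) \<subseteq> W" using \<phi>(2) assms(3) unfolding fv_subst by blast
  moreover have "params (subst \<sigma> \<phi>) \<subseteq> B" using \<phi>(2,3) assms(2,3) unfolding params_subst by blast
  ultimately show ?thesis by (simp add: forms_def)
qed

lemma forms_mono: "V \<subseteq> V' \<Longrightarrow> A \<subseteq> A' \<Longrightarrow> forms L G V A \<subseteq> forms L G V' A'"
  by (auto simp: forms_def)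

lemma finite_fv_trm: "finite (fv_trm t)" by (induction t) auto
lemma finite_fv: "finite (fv \<phi>)" by (induction \<phi>) (auto simp: finite_fv_trm)
lemma finite_params_trm: "finite (params_trm t)" by (induction t) auto
lemma finite_params: "finite (params \<phi>)" by (induction \<phi>) (auto simp: finite_params_trm)

section \<open>Formulas as definable sets\<close>

lemma sat_inst: "sat G v e (inst V b \<phi>) \<longleftrightarrow> sat G (\<lambda>z. if z \<in> V then b z else v z) e \<phi>"
  unfolding inst_def by (rule sat_subst) auto

lemma inst_forms:
  assumes "\<phi> \<in> forms L G (U \<union> V) A" "tuple G V b"
  shows "inst V b \<phi> \<in> forms L G U (A \<union> b ` V)"
proof -
  have *: "trm_ok L G \<Gamma> (Par (b z)) (fst z)" if "z \<in> V" for z \<Gamma>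
    using trm_ok.intros(3)[of L G \<Gamma> "b z"] assms(2) that by (simp add: tuple_def)
  show ?thesis
    unfolding inst_def
  proof (rule forms_subst[OF assms(1)], goal_cases)
    case (2 z)
    then show ?case by (cases "z \<in> V") (simp_all add: * trm_ok.intros(1))
  qed simp
qed

text \<open>
  Parameters are replaced by variables, so that \<open>inst\<close> can put them back.
\<close>

primrec gen_trm :: "('a \<Rightarrow> 's var) \<Rightarrow> ('s, 'f, 'a) trm \<Rightarrow> ('s, 'f, 'a) trm" where
  "gen_trm w (Free x) = Free x"
| "gen_trm w (Bound i) = Bound i"
| "gen_trm w (Par a) = Free (w a)"
| "gen_trm w (App f ts) = App f (map (gen_trm w) ts)"

primrec gen :: "('a \<Rightarrow> 's var) \<Rightarrow> ('s, 'f, 'r, 'a) fm \<Rightarrow> ('s, 'f, 'r, 'a) fm" where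
  "gen w Bot = Bot"
| "gen w (Eql t u) = Eql (gen_trm w t) (gen_trm w u)"
| "gen w (Rel r ts) = Rel r (map (gen_trm w) ts)"
| "gen w (Neg \<phi>) = Neg (gen w \<phi>)"
| "gen w (Conj \<phi> \<psi>) = Conj (gen w \<phi>) (gen w \<psi>)"
| "gen w (Exi s \<phi>) = Exi s (gen w \<phi>)"

lemma fv_gen_trm: "fv_trm (gen_trm w t) = fv_trm t \<union> w ` params_trm t" by (induction t) auto
lemma fv_gen: "fv (gen w \<phi>) = fv \<phi> \<union> w ` params \<phi>" by (induction \<phi>) (auto simp: fv_gen_trm)
lemma params_gen_trm: "params_trm (gen_trm w t) = {}" by (induction t) auto
lemma params_gen: "params (gen w \<phi>) = {}" by (induction \<phi>) (auto simp: params_gen_trm)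

lemma inst_gen_trm:
  "fv_trm t \<inter> W = {} \<Longrightarrow> (\<And>a. a \<in> params_trm t \<Longrightarrow> w a \<in> W \<and> c (w a) = a) \<Longrightarrow>
     subst_trm (\<lambda>z. if z \<in> W then Par (c z) else Free z) (gen_trm w t) = t"
proof (induction t)
  case (App f ts)
  have "map (\<lambda>t. subst_trm (\<lambda>z. if z \<in> W then Par (c z) else Free z) (gen_trm w t)) ts = ts"
    using App.prems by (intro map_idI App.IH) auto
  then show ?case by (simp only: gen_trm.simps subst_trm.simps map_map comp_def)
qed auto

lemma inst_gen:
  "fv \<phi> \<inter> W = {} \<Longrightarrow> (\<And>a. a \<in> params \<phi> \<Longrightarrow> w a \<in> W \<and> c (w a) = a) \<Longrightarrow> inst W c (gen w \<phi>) = \<phi>"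
  unfolding inst_def
proof (induction \<phi>)
  case (Rel r ts)
  have "map (\<lambda>t. subst_trm (\<lambda>z. if z \<in> W then Par (c z) else Free z) (gen_trm w t)) ts = ts"
    using Rel.prems by (intro map_idI inst_gen_trm) auto
  then show ?case by (simp only: gen.simps subst.simps map_map comp_def)
next
  case (Eql t u)
  have "subst_trm (\<lambda>z. if z \<in> W then Par (c z) else Free z) (gen_trm w t) = t"
    "subst_trm (\<lambda>z. if z \<in> W then Par (c z) else Free z) (gen_trm w u) = u"
    using Eql.prems by (auto intro!: inst_gen_trm)
  then show ?case by simp
next
  case (Conj \<phi> \<psi>)
  have "subst (\<lambda>z. if z \<in> W then Par (c z) else Free z) (gen w \<phi>) = \<phi>"
    by (rule Conj.IH(1)) (use Conj.prems in auto)
  moreover have "subst (\<lambda>z. if z \<in> W then Par (c z) else Free z) (gen w \<psi>) = \<psi>"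
    by (rule Conj.IH(2)) (use Conj.prems in auto)
  ultimately show ?case by simp
qed auto

lemma trm_ok_gen:
  "trm_ok L G \<Gamma> t s \<Longrightarrow> (\<And>a. a \<in> params_trm t \<Longrightarrow> fst (w a) = srt G a) \<Longrightarrow> trm_ok L G \<Gamma> (gen_trm w t) s"
proof (induction rule: trm_ok.induct)
  case (3 a)
  then show ?case using trm_ok.intros(1)[of L G \<Gamma> "w a"] by simp
next
  case (4 f ss s ts)
  have "list_all2 (trm_ok L G \<Gamma>) (map (gen_trm w) ts) ss"
    unfolding list_all2_conv_all_nth
  proof (intro conjI allI impI)
    show "length (map (gen_trm w) ts) = length ss" using 4(2) by (simp add: list_all2_conv_all_nth)
    fix i assume "i < length (map (gen_trm w) ts)"
    then have i: "i < length ts" by simp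
    have "a \<in> params_trm (App f ts)" if "a \<in> params_trm (ts ! i)" for a
      using that nth_mem[OF i] by auto
    then have "trm_ok L G \<Gamma> (gen_trm w (ts ! i)) (ss ! i)"
      using 4(2,3) i by (auto simp: list_all2_conv_all_nth)
    then show "trm_ok L G \<Gamma> (map (gen_trm w) ts ! i) (ss ! i)" using i by simp
  qed
  then show ?case using 4(1) by (auto intro: trm_ok.intros)
qed (auto intro: trm_ok.intros)

lemma fm_ok_gen:
  "fm_ok L G \<Gamma> \<phi> \<Longrightarrow> (\<And>a. a \<in> params \<phi> \<Longrightarrow> fst (w a) = srt G a) \<Longrightarrow> fm_ok L G \<Gamma> (gen w \<phi>)"
proof (induction \<phi> arbitrary: \<Gamma>)
  case (Eql t u)
  then obtain s where s: "trm_ok L G \<Gamma> t s" "trm_ok L G \<Gamma> u s" by auto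
  have "trm_ok L G \<Gamma> (gen_trm w t) s" "trm_ok L G \<Gamma> (gen_trm w u) s"
    using Eql.prems(2) by (auto intro!: trm_ok_gen s)
  then show ?case by auto
next
  case (Rel r ts)
  then obtain ss where ss: "rel_ty L r = Some ss" "list_all2 (trm_ok L G \<Gamma>) ts ss" by auto
  have "list_all2 (trm_ok L G \<Gamma>) (map (gen_trm w) ts) ss"
    unfolding list_all2_conv_all_nth
  proof (intro conjI allI impI)
    show "length (map (gen_trm w) ts) = length ss" using ss(2) by (simp add: list_all2_conv_all_nth)
    fix i assume "i < length (map (gen_trm w) ts)"
    then have i: "i < length ts" by simp
    have "a \<in> params (Rel r ts)" if "a \<in> params_trm (ts ! i)" for a
      using that nth_mem[OF i] by auto
    then have "trm_ok L G \<Gamma> (gen_trm w (ts ! i)) (ss ! i)"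
      using ss(2) i Rel.prems(2) by (intro trm_ok_gen) (auto simp: list_all2_conv_all_nth)
    then show "trm_ok L G \<Gamma> (map (gen_trm w) ts ! i) (ss ! i)" using i by simp
  qed
  then show ?case using ss(1) by auto
qed auto

text \<open>
  Every formula arises from one without parameters by substituting its parameters for new variables. The new
  variables get indices above all indices occurring in \<open>V\<close>.
\<close>

lemma ex_generalisation:
  fixes G :: "('s, 'f, 'r, 'a) struc"
  assumes "\<phi> \<in> forms L G V A" "A \<subseteq> univ G" "finite V"
  shows "\<exists>W c \<phi>0. finite W \<and> W \<inter> V = {} \<and> \<phi>0 \<in> forms L G (V \<union> W) {} \<and> tuple G W c \<and>
    c ` W \<subseteq> A \<and> inst W c \<phi>0 = \<phi>"
proof -
  have \<phi>: "fm_ok L G [] \<phi>" "fv \<phi> \<subseteq> V" "params \<phi> \<subseteq> A" using assms(1) by (auto simp: forms_def)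
  obtain idx :: "'a \<Rightarrow> nat" where idx: "inj_on idx (params \<phi>)"
    using finite_imp_inj_to_nat_seg[OF finite_params[of \<phi>]] by (elim exE conjE)
  define n where "n = Suc (Max (insert 0 (snd ` V)))"
  have n: "snd z < n" if "z \<in> V" for z
    using that assms(3) unfolding n_def by (intro le_imp_less_Suc Max_ge) auto
  define w where "w a = (srt G a, n + idx a)" for a
  define W where "W = w ` params \<phi>"
  define c where "c = inv_into (params \<phi>) w"
  have inj: "inj_on w (params \<phi>)" using idx by (auto simp: inj_on_def w_def)
  then have c: "c (w a) = a" if "a \<in> params \<phi>" for a using that by (simp add: c_def)
  have "w a \<notin> V" for a using n[of "w a"] by (auto simp: w_def)
  then have disj: "W \<inter> V = {}" by (auto simp: W_def)
  have "inst W c (gen w \<phi>) = \<phi>"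
    by (rule inst_gen) (use disj \<phi>(2) c in \<open>auto simp: W_def\<close>)
  moreover have "gen w \<phi> \<in> forms L G (V \<union> W) {}"
    using fm_ok_gen[OF \<phi>(1), of w] \<phi>(2) by (auto simp: forms_def fv_gen params_gen W_def w_def)
  moreover have "tuple G W c" using c \<phi>(3) assms(2) by (auto simp: tuple_def W_def w_def c)
  moreover have "c ` W \<subseteq> A" using c \<phi>(3) by (auto simp: W_def)
  moreover have "finite W" by (simp add: W_def finite_params)
  ultimately show ?thesis using disj by (intro exI[of _ W] exI[of _ c] exI[of _ "gen w \<phi>"]) simp
qed

definition tset :: "('s, 'f, 'r, 'a) struc \<Rightarrow> 's var set \<Rightarrow> ('s, 'f, 'r, 'a) fm \<Rightarrow> ('s var \<Rightarrow> 'a) set" where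
  "tset G V \<phi> = {b. tuple G V b \<and> sat G b [] \<phi>}"

abbreviation tuples :: "('s, 'f, 'r, 'a) struc \<Rightarrow> 's var set \<Rightarrow> ('s var \<Rightarrow> 'a) set" where
  "tuples G V \<equiv> {b. tuple G V b}"

abbreviation tsets where "tsets L G V A \<equiv> tset G V ` forms L G V A"

definition vset :: "('s, 'f, 'r) lang \<Rightarrow> ('s, 'f, 'r, 'a) struc \<Rightarrow> ('s, 'f, 'r, 'a) fm \<Rightarrow> 'a set" where
  "vset L G \<phi> = {a\<in>gelems L G. holds G a \<phi>}"

abbreviation vsets where "vsets L G A \<equiv> vset L G ` xforms L G A"

lemma forms_connectives:
  "Bot \<in> forms L G V A" "Neg \<phi> \<in> forms L G V A \<longleftrightarrow> \<phi> \<in> forms L G V A"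
  "Conj \<phi> \<psi> \<in> forms L G V A \<longleftrightarrow> \<phi> \<in> forms L G V A \<and> \<psi> \<in> forms L G V A"
  by (auto simp: forms_def)

lemma algebra_image_forms:
  assumes "\<And>\<phi>. \<phi> \<in> forms L G V A \<Longrightarrow> D (Neg \<phi>) = \<Omega> - D \<phi>"
    "\<And>\<phi> \<psi>. \<phi> \<in> forms L G V A \<Longrightarrow> \<psi> \<in> forms L G V A \<Longrightarrow> D (Conj \<phi> \<psi>) = D \<phi> \<inter> D \<psi>"
    "D Bot = {}" "\<And>\<phi>. D \<phi> \<subseteq> \<Omega>"
  shows "algebra \<Omega> (D ` forms L G V A)"
  unfolding algebra_iff_Int
proof (intro conjI ballI)
  show "D ` forms L G V A \<subseteq> Pow \<Omega>" using assms(4) by auto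
  show "{} \<in> D ` forms L G V A" using assms(3) forms_connectives(1) by (metis imageI)
  fix S assume "S \<in> D ` forms L G V A"
  then obtain \<phi> where \<phi>: "\<phi> \<in> forms L G V A" "S = D \<phi>" by blast
  then show "\<Omega> - S \<in> D ` forms L G V A"
    using assms(1)[OF \<phi>(1)] \<phi> forms_connectives(2)[of \<phi>] by (metis imageI)
  fix T assume "T \<in> D ` forms L G V A"
  then obtain \<psi> where \<psi>: "\<psi> \<in> forms L G V A" "T = D \<psi>" by blast
  then show "S \<inter> T \<in> D ` forms L G V A"
    using \<phi> \<psi> assms(2)[OF \<phi>(1) \<psi>(1)] forms_connectives(3)[of \<phi> \<psi>] by (metis imageI)
qed

lemma algebra_tsets: "algebra (tuples G V) (tsets L G V A)"
  by (rule algebra_image_forms) (auto simp: tset_def)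

lemma vset_simps:
  "vset L G (Neg \<phi>) = gelems L G - vset L G \<phi>" "vset L G (Conj \<phi> \<psi>) = vset L G \<phi> \<inter> vset L G \<psi>"
  "vset L G Bot = {}" "vset L G \<phi> \<subseteq> gelems L G"
  by (auto simp: vset_def holds_def)

lemma algebra_vsets: "algebra (gelems L G) (vsets L G A)"
  by (rule algebra_image_forms) (auto simp: vset_simps vset_simps(4)[THEN subsetD])

lemma holds_eq_sat:
  assumes "fv \<phi> \<subseteq> {x}"
  shows "holds G (b x) \<phi> \<longleftrightarrow> sat G b [] \<phi>"
  unfolding holds_def by (rule sat_cong) (use assms in auto)

section \<open>Keisler measures as charges\<close>

text \<open>
  A Keisler measure as a function of definable sets instead of formulas.
\<close>

definition charge_of where
  "charge_of L G \<mu> S = \<mu> (SOME \<phi>. \<phi> \<in> xforms L G (univ G) \<and> vset L G \<phi> = S)"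

lemma charge_of_vset:
  assumes "\<mu> \<in> keisler L G (univ G)" "\<phi> \<in> xforms L G (univ G)"
  shows "charge_of L G \<mu> (vset L G \<phi>) = \<mu> \<phi>"
proof -
  define \<psi> where "\<psi> = (SOME \<psi>. \<psi> \<in> xforms L G (univ G) \<and> vset L G \<psi> = vset L G \<phi>)"
  have "\<psi> \<in> xforms L G (univ G) \<and> vset L G \<psi> = vset L G \<phi>"
    unfolding \<psi>_def by (rule someI[of _ \<phi>]) (use assms(2) in simp)
  then have "\<psi> \<in> xforms L G (univ G)" "\<forall>a\<in>gelems L G. holds G a \<psi> \<longleftrightarrow> holds G a \<phi>"
    by (auto simp: vset_def)
  then have "\<mu> \<psi> = \<mu> \<phi>" using assms unfolding keisler_def by blast
  then show ?thesis by (simp add: charge_of_def \<psi>_def)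
qed

lemma charge_charge_of:
  assumes "\<mu> \<in> keisler L G (univ G)"
  shows "charge (gelems L G) (vsets L G (univ G)) (charge_of L G \<mu>)"
proof -
  interpret algebra "gelems L G" "vsets L G (univ G)" by (rule algebra_vsets)
  note eq = charge_of_vset[OF assms]
  show ?thesis
  proof
    fix A B assume A: "A \<in> vsets L G (univ G)"
    then obtain \<phi> where \<phi>: "\<phi> \<in> xforms L G (univ G)" "A = vset L G \<phi>"
      by (elim imageE) (rule that)
    show "0 \<le> charge_of L G \<mu> A"
      unfolding \<phi>(2) eq[OF \<phi>(1)] using assms \<phi>(1) unfolding keisler_def by blast
    assume B: "B \<in> vsets L G (univ G)" and disj: "A \<inter> B = {}"
    from B obtain \<psi> where \<psi>: "\<psi> \<in> xforms L G (univ G)" "B = vset L G \<psi>"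
      by (elim imageE) (rule that)
    have Disj: "Disj \<phi> \<psi> \<in> xforms L G (univ G)" "vset L G (Disj \<phi> \<psi>) = A \<union> B"
      using \<phi> \<psi> by (auto simp: forms_connectives vset_def holds_def)
    have "\<forall>a\<in>gelems L G. \<not> (holds G a \<phi> \<and> holds G a \<psi>)"
      using disj unfolding \<phi> \<psi> vset_def by blast
    then have "\<mu> (Disj \<phi> \<psi>) = \<mu> \<phi> + \<mu> \<psi>" using assms \<phi>(1) \<psi>(1) unfolding keisler_def by blast
    then show "charge_of L G \<mu> (A \<union> B) = charge_of L G \<mu> A + charge_of L G \<mu> B"
      using eq[OF Disj(1)] eq[OF \<phi>(1)] eq[OF \<psi>(1)] unfolding Disj(2) \<phi>(2)[symmetric] \<psi>(2)[symmetric]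
      by simp
  next
    have "vset L G Top = gelems L G" "Top \<in> xforms L G (univ G)"
      by (auto simp: vset_simps forms_connectives)
    moreover have "\<mu> Top = 1" using assms unfolding keisler_def by blast
    ultimately show "charge_of L G \<mu> (gelems L G) = 1" using eq[of Top] by simp
  qed
qed

lemma keisler_of_charge:
  assumes "charge (gelems L G) (vsets L G (univ G)) m"
    and "\<And>\<phi>. \<phi> \<in> xforms L G (univ G) \<Longrightarrow> \<nu> \<phi> = m (vset L G \<phi>)"
  shows "\<nu> \<in> keisler L G (univ G)"
proof -
  interpret charge "gelems L G" "vsets L G (univ G)" m by fact
  show ?thesis
    unfolding keisler_def
  proof (intro CollectI conjI ballI impI)
    show "0 \<le> \<nu> \<phi>" if "\<phi> \<in> xforms L G (univ G)" for \<phi>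
      using assms(2)[OF that] nonneg that by simp
    show "\<nu> Top = 1" using assms(2)[of Top] total by (simp add: vset_simps forms_connectives)
    fix \<phi> \<psi> assume *: "\<phi> \<in> xforms L G (univ G)" "\<psi> \<in> xforms L G (univ G)"
    show "\<nu> \<phi> = \<nu> \<psi>" if "\<forall>a\<in>gelems L G. holds G a \<phi> = holds G a \<psi>"
    proof -
      have "vset L G \<phi> = vset L G \<psi>" using that by (auto simp: vset_def)
      then show ?thesis using assms(2) * by simp
    qed
    show "\<nu> (Disj \<phi> \<psi>) = \<nu> \<phi> + \<nu> \<psi>" if "\<forall>a\<in>gelems L G. \<not> (holds G a \<phi> \<and> holds G a \<psi>)"
    proof -
      have "vset L G \<phi> \<inter> vset L G \<psi> = {}" using that by (auto simp: vset_def)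
      moreover have "vset L G (Disj \<phi> \<psi>) = vset L G \<phi> \<union> vset L G \<psi>"
        by (auto simp: vset_def holds_def)
      ultimately show ?thesis
        using assms(2) * additive[of "vset L G \<phi>" "vset L G \<psi>"] by (simp add: forms_connectives)
    qed
  qed
qed

section \<open>Type spaces\<close>

text \<open>
  By Zorn's lemma there is a maximal set of formulas that remains finitely satisfiable jointly with \<open>\<B>\<close>;
  it is complete, since otherwise neither a formula nor its negation could be added. The members of \<open>\<B>\<close>
  need not be definable. This allows transferring conditions that are awkward to write as formulas to a
  realisation of the type.
\<close>

lemma ex_type_meeting:
  fixes G :: "('s, 'f, 'r, 'a) struc"
  assumes fip: "\<And>\<B>0. finite \<B>0 \<Longrightarrow> \<B>0 \<subseteq> \<B> \<Longrightarrow> \<exists>b. tuple G V b \<and> b \<in> \<Inter>\<B>0"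
  obtains p where "p \<in> types L G V A"
    "\<And>F \<B>0. finite F \<Longrightarrow> F \<subseteq> p \<Longrightarrow> finite \<B>0 \<Longrightarrow> \<B>0 \<subseteq> \<B> \<Longrightarrow>
      \<exists>b. tuple G V b \<and> (\<forall>\<phi>\<in>F. sat G b [] \<phi>) \<and> b \<in> \<Inter>\<B>0"
proof -
  define ok where "ok p \<longleftrightarrow> (\<forall>F \<B>0. finite F \<and> F \<subseteq> p \<and> finite \<B>0 \<and> \<B>0 \<subseteq> \<B> \<longrightarrow>
      (\<exists>b. tuple G V b \<and> (\<forall>\<phi>\<in>F. sat G b [] \<phi>) \<and> b \<in> \<Inter>\<B>0))" for p
  define \<P> where "\<P> = {p. p \<subseteq> forms L G V A \<and> ok p}"
  have "\<Union>\<C> \<in> \<P>" if \<C>: "subset.chain \<P> \<C>" for \<C>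
  proof (cases "\<C> = {}")
    case True
    have "ok {}" unfolding ok_def using fip by auto
    then show ?thesis using True by (simp add: \<P>_def)
  next
    case False
    have sub: "\<C> \<subseteq> \<P>" using \<C> by (simp add: subset.chain_def)
    have "ok (\<Union>\<C>)"
      unfolding ok_def
    proof (intro allI impI)
      fix F \<B>0 assume F: "finite F \<and> F \<subseteq> \<Union>\<C> \<and> finite \<B>0 \<and> \<B>0 \<subseteq> \<B>"
      then obtain X where X: "X \<in> \<C>" "F \<subseteq> X"
        using finite_subset_Union_chain[OF _ _ False \<C>, of F] by metis
      then have "ok X" using sub by (auto simp: \<P>_def)
      then show "\<exists>b. tuple G V b \<and> (\<forall>\<phi>\<in>F. sat G b [] \<phi>) \<and> b \<in> \<Inter>\<B>0"
        using F X(2) unfolding ok_def by blast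
    qed
    then show ?thesis using sub by (auto simp: \<P>_def)
  qed
  then obtain p where p: "p \<in> \<P>" and max: "\<And>q. q \<in> \<P> \<Longrightarrow> p \<subseteq> q \<Longrightarrow> q = p"
    using subset_Zorn'[of \<P>] by metis
  have okp: "ok p" and pf: "p \<subseteq> forms L G V A" using p by (auto simp: \<P>_def)
  have bad: "\<exists>F \<B>0. finite F \<and> F \<subseteq> p \<and> finite \<B>0 \<and> \<B>0 \<subseteq> \<B> \<and>
      (\<forall>b. tuple G V b \<and> (\<forall>\<psi>\<in>F. sat G b [] \<psi>) \<and> b \<in> \<Inter>\<B>0 \<longrightarrow> \<not> sat G b [] \<phi>)"
    if \<phi>: "\<phi> \<in> forms L G V A" "\<phi> \<notin> p" for \<phi>
  proof -
    have "insert \<phi> p \<notin> \<P>" using max[of "insert \<phi> p"] \<phi>(2) by blast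
    then have "\<not> ok (insert \<phi> p)" using pf \<phi>(1) by (simp add: \<P>_def)
    then obtain F \<B>0 where F: "finite F" "F \<subseteq> insert \<phi> p" "finite \<B>0" "\<B>0 \<subseteq> \<B>"
      "\<not> (\<exists>b. tuple G V b \<and> (\<forall>\<phi>\<in>F. sat G b [] \<phi>) \<and> b \<in> \<Inter>\<B>0)"
      unfolding ok_def by blast
    have "finite (F - {\<phi>})" "F - {\<phi>} \<subseteq> p" using F by auto
    then show ?thesis using F(3-5) by (intro exI[of _ "F - {\<phi>}"] exI[of _ \<B>0]) blast
  qed
  have dec: "\<phi> \<in> p \<or> Neg \<phi> \<in> p" if \<phi>: "\<phi> \<in> forms L G V A" for \<phi>
  proof (rule ccontr)
    assume n: "\<not> (\<phi> \<in> p \<or> Neg \<phi> \<in> p)"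
    then have n1: "\<phi> \<notin> p" and n2: "Neg \<phi> \<notin> p" by auto
    obtain F1 \<B>1 where 1: "finite F1" "F1 \<subseteq> p" "finite \<B>1" "\<B>1 \<subseteq> \<B>"
      "\<forall>b. tuple G V b \<and> (\<forall>\<psi>\<in>F1. sat G b [] \<psi>) \<and> b \<in> \<Inter>\<B>1 \<longrightarrow> \<not> sat G b [] \<phi>"
      using bad[OF \<phi> n1] by (elim exE conjE)
    obtain F2 \<B>2 where 2: "finite F2" "F2 \<subseteq> p" "finite \<B>2" "\<B>2 \<subseteq> \<B>"
      "\<forall>b. tuple G V b \<and> (\<forall>\<psi>\<in>F2. sat G b [] \<psi>) \<and> b \<in> \<Inter>\<B>2 \<longrightarrow> \<not> sat G b [] (Neg \<phi>)"
      using bad[OF _ n2] \<phi> forms_connectives(2) by (metis (no_types, lifting))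
    obtain b where b: "tuple G V b" "\<forall>\<psi>\<in>F1 \<union> F2. sat G b [] \<psi>" "b \<in> \<Inter>(\<B>1 \<union> \<B>2)"
      using okp[unfolded ok_def, rule_format, of "F1 \<union> F2" "\<B>1 \<union> \<B>2"] 1(1-4) 2(1-4) by auto
    then have "\<not> sat G b [] \<phi>" "\<not> sat G b [] (Neg \<phi>)" using 1(5) 2(5) by auto
    then show False by simp
  qed
  have sats: "\<exists>b. tuple G V b \<and> (\<forall>\<phi>\<in>F. sat G b [] \<phi>) \<and> b \<in> \<Inter>\<B>0"
    if "finite F" "F \<subseteq> p" "finite \<B>0" "\<B>0 \<subseteq> \<B>" for F \<B>0
    using okp that unfolding ok_def by blast
  show ?thesis
  proof (rule that)
    have "\<exists>b. tuple G V b \<and> (\<forall>\<phi>\<in>F. sat G b [] \<phi>)" if "finite F \<and> F \<subseteq> p" for F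
      using sats[of F "{}"] that by auto
    then show "p \<in> types L G V A" using pf dec by (simp add: types_def)
  qed (rule sats)
qed

definition cylinder where
  "cylinder L G V A \<phi> = {p \<in> types L G V A. \<phi> \<in> p}"

abbreviation "cylinders L G V A \<equiv> cylinder L G V A ` forms L G V A"

lemma type_top_cylinders: "type_top L G V A = topology_generated_by (cylinders L G V A)"
  by (simp add: type_top_def cylinder_def[abs_def])

lemma types_finite_sat:
  "p \<in> types L G V A \<Longrightarrow> finite F \<Longrightarrow> F \<subseteq> p \<Longrightarrow> \<exists>b. tuple G V b \<and> (\<forall>\<phi>\<in>F. sat G b [] \<phi>)"
  by (simp add: types_def)

lemma types_Neg:
  assumes "p \<in> types L G V A" "\<phi> \<in> forms L G V A"
  shows "Neg \<phi> \<in> p \<longleftrightarrow> \<phi> \<notin> p"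
proof -
  have "\<phi> \<in> p \<or> Neg \<phi> \<in> p" using assms by (simp add: types_def)
  moreover have "\<not> (\<phi> \<in> p \<and> Neg \<phi> \<in> p)"
    using types_finite_sat[OF assms(1), of "{\<phi>, Neg \<phi>}"] by auto
  ultimately show ?thesis by blast
qed

lemma types_closed:
  assumes p: "p \<in> types L G V A" and F: "finite F" "F \<subseteq> p" and \<phi>: "\<phi> \<in> forms L G V A"
    and imp: "\<And>b. tuple G V b \<Longrightarrow> (\<forall>\<psi>\<in>F. sat G b [] \<psi>) \<Longrightarrow> sat G b [] \<phi>"
  shows "\<phi> \<in> p"
proof (rule ccontr)
  assume "\<phi> \<notin> p"
  then have "Neg \<phi> \<in> p" using types_Neg[OF p \<phi>] by simp
  then obtain b where "tuple G V b" "\<forall>\<psi>\<in>insert (Neg \<phi>) F. sat G b [] \<psi>"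
    using types_finite_sat[OF p, of "insert (Neg \<phi>) F"] F by blast
  then show False using imp[of b] by simp
qed

lemma types_Conj:
  assumes "p \<in> types L G V A" "\<phi> \<in> forms L G V A" "\<psi> \<in> forms L G V A"
  shows "Conj \<phi> \<psi> \<in> p \<longleftrightarrow> \<phi> \<in> p \<and> \<psi> \<in> p"
proof
  assume c: "Conj \<phi> \<psi> \<in> p"
  have "\<phi> \<in> p" by (rule types_closed[OF assms(1), of "{Conj \<phi> \<psi>}"]) (use c assms(2) in simp_all)
  moreover have "\<psi> \<in> p" by (rule types_closed[OF assms(1), of "{Conj \<phi> \<psi>}"]) (use c assms(3) in simp_all)
  ultimately show "\<phi> \<in> p \<and> \<psi> \<in> p" by (rule conjI)
next
  assume c: "\<phi> \<in> p \<and> \<psi> \<in> p"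
  show "Conj \<phi> \<psi> \<in> p"
    by (rule types_closed[OF assms(1), of "{\<phi>, \<psi>}"]) (use c assms(2,3) in \<open>simp_all add: forms_connectives\<close>)
qed

lemma types_Bot: "p \<in> types L G V A \<Longrightarrow> Bot \<notin> p"
  using types_finite_sat[of p L G V A "{Bot}"] by auto

lemma algebra_cylinders: "algebra (types L G V A) (cylinders L G V A)"
  by (rule algebra_image_forms) (auto simp: cylinder_def types_Neg types_Conj types_Bot)

lemma topspace_type_top [simp]: "topspace (type_top L G V A) = types L G V A"
proof -
  interpret algebra "types L G V A" "cylinders L G V A" by (rule algebra_cylinders)
  show ?thesis
    unfolding type_top_cylinders topology_generated_by_topspace using top sets_into_space by blast
qed

lemma openin_cylinder: "\<phi> \<in> forms L G V A \<Longrightarrow> openin (type_top L G V A) (cylinder L G V A \<phi>)"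
  unfolding type_top_cylinders by (rule topology_generated_by_Basis) simp

lemma type_top_base:
  assumes "openin (type_top L G V A) U" "p \<in> U"
  shows "\<exists>C\<in>cylinders L G V A. p \<in> C \<and> C \<subseteq> U"
proof -
  interpret algebra "types L G V A" "cylinders L G V A" by (rule algebra_cylinders)
  note sets_Int = Int
  have "generate_topology_on (cylinders L G V A) U"
    using assms(1) unfolding type_top_cylinders openin_topology_generated_by_iff .
  then show ?thesis using assms(2)
  proof (induction arbitrary: p rule: generate_topology_on.induct)
    case (Int a b)
    then obtain C D where C: "C \<in> cylinders L G V A" "p \<in> C" "C \<subseteq> a"
      and D: "D \<in> cylinders L G V A" "p \<in> D" "D \<subseteq> b" by (meson IntD1 IntD2)
    then show ?case using sets_Int[OF C(1) D(1)] by (intro bexI[of _ "C \<inter> D"]) auto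
  next
    case (UN K)
    then obtain k where k: "k \<in> K" "p \<in> k" by blast
    then obtain C where "C \<in> cylinders L G V A" "p \<in> C" "C \<subseteq> k" using UN.IH by meson
    then show ?case using k by (intro bexI[of _ C]) auto
  next
    case (Basis s)
    then show ?case by (intro bexI[of _ s]) auto
  qed simp
qed

text \<open>
  If no finitely many of the basic sets below members of the cover exhaust all tuples, then some type
  contains the negations of all the formulas in question, and it lies in no member of the cover.
\<close>

lemma compact_space_type_top: "compact_space (type_top L G V A)"
  unfolding compact_space_alt
proof (intro allI impI)
  fix \<U> assume "(\<forall>U\<in>\<U>. openin (type_top L G V A) U) \<and> topspace (type_top L G V A) \<subseteq> \<Union>\<U>"
  then have \<U>: "\<forall>U\<in>\<U>. openin (type_top L G V A) U" "topspace (type_top L G V A) \<subseteq> \<Union>\<U>" by auto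
  define \<Phi> where "\<Phi> = {\<phi> \<in> forms L G V A. \<exists>U\<in>\<U>. cylinder L G V A \<phi> \<subseteq> U}"
  define \<B> where "\<B> = (\<lambda>\<phi>. {b. \<not> sat G b [] \<phi>}) ` \<Phi>"
  have fin_cover: "\<exists>\<Phi>0. finite \<Phi>0 \<and> \<Phi>0 \<subseteq> \<Phi> \<and> (\<forall>b. tuple G V b \<longrightarrow> (\<exists>\<phi>\<in>\<Phi>0. sat G b [] \<phi>))"
  proof (rule ccontr)
    assume "\<not> ?thesis"
    then have no: "\<exists>b. tuple G V b \<and> (\<forall>\<phi>\<in>\<Phi>0. \<not> sat G b [] \<phi>)" if "finite \<Phi>0 \<and> \<Phi>0 \<subseteq> \<Phi>" for \<Phi>0
      using that by simp
    have fip: "\<exists>b. tuple G V b \<and> b \<in> \<Inter>\<B>0" if \<B>0: "finite \<B>0" "\<B>0 \<subseteq> \<B>" for \<B>0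
    proof -
      obtain \<Phi>0 where \<Phi>0: "\<Phi>0 \<subseteq> \<Phi>" "finite \<Phi>0" "\<B>0 = (\<lambda>\<phi>. {b. \<not> sat G b [] \<phi>}) ` \<Phi>0"
        using finite_subset_image[OF \<B>0[unfolded \<B>_def]] by (elim exE conjE)
      obtain b where "tuple G V b" "\<forall>\<phi>\<in>\<Phi>0. \<not> sat G b [] \<phi>"
        using no[OF conjI[OF \<Phi>0(2,1)]] by (elim exE conjE) (rule that)
      then show ?thesis using \<Phi>0(3) by (intro exI[of _ b]) simp
    qed
    obtain p where p: "p \<in> types L G V A" and
      meet: "\<And>F \<B>0. finite F \<Longrightarrow> F \<subseteq> p \<Longrightarrow> finite \<B>0 \<Longrightarrow> \<B>0 \<subseteq> \<B> \<Longrightarrow>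
        \<exists>b. tuple G V b \<and> (\<forall>\<phi>\<in>F. sat G b [] \<phi>) \<and> b \<in> \<Inter>\<B>0"
      by (rule ex_type_meeting[OF fip]) (assumption+, rule that)
    obtain U where U: "U \<in> \<U>" "p \<in> U" using \<U>(2) p by auto
    then have "openin (type_top L G V A) U" using \<U>(1) by simp
    from type_top_base[OF this U(2)]
    obtain C where C: "C \<in> cylinders L G V A" "p \<in> C" "C \<subseteq> U" by (elim bexE conjE)
    obtain \<phi> where \<phi>: "C = cylinder L G V A \<phi>" "\<phi> \<in> forms L G V A"
      using C(1) by (elim imageE) (rule that)
    have "\<phi> \<in> \<Phi>" using C(3) U(1) \<phi> by (auto simp: \<Phi>_def)
    moreover have "\<phi> \<in> p" using C(2) \<phi>(1) by (simp add: cylinder_def)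
    ultimately have "\<exists>b. tuple G V b \<and> (\<forall>\<psi>\<in>{\<phi>}. sat G b [] \<psi>) \<and> b \<in> \<Inter>{{b. \<not> sat G b [] \<phi>}}"
      by (intro meet) (auto simp: \<B>_def)
    then show False by simp
  qed
  obtain \<Phi>0 where \<Phi>0: "finite \<Phi>0" "\<Phi>0 \<subseteq> \<Phi>" "\<forall>b. tuple G V b \<longrightarrow> (\<exists>\<phi>\<in>\<Phi>0. sat G b [] \<phi>)"
    using fin_cover by (elim exE conjE) (rule that)
  have cover: "\<exists>\<phi>\<in>\<Phi>0. \<phi> \<in> p" if p: "p \<in> types L G V A" for p
  proof (rule ccontr)
    assume "\<not> (\<exists>\<phi>\<in>\<Phi>0. \<phi> \<in> p)"
    then have "Neg ` \<Phi>0 \<subseteq> p" using types_Neg[OF p] \<Phi>0(2) by (auto simp: \<Phi>_def)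
    from types_finite_sat[OF p _ this] \<Phi>0(1)
    obtain b where "tuple G V b" "\<forall>\<phi>\<in>Neg ` \<Phi>0. sat G b [] \<phi>" by auto
    then show False using \<Phi>0(3) by (meson image_eqI sat.simps(4))
  qed
  have "\<forall>\<phi>\<in>\<Phi>0. \<exists>U. U \<in> \<U> \<and> cylinder L G V A \<phi> \<subseteq> U" using \<Phi>0(2) by (auto simp: \<Phi>_def)
  from bchoice[OF this] obtain u
    where u: "\<forall>\<phi>\<in>\<Phi>0. u \<phi> \<in> \<U> \<and> cylinder L G V A \<phi> \<subseteq> u \<phi>" by (rule exE)
  have "types L G V A \<subseteq> \<Union>(u ` \<Phi>0)"
  proof
    fix p assume p: "p \<in> types L G V A"
    then obtain \<phi> where "\<phi> \<in> \<Phi>0" "\<phi> \<in> p" using cover by blast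
    then show "p \<in> \<Union>(u ` \<Phi>0)" using u p unfolding cylinder_def by blast
  qed
  then show "\<exists>\<F>. finite \<F> \<and> \<F> \<subseteq> \<U> \<and> topspace (type_top L G V A) \<subseteq> \<Union>\<F>"
    using \<Phi>0(1) u by (intro exI[of _ "u ` \<Phi>0"]) auto
qed

lemma Hausdorff_space_type_top: "Hausdorff_space (type_top L G V A)"
  unfolding Hausdorff_space_def
proof (intro allI impI)
  have *: "\<exists>\<phi>\<in>forms L G V A. \<phi> \<in> p \<and> \<phi> \<notin> q" if "p \<in> types L G V A" "q \<in> types L G V A" "p \<noteq> q" for p q
  proof -
    have "p \<subseteq> forms L G V A" "q \<subseteq> forms L G V A" using that by (auto simp: types_def)
    then show ?thesis
      using that(3) types_Neg[OF that(1)] types_Neg[OF that(2)] forms_connectives(2) by blast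
  qed
  fix p q assume "p \<in> topspace (type_top L G V A) \<and> q \<in> topspace (type_top L G V A) \<and> p \<noteq> q"
  then have pq: "p \<in> types L G V A" "q \<in> types L G V A" "p \<noteq> q" by auto
  then obtain \<phi> where \<phi>: "\<phi> \<in> forms L G V A" "\<phi> \<in> p" "\<phi> \<notin> q" using * by blast
  have "Neg \<phi> \<in> forms L G V A" using \<phi> by (simp add: forms_connectives)
  moreover have "disjnt (cylinder L G V A \<phi>) (cylinder L G V A (Neg \<phi>))"
    using types_Neg[OF _ \<phi>(1)] by (auto simp: disjnt_def cylinder_def)
  moreover have "p \<in> cylinder L G V A \<phi>" "q \<in> cylinder L G V A (Neg \<phi>)"
    using pq \<phi> types_Neg[OF pq(2) \<phi>(1)] by (auto simp: cylinder_def)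
  ultimately show "\<exists>U V'. openin (type_top L G V A) U \<and> openin (type_top L G V A) V' \<and>
      p \<in> U \<and> q \<in> V' \<and> disjnt U V'"
    using openin_cylinder \<phi>(1)
    by (intro exI[of _ "cylinder L G V A \<phi>"] exI[of _ "cylinder L G V A (Neg \<phi>)"] conjI) simp_all
qed

lemma clopen_base_types: "clopen_base (type_top L G V A) (cylinders L G V A)"
proof (rule clopen_base.intro)
  show "openin (type_top L G V A) C" if "C \<in> cylinders L G V A" for C
    using that by (elim imageE) (simp add: openin_cylinder)
  show "\<exists>C\<in>cylinders L G V A. p \<in> C \<and> C \<subseteq> U" if "openin (type_top L G V A) U" "p \<in> U" for U p
    by (rule type_top_base[OF that])
qed (simp_all add: algebra_cylinders compact_space_type_top)

lemma tp_types: "tuple G V b \<Longrightarrow> tp L G V b A \<in> types L G V A"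
  by (auto simp: types_def tp_def forms_connectives)

lemma mem_tp: "\<phi> \<in> forms L G V A \<Longrightarrow> \<phi> \<in> tp L G V b A \<longleftrightarrow> sat G b [] \<phi>"
  by (simp add: tp_def)

section \<open>Definability as uniform approximability\<close>

text \<open>
  The type space is compact and has a base of cylinders, so finitely many cylinders on which \<open>F\<close> oscillates
  little cover it.
\<close>

lemma tmeas_of_continuous:
  assumes F: "continuous_map (type_top L G V A) euclideanreal F"
    and h: "\<And>b. tuple G V b \<Longrightarrow> h b = F (tp L G V b A)"
  shows "tmeas (tuples G V) (tsets L G V A) h"
  unfolding tmeas_def
proof (intro allI impI)
  fix \<epsilon> :: real assume "\<epsilon> > 0"
  define \<Phi> where "\<Phi> = {\<phi> \<in> forms L G V A. \<forall>p\<in>cylinder L G V A \<phi>. \<forall>q\<in>cylinder L G V A \<phi>. \<bar>F p - F q\<bar> \<le> \<epsilon>}"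
  have "\<exists>\<F>. finite \<F> \<and> \<F> \<subseteq> cylinder L G V A ` \<Phi> \<and> topspace (type_top L G V A) \<subseteq> \<Union>\<F>"
  proof (rule compactinD)
    show "compactin (type_top L G V A) (topspace (type_top L G V A))"
      using compact_space_type_top by (simp add: compact_space_def)
    show "openin (type_top L G V A) U" if "U \<in> cylinder L G V A ` \<Phi>" for U
      using that openin_cylinder by (auto simp: \<Phi>_def)
    show "topspace (type_top L G V A) \<subseteq> \<Union> (cylinder L G V A ` \<Phi>)"
    proof
      fix p assume p: "p \<in> topspace (type_top L G V A)"
      define U where "U = {q \<in> topspace (type_top L G V A). F q \<in> ball (F p) (\<epsilon> / 2)}"
      have "openin (type_top L G V A) U" unfolding U_def
        by (rule openin_continuous_map_preimage[OF F]) simp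
      moreover have "p \<in> U" using p \<open>\<epsilon> > 0\<close> by (simp add: U_def)
      ultimately have "openin (type_top L G V A) U" "p \<in> U" by auto
      from type_top_base[OF this] obtain C where C: "C \<in> cylinders L G V A" "p \<in> C" "C \<subseteq> U"
        by (elim bexE conjE)
      obtain \<phi> where \<phi>: "C = cylinder L G V A \<phi>" "\<phi> \<in> forms L G V A"
        using C(1) by (elim imageE) (rule that)
      have "\<bar>F q - F q'\<bar> \<le> \<epsilon>" if "q \<in> C" "q' \<in> C" for q q'
      proof -
        have "dist (F p) (F q) < \<epsilon> / 2" "dist (F p) (F q') < \<epsilon> / 2"
          using that C(3) by (auto simp: U_def)
        then show ?thesis unfolding dist_real_def by linarith
      qed
      then have "\<phi> \<in> \<Phi>" using \<phi> by (simp add: \<Phi>_def)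
      then show "p \<in> \<Union> (cylinder L G V A ` \<Phi>)" using C(2) \<phi>(1) by blast
    qed
  qed
  then obtain \<F> where \<F>: "finite \<F>" "\<F> \<subseteq> cylinder L G V A ` \<Phi>" "types L G V A \<subseteq> \<Union>\<F>" by auto
  then obtain \<Phi>0 where \<Phi>0: "\<Phi>0 \<subseteq> \<Phi>" "finite \<Phi>0" "\<F> = cylinder L G V A ` \<Phi>0"
    using finite_subset_image[OF \<F>(1,2)] by (elim exE conjE)
  have "tuples G V \<subseteq> \<Union>(tset G V ` \<Phi>0)"
  proof
    fix b assume b: "b \<in> tuples G V"
    then have "tp L G V b A \<in> \<Union>\<F>" using \<F>(3) tp_types[of G V b L A] by auto
    then obtain \<phi> where \<phi>: "\<phi> \<in> \<Phi>0" "\<phi> \<in> tp L G V b A" unfolding \<Phi>0(3) cylinder_def by auto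
    then have "b \<in> tset G V \<phi>" using b by (simp add: tset_def tp_def)
    then show "b \<in> \<Union>(tset G V ` \<Phi>0)" using \<phi>(1) by (rule UN_I[rotated])
  qed
  moreover have "\<bar>h b - h b'\<bar> \<le> \<epsilon>" if "\<phi> \<in> \<Phi>0" "b \<in> tset G V \<phi>" "b' \<in> tset G V \<phi>" for \<phi> b b'
  proof -
    have \<phi>: "\<phi> \<in> \<Phi>" "\<phi> \<in> forms L G V A" using that(1) \<Phi>0(1) by (auto simp: \<Phi>_def)
    then have "tp L G V b A \<in> cylinder L G V A \<phi>" "tp L G V b' A \<in> cylinder L G V A \<phi>"
      using that(2,3) tp_types by (auto simp: cylinder_def mem_tp tset_def)
    then show ?thesis using \<phi>(1) that(2,3) h by (auto simp: \<Phi>_def tset_def)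
  qed
  moreover have "\<Phi>0 \<subseteq> forms L G V A" using \<Phi>0(1) by (auto simp: \<Phi>_def)
  ultimately show "\<exists>P. finite P \<and> P \<subseteq> tsets L G V A \<and> tuples G V \<subseteq> \<Union>P \<and>
      (\<forall>S\<in>P. \<forall>b\<in>S \<inter> tuples G V. \<forall>b'\<in>S \<inter> tuples G V. \<bar>h b - h b'\<bar> \<le> \<epsilon>)"
    using \<Phi>0(2) by (intro exI[of _ "tset G V ` \<Phi>0"]) auto
qed

lemma saturatedD:
  assumes "sufficiently_saturated L \<kappa> G" "A \<subseteq> univ G" "|A| <o \<kappa>" "finite V" "p \<in> types L G V A"
  shows "\<exists>b. tuple G V b \<and> p = tp L G V b A"
  using assms unfolding sufficiently_saturated_def by blast

text \<open>
  Elements of the same type lie in the same cells of every definable cover, so \<open>h\<close> factors through types;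
  every type over a small set is realised. A cell of a cover with small oscillation is a neighbourhood
  witnessing continuity.
\<close>

lemma continuous_of_tmeas:
  assumes sat: "sufficiently_saturated L \<kappa> G" "A \<subseteq> univ G" "|A| <o \<kappa>" "finite V"
    and h: "tmeas (tuples G V) (tsets L G V A) h"
  shows "\<exists>F. continuous_map (type_top L G V A) euclideanreal F \<and>
    (\<forall>b. tuple G V b \<longrightarrow> h b = F (tp L G V b A))"
proof -
  have near: "\<exists>\<phi>\<in>forms L G V A. sat G b [] \<phi> \<and>
      (\<forall>b'. tuple G V b' \<longrightarrow> sat G b' [] \<phi> \<longrightarrow> \<bar>h b - h b'\<bar> \<le> \<epsilon>)"
    if b: "tuple G V b" and "\<epsilon> > 0" for b \<epsilon>
  proof -
    obtain P where P: "finite P" "P \<subseteq> tsets L G V A" "tuples G V \<subseteq> \<Union>P"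
      "\<And>A x y. A \<in> P \<Longrightarrow> x \<in> A \<inter> tuples G V \<Longrightarrow> y \<in> A \<inter> tuples G V \<Longrightarrow> \<bar>h x - h y\<bar> \<le> \<epsilon>"
      by (rule tmeasE[OF h \<open>\<epsilon> > 0\<close>]) (rule that)
    obtain S where S: "S \<in> P" "b \<in> S" using P(3) b by auto
    have "S \<in> tsets L G V A" by (rule subsetD[OF P(2) S(1)])
    then obtain \<phi> where \<phi>: "S = tset G V \<phi>" "\<phi> \<in> forms L G V A" by (elim imageE) (rule that)
    show ?thesis
    proof (intro bexI[OF _ \<phi>(2)] conjI allI impI)
      show "sat G b [] \<phi>" using S(2) \<phi>(1) by (simp add: tset_def)
      show "\<bar>h b - h b'\<bar> \<le> \<epsilon>" if "tuple G V b'" "sat G b' [] \<phi>" for b'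
        by (rule P(4)[OF S(1)]) (use S(2) b that \<phi>(1) in \<open>auto simp: tset_def\<close>)
    qed
  qed
  have eq: "h b = h b'" if b: "tuple G V b" "tuple G V b'" "tp L G V b A = tp L G V b' A" for b b'
  proof -
    have "\<bar>h b - h b'\<bar> \<le> \<epsilon>" if "\<epsilon> > 0" for \<epsilon>
    proof -
      obtain \<phi> where \<phi>: "\<phi> \<in> forms L G V A" "sat G b [] \<phi>"
        "\<forall>b'. tuple G V b' \<longrightarrow> sat G b' [] \<phi> \<longrightarrow> \<bar>h b - h b'\<bar> \<le> \<epsilon>"
        using near[OF b(1) \<open>\<epsilon> > 0\<close>] by blast
      then have "sat G b' [] \<phi>" using mem_tp[OF \<phi>(1), of b] mem_tp[OF \<phi>(1), of b'] b(3) by simp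
      then show ?thesis using \<phi>(3) b(2) by blast
    qed
    then have "\<bar>h b - h b'\<bar> \<le> 0" by (rule dense_ge)
    then show ?thesis by simp
  qed
  define r where "r p = (SOME b. tuple G V b \<and> p = tp L G V b A)" for p
  have r: "tuple G V (r p)" "tp L G V (r p) A = p" if "p \<in> types L G V A" for p
    using someI_ex[OF saturatedD[OF sat that]] by (auto simp: r_def)
  define F where "F p = h (r p)" for p
  have "continuous_map (type_top L G V A) euclideanreal F"
    unfolding continuous_map
  proof (intro conjI allI impI)
    fix U assume "openin euclideanreal U"
    then have "open U" by simp
    show "openin (type_top L G V A) {p \<in> topspace (type_top L G V A). F p \<in> U}"
    proof (subst openin_subopen, intro ballI)
      fix p assume "p \<in> {p \<in> topspace (type_top L G V A). F p \<in> U}"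
      then have p: "p \<in> types L G V A" "F p \<in> U" by auto
      then obtain \<epsilon> where \<epsilon>: "\<epsilon> > 0" "ball (F p) \<epsilon> \<subseteq> U" using \<open>open U\<close> open_contains_ball by blast
      have "\<epsilon> / 2 > 0" using \<epsilon>(1) by simp
      then obtain \<phi> where \<phi>: "\<phi> \<in> forms L G V A" "sat G (r p) [] \<phi>"
        "\<forall>b'. tuple G V b' \<longrightarrow> sat G b' [] \<phi> \<longrightarrow> \<bar>h (r p) - h b'\<bar> \<le> \<epsilon> / 2"
        using near[OF r(1)[OF p(1)]] by blast
      show "\<exists>T. openin (type_top L G V A) T \<and> p \<in> T \<and> T \<subseteq> {p \<in> topspace (type_top L G V A). F p \<in> U}"
      proof (intro exI conjI)
        show "openin (type_top L G V A) (cylinder L G V A \<phi>)" by (rule openin_cylinder) fact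
        show "p \<in> cylinder L G V A \<phi>"
          using p(1) mem_tp[OF \<phi>(1), of "r p"] \<phi>(2) r(2)[OF p(1)] by (simp add: cylinder_def)
        show "cylinder L G V A \<phi> \<subseteq> {p \<in> topspace (type_top L G V A). F p \<in> U}"
        proof
          fix q assume "q \<in> cylinder L G V A \<phi>"
          then have q: "q \<in> types L G V A" "\<phi> \<in> q" by (auto simp: cylinder_def)
          then have "sat G (r q) [] \<phi>" using mem_tp[OF \<phi>(1), of "r q"] r(2) by simp
          then have "\<bar>F p - F q\<bar> \<le> \<epsilon> / 2" using \<phi>(3) r(1)[OF q(1)] by (simp add: F_def)
          then have "F q \<in> ball (F p) \<epsilon>" using \<epsilon>(1) by (simp add: dist_real_def)
          then show "q \<in> {p \<in> topspace (type_top L G V A). F p \<in> U}" using q(1) \<epsilon>(2) by auto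
        qed
      qed
    qed
  qed simp
  moreover have "h b = F (tp L G V b A)" if "tuple G V b" for b
    using eq[OF that r(1)[OF tp_types[OF that]]] r(2)[OF tp_types[OF that]] by (simp add: F_def)
  ultimately show ?thesis by blast
qed

section \<open>Families of sets definable over small sets\<close>

text \<open>
  Take a complete type of \<open>k\<close>-tuples that is finitely satisfiable jointly with the conditions, and realise
  it. The membership pattern of the realisation in a given \<open>E\<close> is part of its type, hence it is shared by
  some tuple that meets the condition for \<open>E\<close>.
\<close>

lemma compact_family_vsets:
  fixes G :: "('s, 'f, 'r, 'a) struc"
  assumes sat: "sufficiently_saturated L \<kappa> G" "A \<subseteq> univ G" "|A| <o \<kappa>" and \<E>: "\<E> \<subseteq> vsets L G A"
  shows "compact_family (gelems L G) \<E>"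
  unfolding compact_family_def
proof (intro allI impI)
  fix k :: nat and Q :: "'a set \<Rightarrow> nat set \<Rightarrow> bool"
  assume fin: "\<forall>\<E>0. finite \<E>0 \<and> \<E>0 \<subseteq> \<E> \<longrightarrow>
    (\<exists>a::nat \<Rightarrow> 'a. (\<forall>i<k. a i \<in> gelems L G) \<and> (\<forall>E\<in>\<E>0. Q E {i\<in>{..<k}. a i \<in> E}))"
  define V where "V = (\<lambda>i. (gsort L, i)) ` {..<k}"
  define good where "good E = {b. Q E {i\<in>{..<k}. b (gsort L, i) \<in> E}}" for E
  have V: "finite V" by (simp add: V_def)
  have fip: "\<exists>b. tuple G V b \<and> b \<in> \<Inter>\<B>0" if \<B>0: "finite \<B>0" "\<B>0 \<subseteq> good ` \<E>" for \<B>0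
  proof -
    obtain \<E>0 where \<E>0: "\<E>0 \<subseteq> \<E>" "finite \<E>0" "\<B>0 = good ` \<E>0"
      using finite_subset_image[OF \<B>0] by (elim exE conjE)
    obtain a where a: "\<forall>i<k. a i \<in> gelems L G" "\<forall>E\<in>\<E>0. Q E {i\<in>{..<k}. a i \<in> E}"
      using fin \<E>0(1,2) by blast
    have "tuple G V (\<lambda>z. a (snd z))" using a(1) by (auto simp: tuple_def V_def gelems_def)
    moreover have "(\<lambda>z. a (snd z)) \<in> \<Inter>\<B>0" using a(2) \<E>0(3) by (simp add: good_def)
    ultimately show ?thesis by blast
  qed
  obtain p where p: "p \<in> types L G V A" and
    meet: "\<And>F \<B>0. finite F \<Longrightarrow> F \<subseteq> p \<Longrightarrow> finite \<B>0 \<Longrightarrow> \<B>0 \<subseteq> good ` \<E> \<Longrightarrow>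
      \<exists>b. tuple G V b \<and> (\<forall>\<phi>\<in>F. sat G b [] \<phi>) \<and> b \<in> \<Inter>\<B>0"
    by (rule ex_type_meeting[OF fip]) (assumption+, rule that)
  obtain b where b: "tuple G V b" "p = tp L G V b A" using saturatedD[OF sat V p] by blast
  have "Q E {i\<in>{..<k}. b (gsort L, i) \<in> E}" if "E \<in> \<E>" for E
  proof -
    obtain \<phi> where \<phi>: "E = vset L G \<phi>" "\<phi> \<in> xforms L G A"
      using \<E> \<open>E \<in> \<E>\<close> by (elim subsetD[THEN imageE]) (assumption, rule that)
    define \<psi> where "\<psi> i = subst (\<lambda>z. Free (gsort L, i)) \<phi>" for i :: nat
    have \<psi>: "\<psi> i \<in> forms L G V A" if "i < k" for i
      unfolding \<psi>_def using that trm_ok.intros(1)[of L G _ "(gsort L, i)"]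
      by (intro forms_subst[OF \<phi>(2)]) (auto simp: V_def xvar_def)
    have sat_\<psi>: "sat G b' [] (\<psi> i) \<longleftrightarrow> b' (gsort L, i) \<in> E" if "tuple G V b'" "i < k" for b' i
    proof -
      have "b' (gsort L, i) \<in> gelems L G" using that by (auto simp: tuple_def V_def gelems_def)
      then show ?thesis
        unfolding \<psi>_def \<phi>(1) vset_def holds_def by (subst sat_subst[where w = "\<lambda>_. b' (gsort L, i)"]) auto
    qed
    \<comment> \<open>the membership pattern of \<open>b\<close> in \<open>E\<close>, as a finite part of its type\<close>
    define F where "F = (\<lambda>i. if sat G b [] (\<psi> i) then \<psi> i else Neg (\<psi> i)) ` {..<k}"
    have "F \<subseteq> p" using \<psi> by (auto simp: F_def b(2) tp_def forms_connectives)
    then obtain b' where b': "tuple G V b'" "\<forall>\<phi>\<in>F. sat G b' [] \<phi>" "b' \<in> \<Inter>{good E}"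
      using meet[of F "{good E}"] \<open>E \<in> \<E>\<close> by (auto simp: F_def)
    have "b' (gsort L, i) \<in> E \<longleftrightarrow> b (gsort L, i) \<in> E" if i: "i < k" for i
    proof -
      have "sat G b' [] (if sat G b [] (\<psi> i) then \<psi> i else Neg (\<psi> i))"
        using b'(2) i by (auto simp: F_def)
      then show ?thesis using sat_\<psi>[OF b'(1) i] sat_\<psi>[OF b(1) i] by (auto split: if_splits)
    qed
    then have "{i\<in>{..<k}. b' (gsort L, i) \<in> E} = {i\<in>{..<k}. b (gsort L, i) \<in> E}" by auto
    then show ?thesis using b'(3) by (simp add: good_def)
  qed
  moreover have "\<forall>i<k. b (gsort L, i) \<in> gelems L G" using b(1) by (auto simp: tuple_def V_def gelems_def)
  ultimately show "\<exists>a. (\<forall>i<k. a i \<in> gelems L G) \<and> (\<forall>E\<in>\<E>. Q E {i\<in>{..<k}. a i \<in> E})"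
    by (intro exI[of _ "\<lambda>i. b (gsort L, i)"]) blast
qed

section \<open>Small elementary substructures\<close>

definition strip :: "('s, 'f, 'r, 'a) fm \<Rightarrow> ('s, 'f, 'r, 'a) fm" where
  "strip \<phi> = (case \<phi> of Exi s \<psi> \<Rightarrow> \<psi> | _ \<Rightarrow> \<phi>)"

text \<open>
  Formulas with loose bound variables occur as subformulas in the Tarski-Vaught argument. They are
  obtained from closed formulas by stripping quantifiers, so there are no more of them.
\<close>

definition open_forms where
  "open_forms L G = (\<Union>n. (strip ^^ n) ` forms L G UNIV {})"

lemma open_formsI: "fm_ok L G \<Gamma> \<phi> \<Longrightarrow> params \<phi> = {} \<Longrightarrow> \<phi> \<in> open_forms L G"
proof (induction \<Gamma> arbitrary: \<phi>)
  case Nil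
  then have "\<phi> \<in> (strip ^^ 0) ` forms L G UNIV {}" by (simp add: forms_def)
  then show ?case unfolding open_forms_def by blast
next
  case (Cons s \<Gamma>)
  then have "Exi s \<phi> \<in> open_forms L G" by simp
  then obtain n \<psi> where "\<psi> \<in> forms L G UNIV {}" "Exi s \<phi> = (strip ^^ n) \<psi>"
    unfolding open_forms_def by auto
  then have "(strip ^^ Suc n) \<psi> = strip (Exi s \<phi>)" by simp
  then have "\<phi> = (strip ^^ Suc n) \<psi>" by (simp add: strip_def)
  then have "\<phi> \<in> (strip ^^ Suc n) ` forms L G UNIV {}" using \<open>\<psi> \<in> _\<close> by (rule image_eqI)
  then show ?case unfolding open_forms_def by (rule UN_I[OF UNIV_I])
qed

lemma infinite_forms: "infinite (forms L G UNIV {})"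
proof -
  let ?f = "\<lambda>n. Eql (Free (undefined, n)) (Free (undefined, n))"
  have "inj ?f" by (auto simp: inj_on_def)
  moreover have "range ?f \<subseteq> forms L G UNIV {}"
    using trm_ok.intros(1) by (fastforce simp: forms_def)
  ultimately show ?thesis using range_inj_infinite infinite_super by blast
qed

lemma saturated_infinite:
  assumes "sufficiently_saturated L \<kappa> G"
  shows "Card_order \<kappa>" "|forms L G UNIV {}| <o \<kappa>" "infinite (Field \<kappa>)"
proof -
  show \<kappa>: "Card_order \<kappa>" "|forms L G UNIV {}| <o \<kappa>"
    using assms by (auto simp: sufficiently_saturated_def)
  show "infinite (Field \<kappa>)"
  proof
    assume "finite (Field \<kappa>)"
    moreover have "|forms L G UNIV {}| \<le>o |Field \<kappa>|"
      using \<kappa> card_of_Field_ordIso[OF \<kappa>(1)] ordLess_imp_ordLeq ordIso_symmetric ordLeq_ordIso_trans by blast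
    ultimately show False using infinite_forms card_of_ordLeq_finite by blast
  qed
qed

lemma small_finite:
  assumes "sufficiently_saturated L \<kappa> G" "finite F"
  shows "|F| <o \<kappa>"
proof -
  have "|forms L G UNIV {}| <o \<kappa>" by (rule saturated_infinite(2)[OF assms(1)])
  moreover have "|F| <o |forms L G UNIV {}|"
    by (rule finite_ordLess_infinite[OF card_of_Well_order card_of_Well_order])
       (simp_all only: Field_card_of assms(2) infinite_forms not_False_eq_True)
  ultimately show ?thesis by (rule ordLess_transitive[rotated])
qed

lemma small_Un:
  assumes "sufficiently_saturated L \<kappa> G" "|A| <o \<kappa>" "|B| <o \<kappa>"
  shows "|A \<union> B| <o \<kappa>"
  by (rule card_of_Un_ordLess_infinite_Field[OF saturated_infinite(3,1)[OF assms(1)] assms(2,3)])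

lemma card_lists_le:
  assumes r: "Card_order r" "infinite (Field r)" and B: "|B| \<le>o r"
  shows "|lists B| \<le>o r"
proof -
  have "|{xs \<in> lists B. length xs = n}| \<le>o r" for n
  proof (induction n)
    case 0
    have "{xs \<in> lists B. length xs = 0} = {[]}" by auto
    have "Field r \<noteq> {}" using r(2) by auto
    from ordLeq_ordIso_trans[OF card_of_singl_ordLeq[OF this] card_of_Field_ordIso[OF r(1)]]
    show ?case unfolding \<open>_ = {[]}\<close> .
  next
    case (Suc n)
    have "{xs \<in> lists B. length xs = Suc n} \<subseteq> (\<lambda>(x, xs). x # xs) ` (B \<times> {xs \<in> lists B. length xs = n})"
      by (auto simp: length_Suc_conv image_iff)
    then have "|{xs \<in> lists B. length xs = Suc n}| \<le>o |B \<times> {xs \<in> lists B. length xs = n}|"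
      by (rule ordLeq_transitive[OF card_of_mono1 card_of_image])
    also have "|B \<times> {xs \<in> lists B. length xs = n}| \<le>o r"
      by (rule card_of_Times_ordLeq_infinite_Field[OF r(2) B Suc r(1)])
    finally show ?case .
  qed
  moreover have "|UNIV :: nat set| \<le>o r"
    using r infinite_iff_card_of_nat card_of_Field_ordIso ordLeq_ordIso_trans by blast
  ultimately have "|\<Union>n. {xs \<in> lists B. length xs = n}| \<le>o r"
    using r by (intro card_of_UNION_ordLeq_infinite_Field) auto
  moreover have "(\<Union>n. {xs \<in> lists B. length xs = n}) = lists B" by auto
  ultimately show ?thesis by simp
qed

definition fv_list :: "('s, 'f, 'r, 'a) fm \<Rightarrow> 's var list" where
  "fv_list \<phi> = (SOME xs. set xs = fv \<phi>)"

lemma set_fv_list: "set (fv_list \<phi>) = fv \<phi>"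
  unfolding fv_list_def by (rule someI_ex) (rule finite_list[OF finite_fv])

text \<open>
  Skolem functions take a finite list of values for the free variables.
\<close>

definition assignment :: "('s, 'f, 'r, 'a) fm \<Rightarrow> 'a list \<Rightarrow> 's var \<Rightarrow> 'a" where
  "assignment \<phi> vs x = the (map_of (zip (fv_list \<phi>) vs) x)"

lemma assignment_map: "x \<in> fv \<phi> \<Longrightarrow> assignment \<phi> (map v (fv_list \<phi>)) x = v x"
  by (simp add: assignment_def map_of_zip_map set_fv_list)

definition skolem :: "('s, 'f, 'r, 'a) struc \<Rightarrow> ('s, 'f, 'r, 'a) fm \<Rightarrow> 'a list \<Rightarrow> 'a list \<Rightarrow> 'a" where
  "skolem G \<theta> vs e = (SOME a. a \<in> univ G \<and> (\<forall>s \<phi>. \<theta> = Exi s \<phi> \<longrightarrow>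
     (\<exists>a'\<in>univ G. srt G a' = s \<and> sat G (assignment \<theta> vs) (a' # e) \<phi>) \<longrightarrow>
     srt G a = s \<and> sat G (assignment \<theta> vs) (a # e) \<phi>))"

lemma skolem:
  assumes "is_struc L G"
  shows "skolem G \<theta> vs e \<in> univ G"
    and "\<theta> = Exi s \<phi> \<Longrightarrow> a \<in> univ G \<Longrightarrow> srt G a = s \<Longrightarrow> sat G (assignment \<theta> vs) (a # e) \<phi> \<Longrightarrow>
      srt G (skolem G \<theta> vs e) = s \<and> sat G (assignment \<theta> vs) (skolem G \<theta> vs e # e) \<phi>"
proof -
  let ?Q = "\<lambda>a. a \<in> univ G \<and> (\<forall>s \<phi>. \<theta> = Exi s \<phi> \<longrightarrow>
     (\<exists>a'\<in>univ G. srt G a' = s \<and> sat G (assignment \<theta> vs) (a' # e) \<phi>) \<longrightarrow>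
     srt G a = s \<and> sat G (assignment \<theta> vs) (a # e) \<phi>)"
  have "\<exists>a. ?Q a"
  proof (cases "\<exists>s \<phi> a'. \<theta> = Exi s \<phi> \<and> a' \<in> univ G \<and> srt G a' = s \<and> sat G (assignment \<theta> vs) (a' # e) \<phi>")
    case True
    then obtain s \<phi> a' where "\<theta> = Exi s \<phi>" "a' \<in> univ G" "srt G a' = s" "sat G (assignment \<theta> vs) (a' # e) \<phi>"
      by (elim exE conjE)
    then show ?thesis by (intro exI[of _ a']) simp
  next
    case False
    obtain a where "a \<in> univ G" using assms unfolding is_struc_def by blast
    then show ?thesis using False by (intro exI[of _ a]) auto
  qed
  then have Q: "?Q (skolem G \<theta> vs e)" unfolding skolem_def by (rule someI_ex)
  then show "skolem G \<theta> vs e \<in> univ G" by (rule conjunct1)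
  show "srt G (skolem G \<theta> vs e) = s \<and> sat G (assignment \<theta> vs) (skolem G \<theta> vs e # e) \<phi>"
    if "\<theta> = Exi s \<phi>" "a \<in> univ G" "srt G a = s" "sat G (assignment \<theta> vs) (a # e) \<phi>"
  proof -
    have "\<exists>a'\<in>univ G. srt G a' = s \<and> sat G (assignment \<theta> vs) (a' # e) \<phi>"
      using that(2-4) by (intro bexI[of _ a]) simp_all
    with conjunct2[OF Q, THEN spec, THEN spec, THEN mp, OF that(1)] show ?thesis by (rule mp)
  qed
qed

definition skolem_step where
  "skolem_step L G B = B \<union> (\<lambda>(\<theta>, vs, e). skolem G \<theta> vs e) ` (open_forms L G \<times> lists B \<times> lists B)"

definition skolem_hull where
  "skolem_hull L G A = (\<Union>n. (skolem_step L G ^^ n) A)"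

lemma skolem_hull_closed:
  assumes "\<theta> \<in> open_forms L G" "set vs \<subseteq> skolem_hull L G A" "set e \<subseteq> skolem_hull L G A"
  shows "skolem G \<theta> vs e \<in> skolem_hull L G A"
proof -
  let ?S = "\<lambda>n. (skolem_step L G ^^ n) A"
  have mono: "?S m \<subseteq> ?S n" if "m \<le> n" for m n
    using that by (rule lift_Suc_mono_le[of ?S, rotated]) (simp add: skolem_step_def)
  have "\<exists>n. F \<subseteq> ?S n" if "finite F" "F \<subseteq> skolem_hull L G A" for F
    using that
  proof (induction F rule: finite_induct)
    case (insert x F)
    then obtain m n where "F \<subseteq> ?S m" "x \<in> ?S n" by (auto simp: skolem_hull_def)
    then have "insert x F \<subseteq> ?S (max m n)" using mono[of m "max m n"] mono[of n "max m n"] by auto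
    then show ?case by blast
  qed simp
  from this[of "set vs \<union> set e"] assms(2,3) obtain n where "set vs \<union> set e \<subseteq> ?S n" by auto
  then have "(\<theta>, vs, e) \<in> open_forms L G \<times> lists (?S n) \<times> lists (?S n)" using assms(1) by auto
  then have "skolem G \<theta> vs e \<in> ?S (Suc n)" by (force simp: skolem_step_def)
  then show ?thesis unfolding skolem_hull_def by blast
qed

lemma eval_trm_univ: "eval_trm (G\<lparr>univ := N\<rparr>) v e = eval_trm G v e"
proof
  fix t show "eval_trm (G\<lparr>univ := N\<rparr>) v e t = eval_trm G v e t"
  proof (induction t)
    case (App f ts)
    have eq: "map (eval_trm (G\<lparr>univ := N\<rparr>) v e) ts = map (eval_trm G v e) ts"
      by (rule map_cong[OF refl]) (rule App.IH)
    have "fun_in (G\<lparr>univ := N\<rparr>) f as = fun_in G f as" for as by simp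
    then show ?case by (simp only: eval_trm.simps eq)
  qed auto
qed

text \<open>
  The Tarski-Vaught test. Nonemptiness of the sorts and closure under the operations of the language are the
  cases of the formulas \<open>x = x\<close> and \<open>x = f(as)\<close>.
\<close>

lemma elem_substruc_skolem_hull:
  assumes G: "is_struc L G" and A: "A \<subseteq> univ G"
  shows "elem_substruc L G (skolem_hull L G A)"
proof -
  define N where "N = skolem_hull L G A"
  have closed: "skolem G \<theta> vs e \<in> N" if "\<theta> \<in> open_forms L G" "set vs \<subseteq> N" "set e \<subseteq> N" for \<theta> vs e
    using skolem_hull_closed that unfolding N_def .
  have "(skolem_step L G ^^ n) A \<subseteq> univ G" for n
    by (induction n) (use A skolem(1)[OF G] in \<open>auto simp: skolem_step_def\<close>)
  then have N: "N \<subseteq> univ G" by (auto simp: N_def skolem_hull_def)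
  have sorts: "\<exists>a\<in>N. srt G a = s" for s
  proof -
    let ?\<theta> = "Exi s (Eql (Bound 0) (Bound 0))"
    have "trm_ok L G [s] (Bound 0) s" using trm_ok.intros(2)[of 0 "[s]" L G] by simp
    then have "?\<theta> \<in> open_forms L G" by (intro open_formsI[of _ _ "[]"]) auto
    then have "skolem G ?\<theta> [] [] \<in> N" by (intro closed) auto
    moreover obtain a where "a \<in> univ G" "srt G a = s" using G unfolding is_struc_def by blast
    then have "srt G (skolem G ?\<theta> [] []) = s" using skolem(2)[where \<theta> = ?\<theta> and \<phi> = "Eql (Bound 0) (Bound 0)" and vs = "[]" and e = "[]", OF G refl, of a]
      by simp
    ultimately show ?thesis by blast
  qed
  have funs: "fun_in G f as \<in> N \<and> srt G (fun_in G f as) = s"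
    if f: "fun_ty L f = Some (ss, s)" and as: "set as \<subseteq> N" "map (srt G) as = ss" for f ss s as
  proof -
    have val: "fun_in G f as \<in> univ G" "srt G (fun_in G f as) = s"
      using G f as N unfolding is_struc_def by blast+
    let ?t = "App f (map (\<lambda>i. Bound (Suc i)) [0..<length ss])"
    \<comment> \<open>the bound variable \<open>0\<close> is the value; the arguments are the bound variables from \<open>1\<close> on\<close>
    let ?\<phi> = "Eql (Bound 0) ?t"
    let ?\<theta> = "Exi s ?\<phi>"
    have len: "length as = length ss" using as(2) by auto
    have "trm_ok L G (s # ss) (Bound 0) s" using trm_ok.intros(2)[of 0 "s # ss" L G] by simp
    moreover have "trm_ok L G (s # ss) (Bound (Suc i)) (ss ! i)" if "i < length ss" for i
      using trm_ok.intros(2)[of "Suc i" "s # ss" L G] that by simp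
    then have "trm_ok L G (s # ss) ?t s"
      by (intro trm_ok.intros(4)[OF f]) (simp add: list_all2_conv_all_nth)
    ultimately have "?\<theta> \<in> open_forms L G" by (intro open_formsI[of _ _ ss]) auto
    then have mem: "skolem G ?\<theta> [] as \<in> N" using as by (intro closed) auto
    have nth: "map (\<lambda>i. as ! i) [0..<length ss] = as" using len map_nth[of as] by simp
    have eval: "sat G v (a # as) ?\<phi> \<longleftrightarrow> a = fun_in G f as" for v a
      by (simp add: comp_def nth)
    have "skolem G ?\<theta> [] as = fun_in G f as"
      using skolem(2)[where \<theta> = ?\<theta> and \<phi> = ?\<phi> and vs = "[]" and e = as, OF G refl val]
      unfolding eval by simp
    then show ?thesis using mem val(2) by simp
  qed
  have elem: "sat (G\<lparr>univ := N\<rparr>) v e \<phi> \<longleftrightarrow> sat G v e \<phi>"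
    if "fm_ok L G \<Gamma> \<phi>" "params \<phi> = {}" "\<And>x. v x \<in> N" "set e \<subseteq> N" for \<phi> \<Gamma> v e
    using that
  proof (induction \<phi> arbitrary: \<Gamma> e)
    case (Rel r ts)
    show ?case by (simp add: eval_trm_univ)
  next
    case (Conj \<phi> \<psi>)
    then show ?case using Conj.IH(1)[of \<Gamma> e] Conj.IH(2)[of \<Gamma> e] by simp
  next
    case (Neg \<phi>)
    then show ?case using Neg.IH[of \<Gamma> e] by simp
  next
    case (Exi s \<phi>)
    have IH: "sat (G\<lparr>univ := N\<rparr>) v (a # e) \<phi> \<longleftrightarrow> sat G v (a # e) \<phi>" if "a \<in> N" for a
      using Exi.IH[of "s # \<Gamma>" "a # e"] Exi.prems that by simp
    have "\<exists>b\<in>N. srt G b = s \<and> sat G v (b # e) \<phi>"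
      if a: "a \<in> univ G" "srt G a = s" "sat G v (a # e) \<phi>" for a
    proof -
      let ?\<theta> = "Exi s \<phi>" and ?vs = "map v (fv_list (Exi s \<phi>))"
      let ?b = "skolem G ?\<theta> ?vs e"
      have same: "sat G (assignment ?\<theta> ?vs) (c # e) \<phi> \<longleftrightarrow> sat G v (c # e) \<phi>" for c
        by (rule sat_cong) (simp add: assignment_map)
      have "?\<theta> \<in> open_forms L G" using Exi.prems by (intro open_formsI) auto
      then have "?b \<in> N" using Exi.prems by (intro closed) auto
      moreover have "srt G ?b = s \<and> sat G v (?b # e) \<phi>"
        using skolem(2)[where \<theta> = ?\<theta> and \<phi> = \<phi> and vs = ?vs and e = e, OF G refl a(1,2)] a(3)
        unfolding same by (rule mp[OF impI])
      ultimately show ?thesis by blast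
    qed
    then show ?case using IH N by (simp; blast)
  qed (auto simp: eval_trm_univ)
  show ?thesis
    unfolding elem_substruc_def N_def[symmetric]
  proof (intro conjI ballI allI impI)
    show "is_struc L (G\<lparr>univ := N\<rparr>)"
      unfolding is_struc_def using sorts funs by simp
    fix \<phi> v assume "\<phi> \<in> forms L G UNIV {}" "tuple (G\<lparr>univ := N\<rparr>) UNIV v"
    then show "sat (G\<lparr>univ := N\<rparr>) v [] \<phi> \<longleftrightarrow> sat G v [] \<phi>"
      by (intro elem[of "[]"]) (auto simp: forms_def tuple_def)
  qed (rule N)
qed

text \<open>
  The downward Loewenheim-Skolem theorem: each step of the hull adds at most as many elements as there are
  formulas and finite lists, and there are at most as many of them as elements in the infinite disjoint
  union of \<open>A\<close> and the set of all formulas without parameters.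
\<close>

theorem ex_small_elem_substruc:
  assumes G: "is_struc L G" and sat: "sufficiently_saturated L \<kappa> G"
    and A: "A \<subseteq> univ G" "|A| <o \<kappa>"
  shows "\<exists>N. elem_substruc L G N \<and> A \<subseteq> N \<and> |N| <o \<kappa>"
proof -
  let ?F = "forms L G UNIV {}"
  note \<kappa> = saturated_infinite[OF sat]
  define r where "r = |A <+> ?F|"
  have r\<kappa>: "r <o \<kappa>" unfolding r_def
    by (rule card_of_Plus_ordLess_infinite_Field[OF \<kappa>(3,1) A(2) \<kappa>(2)])
  have inf: "infinite (A <+> ?F)" using finite_PlusD(2) infinite_forms by blast
  have r1: "Card_order r" unfolding r_def by (rule card_of_Card_order)
  have r2: "infinite (Field r)" using inf unfolding r_def Field_card_of .
  note r = r1 r2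
  have Ar: "|A| \<le>o r" "|?F| \<le>o r" unfolding r_def by (rule card_of_Plus1, rule card_of_Plus2)
  have nat: "|UNIV :: nat set| \<le>o r"
    using r infinite_iff_card_of_nat card_of_Field_ordIso ordLeq_ordIso_trans by blast
  have "|open_forms L G| \<le>o r"
    unfolding open_forms_def using nat r Ar(2) ordLeq_transitive[OF card_of_image]
    by (intro card_of_UNION_ordLeq_infinite_Field) auto
  then have step: "|skolem_step L G B| \<le>o r" if "|B| \<le>o r" for B
    unfolding skolem_step_def using r that
    by (intro card_of_Un_ordLeq_infinite_Field ordLeq_transitive[OF card_of_image]
        card_of_Times_ordLeq_infinite_Field card_lists_le)
  have "|(skolem_step L G ^^ n) A| \<le>o r" for n
    by (induction n) (auto intro: Ar step)
  then have "|skolem_hull L G A| \<le>o r"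
    unfolding skolem_hull_def using nat r by (intro card_of_UNION_ordLeq_infinite_Field) auto
  then have "|skolem_hull L G A| <o \<kappa>" using r\<kappa> by (rule ordLeq_ordLess_trans)
  moreover have "(skolem_step L G ^^ 0) A \<subseteq> skolem_hull L G A" unfolding skolem_hull_def by blast
  then have "A \<subseteq> skolem_hull L G A" by simp
  ultimately show ?thesis using elem_substruc_skolem_hull[OF G A(1)] by blast
qed

section \<open>The Borel measure of a Keisler measure\<close>

lemma keisler_eqI:
  assumes "\<mu> \<in> keisler L G (univ G)" "\<phi> \<in> xforms L G (univ G)" "\<psi> \<in> xforms L G (univ G)"
    "vset L G \<phi> = vset L G \<psi>"
  shows "\<mu> \<phi> = \<mu> \<psi>"
  using charge_of_vset[OF assms(1,2)] charge_of_vset[OF assms(1,3)] assms(4) by simp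

lemma sat_iff_holds:
  assumes "\<phi> \<in> xforms L G A" "tuple G {xvar L} b"
  shows "sat G b [] \<phi> \<longleftrightarrow> b (xvar L) \<in> vset L G \<phi>"
proof -
  have "b (xvar L) \<in> gelems L G" using assms(2) by (simp add: tuple_def gelems_def xvar_def)
  moreover have "holds G (b (xvar L)) \<phi> \<longleftrightarrow> sat G b [] \<phi>"
    by (rule holds_eq_sat) (use assms(1) in \<open>simp add: forms_def\<close>)
  ultimately show ?thesis by (simp add: vset_def)
qed

text \<open>
  Elements are witnessed by their types; so the measure of a cylinder is well defined.
\<close>

lemma vset_subset_of_cylinder:
  assumes \<phi>: "\<phi> \<in> xforms L G A" and \<psi>: "\<psi> \<in> xforms L G A"
    and sub: "cylinder L G {xvar L} A \<phi> \<subseteq> cylinder L G {xvar L} A \<psi>"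
  shows "vset L G \<phi> \<subseteq> vset L G \<psi>"
proof
  fix a assume a: "a \<in> vset L G \<phi>"
  have t: "tuple G {xvar L} (\<lambda>_. a)" using a by (simp add: vset_def gelems_def tuple_def xvar_def)
  have "tp L G {xvar L} (\<lambda>_. a) A \<in> cylinder L G {xvar L} A \<phi>"
    using a sat_iff_holds[OF \<phi> t] by (simp add: cylinder_def tp_types[OF t] mem_tp[OF \<phi>])
  then have "tp L G {xvar L} (\<lambda>_. a) A \<in> cylinder L G {xvar L} A \<psi>" by (rule subsetD[OF sub])
  then show "a \<in> vset L G \<psi>"
    using sat_iff_holds[OF \<psi> t] by (simp add: cylinder_def mem_tp[OF \<psi>])
qed

definition cylinder_charge where
  "cylinder_charge L G \<mu> A C = \<mu> (SOME \<phi>. \<phi> \<in> xforms L G A \<and> cylinder L G {xvar L} A \<phi> = C)"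

lemma cylinder_charge:
  assumes \<mu>: "\<mu> \<in> keisler L G (univ G)" and A: "A \<subseteq> univ G" and \<phi>: "\<phi> \<in> xforms L G A"
  shows "cylinder_charge L G \<mu> A (cylinder L G {xvar L} A \<phi>) = \<mu> \<phi>"
proof -
  let ?C = "cylinder L G {xvar L} A"
  define \<psi> where "\<psi> = (SOME \<psi>. \<psi> \<in> xforms L G A \<and> ?C \<psi> = ?C \<phi>)"
  have \<psi>: "\<psi> \<in> xforms L G A \<and> ?C \<psi> = ?C \<phi>"
    unfolding \<psi>_def by (rule someI[of _ \<phi>]) (use \<phi> in simp)
  then have "vset L G \<psi> = vset L G \<phi>"
    using vset_subset_of_cylinder[of \<psi> L G A \<phi>] vset_subset_of_cylinder[of \<phi> L G A \<psi>] \<phi> by simp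
  moreover have "xforms L G A \<subseteq> xforms L G (univ G)" by (rule forms_mono[OF subset_refl A])
  ultimately have "\<mu> \<psi> = \<mu> \<phi>" using \<psi> \<phi> by (intro keisler_eqI[OF \<mu>]) auto
  then show ?thesis by (simp add: cylinder_charge_def \<psi>_def)
qed

lemma clopen_charge_types:
  assumes \<mu>: "\<mu> \<in> keisler L G (univ G)" and A: "A \<subseteq> univ G"
  shows "clopen_charge (type_top L G {xvar L} A) (cylinders L G {xvar L} A) (cylinder_charge L G \<mu> A)"
proof -
  let ?C = "cylinder L G {xvar L} A" and ?m = "cylinder_charge L G \<mu> A"
  interpret clopen_base "type_top L G {xvar L} A" "cylinders L G {xvar L} A" by (rule clopen_base_types)
  interpret c: charge "gelems L G" "vsets L G (univ G)" "charge_of L G \<mu>" by (rule charge_charge_of[OF \<mu>])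
  note eq = cylinder_charge[OF \<mu> A]
  have sub: "\<phi> \<in> xforms L G (univ G)" if "\<phi> \<in> xforms L G A" for \<phi>
    using that forms_mono[OF subset_refl A] by (rule subsetD[rotated])
  have m: "?m (?C \<phi>) = charge_of L G \<mu> (vset L G \<phi>)" if "\<phi> \<in> xforms L G A" for \<phi>
    using eq[OF that] charge_of_vset[OF \<mu> sub[OF that]] by simp
  show ?thesis
  proof (intro clopen_charge.intro clopen_base_types charge.intro algebra)
    show "charge_axioms (topspace (type_top L G {xvar L} A)) (cylinders L G {xvar L} A) ?m"
    proof
      fix S T assume "S \<in> cylinders L G {xvar L} A"
      then obtain \<phi> where \<phi>: "S = ?C \<phi>" "\<phi> \<in> xforms L G A" by (elim imageE) (rule that)
      show "0 \<le> ?m S" unfolding \<phi>(1) m[OF \<phi>(2)] using sub[OF \<phi>(2)] by (intro c.nonneg imageI)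
      assume "T \<in> cylinders L G {xvar L} A" and disj: "S \<inter> T = {}"
      then obtain \<psi> where \<psi>: "T = ?C \<psi>" "\<psi> \<in> xforms L G A" by (elim imageE) (rule that)
      have D: "Disj \<phi> \<psi> \<in> xforms L G A" using \<phi>(2) \<psi>(2) by (simp add: forms_connectives)
      have neg: "Neg \<phi> \<in> xforms L G A" "Neg \<psi> \<in> xforms L G A" "Conj (Neg \<phi>) (Neg \<psi>) \<in> xforms L G A"
        using \<phi>(2) \<psi>(2) by (simp_all add: forms_connectives)
      have CD: "?C (Disj \<phi> \<psi>) = S \<union> T"
        using types_Neg[OF _ neg(3)] types_Conj[OF _ neg(1,2)] types_Neg[OF _ \<phi>(2)] types_Neg[OF _ \<psi>(2)]
        unfolding cylinder_def \<phi>(1) \<psi>(1) by auto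
      have "?C \<phi> \<subseteq> ?C (Neg \<psi>)"
        using disj types_Neg[OF _ \<psi>(2)] unfolding \<phi>(1) \<psi>(1) cylinder_def by auto
      from vset_subset_of_cylinder[OF \<phi>(2) neg(2) this]
      have "vset L G \<phi> \<inter> vset L G \<psi> = {}" by (auto simp: vset_simps)
      then have "charge_of L G \<mu> (vset L G \<phi> \<union> vset L G \<psi>) = ?m S + ?m T"
        unfolding \<phi>(1) \<psi>(1) m[OF \<phi>(2)] m[OF \<psi>(2)] using sub[OF \<phi>(2)] sub[OF \<psi>(2)]
        by (intro c.additive imageI)
      moreover have "vset L G (Disj \<phi> \<psi>) = vset L G \<phi> \<union> vset L G \<psi>" by (auto simp: vset_def holds_def)
      ultimately show "?m (S \<union> T) = ?m S + ?m T" using m[OF D] CD by simp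
    next
      have T: "Top \<in> xforms L G A" by (simp add: forms_connectives)
      have "?C Top = topspace (type_top L G {xvar L} A)"
        by (auto simp: cylinder_def types_Neg[OF _ forms_connectives(1)] types_Bot)
      then show "?m (topspace (type_top L G {xvar L} A)) = 1"
        using m[OF T] c.total by (simp add: vset_simps)
    qed
  qed
qed

text \<open>
  The definite description in \<open>borel_ext\<close> is proper.
\<close>

lemma borel_ext:
  assumes \<mu>: "\<mu> \<in> keisler L G (univ G)" and A: "A \<subseteq> univ G"
  shows "regular_borel_prob (type_top L G {xvar L} A) (borel_ext L G \<mu> A)"
    and "\<phi> \<in> xforms L G A \<Longrightarrow> measure (borel_ext L G \<mu> A) (cylinder L G {xvar L} A \<phi>) = \<mu> \<phi>"
    and "regular_borel_prob (type_top L G {xvar L} A) m \<Longrightarrow>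
      (\<And>\<phi>. \<phi> \<in> xforms L G A \<Longrightarrow> measure m (cylinder L G {xvar L} A \<phi>) = \<mu> \<phi>) \<Longrightarrow> borel_ext L G \<mu> A = m"
proof -
  let ?X = "type_top L G {xvar L} A" and ?C = "cylinder L G {xvar L} A"
  let ?Q = "\<lambda>m. regular_borel_prob ?X m \<and> (\<forall>\<phi>\<in>xforms L G A. measure m (?C \<phi>) = \<mu> \<phi>)"
  interpret clopen_charge ?X "cylinders L G {xvar L} A" "cylinder_charge L G \<mu> A"
    by (rule clopen_charge_types[OF \<mu> A])
  obtain n where n: "regular_borel_prob ?X n"
    "\<forall>C\<in>cylinders L G {xvar L} A. measure n C = cylinder_charge L G \<mu> A C"
    using ex_regular_borel_prob by (elim exE conjE) (rule that)
  then have Qn: "?Q n" using cylinder_charge[OF \<mu> A] by simp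
  have uniq: "m = n" if "?Q m" for m
    by (rule regular_borel_prob_unique) (use that Qn in auto)
  have eq: "borel_ext L G \<mu> A = n"
    unfolding borel_ext_def cylinder_def[symmetric] using Qn uniq by (rule the_equality)
  show "regular_borel_prob ?X (borel_ext L G \<mu> A)" unfolding eq by (rule n)
  show "measure (borel_ext L G \<mu> A) (?C \<phi>) = \<mu> \<phi>" if "\<phi> \<in> xforms L G A" for \<phi>
    unfolding eq using Qn that by simp
  show "borel_ext L G \<mu> A = m"
    if "regular_borel_prob ?X m" "\<And>\<phi>. \<phi> \<in> xforms L G A \<Longrightarrow> measure m (?C \<phi>) = \<mu> \<phi>" for m
    unfolding eq by (rule uniq[symmetric]) (use that in simp)
qed

text \<open>
  The support is the complement of the union of all null cylinders.
\<close>

lemma msupport_props: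
  assumes \<mu>: "\<mu> \<in> keisler L G (univ G)" and A: "A \<subseteq> univ G"
  shows "msupport L G \<mu> A \<in> sets (borel_ext L G \<mu> A)"
    and "measure (borel_ext L G \<mu> A) (msupport L G \<mu> A) = 1"
proof -
  let ?X = "type_top L G {xvar L} A" and ?C = "cylinder L G {xvar L} A"
  let ?m = "borel_ext L G \<mu> A"
  note m = borel_ext(1)[OF \<mu> A]
  interpret clopen_charge ?X "cylinders L G {xvar L} A" "cylinder_charge L G \<mu> A"
    by (rule clopen_charge_types[OF \<mu> A])
  interpret p: prob_space ?m by (rule regular_borel_probD(3)[OF m])
  let ?U = "\<Union>{C\<in>cylinders L G {xvar L} A. measure ?m C = 0}"
  have U: "openin ?X ?U" using open_base by (intro openin_Union) auto
  have pos: "\<mu> \<phi> > 0 \<longleftrightarrow> measure ?m (?C \<phi>) \<noteq> 0" if "\<phi> \<in> xforms L G A" for \<phi>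
    using borel_ext(2)[OF \<mu> A that] measure_nonneg[of ?m "?C \<phi>"] by auto
  have supp: "msupport L G \<mu> A = space ?m - ?U"
  proof (rule Set.set_eqI)
    fix p
    have sp: "space ?m = types L G {xvar L} A" using regular_borel_probD(1)[OF m] by simp
    show "p \<in> msupport L G \<mu> A \<longleftrightarrow> p \<in> space ?m - ?U"
    proof (cases "p \<in> types L G {xvar L} A")
      case True
      then have p: "p \<subseteq> xforms L G A" by (simp add: types_def)
      have "(\<forall>\<phi>\<in>p. \<mu> \<phi> > 0) \<longleftrightarrow> (\<forall>\<phi>\<in>xforms L G A. \<phi> \<in> p \<longrightarrow> measure ?m (?C \<phi>) \<noteq> 0)"
        using p pos by blast
      also have "\<dots> \<longleftrightarrow> p \<notin> ?U" using True by (auto simp: cylinder_def)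
      finally show ?thesis using True by (simp add: msupport_def sp)
    qed (simp add: msupport_def sp)
  qed
  have Us: "?U \<in> sets ?m" using borel_of_top_simps(2)[OF U] regular_borel_probD(2)[OF m] by simp
  show "msupport L G \<mu> A \<in> sets ?m" unfolding supp using Us by auto
  show "measure ?m (msupport L G \<mu> A) = 1"
    unfolding supp using p.prob_compl[OF Us] measure_null_clopens[OF m] by simp
qed

section \<open>Changing the parameter set\<close>

lemma types_restrict:
  assumes p: "p \<in> types L G V B" and AB: "A \<subseteq> B"
  shows "p \<inter> forms L G V A \<in> types L G V A"
  unfolding types_def
proof (intro CollectI conjI ballI allI impI)
  fix \<phi> assume \<phi>: "\<phi> \<in> forms L G V A"
  have "\<phi> \<in> forms L G V B" using \<phi> forms_mono[OF subset_refl AB] by (rule subsetD[rotated])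
  then have "\<phi> \<in> p \<or> Neg \<phi> \<in> p" using p by (simp add: types_def)
  then show "\<phi> \<in> p \<inter> forms L G V A \<or> Neg \<phi> \<in> p \<inter> forms L G V A" using \<phi> by (auto simp: forms_connectives)
next
  fix F assume "finite F \<and> F \<subseteq> p \<inter> forms L G V A"
  then show "\<exists>b. tuple G V b \<and> (\<forall>\<phi>\<in>F. sat G b [] \<phi>)" by (intro types_finite_sat[OF p]) auto
qed simp

lemma continuous_map_restrict:
  assumes AB: "A \<subseteq> B"
  shows "continuous_map (type_top L G V B) (type_top L G V A) (\<lambda>p. p \<inter> forms L G V A)"
  unfolding type_top_cylinders[of L G V A]
proof (rule continuous_on_generated_topo)
  show "(\<lambda>p. p \<inter> forms L G V A) ` topspace (type_top L G V B) \<subseteq> \<Union>(cylinders L G V A)"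
  proof
    fix q assume "q \<in> (\<lambda>p. p \<inter> forms L G V A) ` topspace (type_top L G V B)"
    then have "q \<in> topspace (type_top L G V A)" using types_restrict[OF _ AB] by auto
    then show "q \<in> \<Union>(cylinders L G V A)"
      unfolding type_top_cylinders[of L G V A] topology_generated_by_topspace .
  qed
  fix U assume "U \<in> cylinders L G V A"
  then obtain \<phi> where \<phi>: "U = cylinder L G V A \<phi>" "\<phi> \<in> forms L G V A" by (elim imageE) (rule that)
  have "(\<lambda>p. p \<inter> forms L G V A) -` U \<inter> topspace (type_top L G V B) = cylinder L G V B \<phi>"
    using types_restrict[OF _ AB] \<phi> by (auto simp: cylinder_def)
  moreover have "\<phi> \<in> forms L G V B" using \<phi>(2) forms_mono[OF subset_refl AB] by (rule subsetD[rotated])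
  ultimately show "openin (type_top L G V B) ((\<lambda>p. p \<inter> forms L G V A) -` U \<inter> topspace (type_top L G V B))"
    using openin_cylinder by simp
qed

text \<open>
  Restricting types to fewer parameters pushes the Borel measure forward: the image is regular and has the
  right values on cylinders, so uniqueness applies.
\<close>

lemma borel_ext_distr:
  assumes \<mu>: "\<mu> \<in> keisler L G (univ G)" and AB: "A \<subseteq> B" "B \<subseteq> univ G"
  shows "borel_ext L G \<mu> A =
    distr (borel_ext L G \<mu> B) (borel_of_top (type_top L G {xvar L} A)) (\<lambda>p. p \<inter> xforms L G A)"
    and "(\<lambda>p. p \<inter> xforms L G A) \<in> measurable (borel_ext L G \<mu> B) (borel_of_top (type_top L G {xvar L} A))"
proof -
  let ?r = "\<lambda>p. p \<inter> xforms L G A" and ?m = "borel_ext L G \<mu> B"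
  let ?Y = "type_top L G {xvar L} A"
  have A: "A \<subseteq> univ G" using AB by (rule order_trans)
  note m = borel_ext(1)[OF \<mu> AB(2)]
  note cont = continuous_map_restrict[OF AB(1), of L G "{xvar L}"]
  show r: "?r \<in> measurable ?m (borel_of_top ?Y)"
    by (subst measurable_cong_sets[OF regular_borel_probD(2)[OF m] refl])
      (rule continuous_map_measurable[OF cont])
  show "borel_ext L G \<mu> A = distr ?m (borel_of_top ?Y) ?r"
  proof (rule borel_ext(3)[OF \<mu> A])
    show "regular_borel_prob ?Y (distr ?m (borel_of_top ?Y) ?r)"
      by (rule regular_borel_prob_distr[OF m cont compact_space_type_top Hausdorff_space_type_top])
    fix \<phi> assume \<phi>: "\<phi> \<in> xforms L G A"
    then have \<phi>B: "\<phi> \<in> xforms L G B" using forms_mono[OF subset_refl AB(1)] by (rule subsetD[rotated])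
    have sp: "space ?m = types L G {xvar L} B" using regular_borel_probD(1)[OF m] by simp
    have "?r -` cylinder L G {xvar L} A \<phi> \<inter> space ?m = cylinder L G {xvar L} B \<phi>"
      using types_restrict[OF _ AB(1), of _ L G "{xvar L}"] \<phi> by (auto simp: cylinder_def sp)
    then show "measure (distr ?m (borel_of_top ?Y) ?r) (cylinder L G {xvar L} A \<phi>) = \<mu> \<phi>"
      using measure_distr[OF r borel_of_top_simps(2)[OF openin_cylinder[OF \<phi>]]] borel_ext(2)[OF \<mu> AB(2) \<phi>B]
      by simp
  qed
qed

section \<open>Convolution of definable Keisler measures\<close>

text \<open>
  Definability with continuity on the type space replaced by approximation on tuples; over small sets the
  two notions agree, and this one can be used over the whole structure as well.
\<close>

definition uniformly_definable where
  "uniformly_definable L G \<mu> M \<longleftrightarrow>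
     (\<forall>V \<phi>. finite V \<and> xvar L \<notin> V \<and> \<phi> \<in> forms L G (insert (xvar L) V) M \<longrightarrow>
        tmeas (tuples G V) (tsets L G V M) (\<lambda>b. \<mu> (inst V b \<phi>)))"

lemma uniformly_definable_of_definable:
  "definable_over L G \<mu> M \<Longrightarrow> uniformly_definable L G \<mu> M"
  unfolding definable_over_def uniformly_definable_def
  by (intro allI impI, elim allE impE, assumption) (elim exE conjE, rule tmeas_of_continuous, auto)

lemma definable_of_uniformly_definable:
  assumes "sufficiently_saturated L \<kappa> G" "M \<subseteq> univ G" "|M| <o \<kappa>" "uniformly_definable L G \<mu> M"
  shows "definable_over L G \<mu> M"
  unfolding definable_over_def
proof (intro allI impI)
  fix V \<phi> assume "finite V \<and> xvar L \<notin> V \<and> \<phi> \<in> forms L G (insert (xvar L) V) M"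
  then show "\<exists>F. continuous_map (type_top L G V M) euclideanreal F \<and>
             (\<forall>b. tuple G V b \<longrightarrow> \<mu> (inst V b \<phi>) = F (tp L G V b M))"
    using assms(4) unfolding uniformly_definable_def
    by (intro continuous_of_tmeas[OF assms(1-3)]) auto
qed

lemma tmeas_fix_variables:
  assumes h: "tmeas (tuples G (V \<union> W)) (tsets L G (V \<union> W) M) h"
    and c: "tuple G W c" "c ` W \<subseteq> N" and MN: "M \<subseteq> N"
  shows "tmeas (tuples G V) (tsets L G V N) (\<lambda>b. h (\<lambda>z. if z \<in> W then c z else b z))"
proof (rule tmeas_compose[OF h])
  let ?m = "\<lambda>b z. if z \<in> W then c z else b z"
  have tup: "tuple G (V \<union> W) (?m b)" if "tuple G V b" for b
    using that c(1) by (auto simp: tuple_def)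
  then show "?m b \<in> tuples G (V \<union> W)" if "b \<in> tuples G V" for b using that by simp
  fix A assume "A \<in> tsets L G (V \<union> W) M"
  then obtain \<phi> where \<phi>: "A = tset G (V \<union> W) \<phi>" "\<phi> \<in> forms L G (V \<union> W) M"
    by (elim imageE) (rule that)
  have "inst W c \<phi> \<in> forms L G V (M \<union> c ` W)" by (rule inst_forms[OF \<phi>(2) c(1)])
  moreover have "forms L G V (M \<union> c ` W) \<subseteq> forms L G V N" using c(2) MN by (intro forms_mono) auto
  ultimately have "inst W c \<phi> \<in> forms L G V N" by (rule subsetD[rotated])
  moreover have "b \<in> tset G V (inst W c \<phi>) \<longleftrightarrow> ?m b \<in> A" if "b \<in> tuples G V" for b
    using tup[of b] that unfolding \<phi>(1) by (simp add: tset_def sat_inst)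
  ultimately show "\<exists>B\<in>tsets L G V N. \<forall>b\<in>tuples G V. b \<in> B \<longleftrightarrow> ?m b \<in> A"
    by (intro bexI[of _ "tset G V (inst W c \<phi>)"]) simp_all
qed

text \<open>
  The additional parameters are made variables, and these are then fixed again.
\<close>

lemma uniformly_definable_mono:
  assumes \<mu>: "uniformly_definable L G \<mu> M" and MN: "M \<subseteq> N" "N \<subseteq> univ G"
  shows "uniformly_definable L G \<mu> N"
  unfolding uniformly_definable_def
proof (intro allI impI)
  fix V \<phi> assume "finite V \<and> xvar L \<notin> V \<and> \<phi> \<in> forms L G (insert (xvar L) V) N"
  then have V: "finite V" "xvar L \<notin> V" and \<phi>: "\<phi> \<in> forms L G (insert (xvar L) V) N" by auto
  have "finite (insert (xvar L) V)" using V(1) by simp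
  from ex_generalisation[OF \<phi> MN(2) this] obtain W c \<phi>0 where
    W: "finite W" "W \<inter> insert (xvar L) V = {}" "\<phi>0 \<in> forms L G (insert (xvar L) V \<union> W) {}"
    and c: "tuple G W c" "c ` W \<subseteq> N" and inst0: "inst W c \<phi>0 = \<phi>" by (elim exE conjE) (rule that)
  have "\<phi>0 \<in> forms L G (insert (xvar L) (V \<union> W)) M"
    using W(3) forms_mono[of "insert (xvar L) V \<union> W" "insert (xvar L) (V \<union> W)" "{}" M L G] by auto
  then have "tmeas (tuples G (V \<union> W)) (tsets L G (V \<union> W) M) (\<lambda>b. \<mu> (inst (V \<union> W) b \<phi>0))"
    using \<mu> V W unfolding uniformly_definable_def by auto
  from tmeas_fix_variables[OF this c MN(1)]
  have "tmeas (tuples G V) (tsets L G V N) (\<lambda>b. \<mu> (inst (V \<union> W) (\<lambda>z. if z \<in> W then c z else b z) \<phi>0))" .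
  moreover have "inst (V \<union> W) (\<lambda>z. if z \<in> W then c z else b z) \<phi>0 = inst V b \<phi>" for b
  proof -
    have eq: "(\<lambda>z. subst_trm (\<lambda>z. if z \<in> V then Par (b z) else Free z) (if z \<in> W then Par (c z) else Free z))
      = (\<lambda>z. if z \<in> V \<union> W then Par (if z \<in> W then c z else b z) else Free z)"
      by (auto simp: fun_eq_iff)
    show ?thesis unfolding inst0[symmetric] unfolding inst_def subst_comp eq ..
  qed
  ultimately show "tmeas (tuples G V) (tsets L G V N) (\<lambda>b. \<mu> (inst V b \<phi>))" by simp
qed

section \<open>Convolution as an integral over group elements\<close>

locale monster_group =
  fixes L :: "('s, 'f, 'r) lang" and G :: "('s, 'f, 'r, 'a) struc" and \<kappa> :: "'k rel"
  assumes struc: "is_struc L G" and grp: "expands_group L G"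
    and sat: "sufficiently_saturated L \<kappa> G"
begin

abbreviation "X \<equiv> gelems L G"
abbreviation "mul a b \<equiv> fun_in G (gmul L) [a, b]"

lemma mul_ty: "fun_ty L (gmul L) = Some ([gsort L, gsort L], gsort L)"
  using grp by (simp add: expands_group_def)

lemma vset_translate:
  assumes \<phi>: "\<phi> \<in> xforms L G A" and d: "d \<in> X"
  shows "translate L d \<phi> \<in> xforms L G (insert d A)"
    and "vset L G (translate L d \<phi>) = {x\<in>X. mul x d \<in> vset L G \<phi>}"
proof -
  have ok: "trm_ok L G \<Gamma> (App (gmul L) [Free (xvar L), Par d]) (gsort L)" for \<Gamma>
    using trm_ok.intros(1)[of L G \<Gamma> "xvar L"] trm_ok.intros(3)[of L G \<Gamma> d] d
    by (intro trm_ok.intros(4)[OF mul_ty]) (auto simp: xvar_def gelems_def)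
  show "translate L d \<phi> \<in> xforms L G (insert d A)"
    unfolding translate_def by (rule forms_subst[OF \<phi>]) (use ok in \<open>auto simp: xvar_def\<close>)
  have "holds G x (translate L d \<phi>) \<longleftrightarrow> holds G (mul x d) \<phi>" for x
    unfolding holds_def translate_def
    by (rule sat_subst) (use \<phi> in \<open>auto simp: forms_def\<close>)
  moreover have "mul x d \<in> X" if "x \<in> X" for x
    using that d grp group.is_monoid monoid.m_closed unfolding expands_group_def gelems_def by fastforce
  ultimately show "vset L G (translate L d \<phi>) = {x\<in>X. mul x d \<in> vset L G \<phi>}"
    by (auto simp: vset_def)
qed

sublocale definable_semigroup X "vsets L G (univ G)" "\<lambda>a b. mul a b"
proof (intro definable_semigroup.intro algebra_vsets definable_semigroup_axioms.intro)
  obtain e where "group \<lparr>carrier = {a\<in>univ G. srt G a = gsort L}, mult = (\<lambda>a b. mul a b), one = e\<rparr>"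
    using grp unfolding expands_group_def by blast
  then interpret g: group "\<lparr>carrier = {a\<in>univ G. srt G a = gsort L}, mult = (\<lambda>a b. mul a b), one = e\<rparr>" .
  show "mul x y \<in> X" if "x \<in> X" "y \<in> X" for x y
    using g.m_closed[of x y] that by (simp add: gelems_def)
  show "mul (mul x y) z = mul x (mul y z)" if "x \<in> X" "y \<in> X" "z \<in> X" for x y z
    using g.m_assoc[of x y z] that by (simp add: gelems_def)
  fix A d assume A: "A \<in> vsets L G (univ G)" and d: "d \<in> X"
  obtain \<phi> where \<phi>: "A = vset L G \<phi>" "\<phi> \<in> xforms L G (univ G)" using A by (elim imageE) (rule that)
  have "insert d (univ G) = univ G" using d by (auto simp: gelems_def)
  then show "{x\<in>X. mul x d \<in> A} \<in> vsets L G (univ G)"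
    using vset_translate[OF \<phi>(2) d] unfolding \<phi>(1) by (metis imageI)
qed

text \<open>
  The formula \<open>\<phi>(x \<cdot> y)\<close> with a variable \<open>y\<close> for the second factor.
\<close>

lemma sum_subst:
  assumes \<phi>: "\<phi> \<in> forms L G (insert (xvar L) V) M" and y: "y \<notin> insert (xvar L) V" "fst y = gsort L"
  defines "\<phi>' \<equiv> subst (\<lambda>z. if z = xvar L then App (gmul L) [Free (xvar L), Free y] else Free z) \<phi>"
  shows "\<phi>' \<in> forms L G (insert (xvar L) (insert y V)) M"
    and "xvar L \<notin> V \<Longrightarrow> inst (insert y V) (b(y := d)) \<phi>' = translate L d (inst V b \<phi>)"
proof -
  have ok: "trm_ok L G \<Gamma> (App (gmul L) [Free (xvar L), Free y]) (gsort L)" for \<Gamma>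
    using trm_ok.intros(1)[of L G \<Gamma> "xvar L"] trm_ok.intros(1)[of L G \<Gamma> y] y(2)
    by (intro trm_ok.intros(4)[OF mul_ty]) (auto simp: xvar_def)
  show "\<phi>' \<in> forms L G (insert (xvar L) (insert y V)) M"
    unfolding \<phi>'_def
    by (rule forms_subst[OF \<phi>]) (use ok trm_ok.intros(1)[of L G] in \<open>auto simp: xvar_def\<close>)
  show "inst (insert y V) (b(y := d)) \<phi>' = translate L d (inst V b \<phi>)" if "xvar L \<notin> V"
    unfolding \<phi>'_def inst_def translate_def subst_comp
    by (rule subst_cong) (use \<phi> y(1) that in \<open>auto simp: forms_def\<close>)
qed

lemma tmeas_translate_measure:
  assumes \<mu>: "uniformly_definable L G \<mu> N" and \<phi>: "\<phi> \<in> xforms L G N"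
  shows "tmeas X (vsets L G N) (\<lambda>d. \<mu> (translate L d \<phi>))"
proof -
  define y where "y = (gsort L, 1::nat)"
  have y: "y \<notin> insert (xvar L) {}" "fst y = gsort L" by (auto simp: y_def xvar_def)
  let ?\<phi>' = "subst (\<lambda>z. if z = xvar L then App (gmul L) [Free (xvar L), Free y] else Free z) \<phi>"
  have "tmeas (tuples G {y}) (tsets L G {y} N) (\<lambda>b. \<mu> (inst {y} b ?\<phi>'))"
    using \<mu> sum_subst(1)[OF \<phi> y] y(1) unfolding uniformly_definable_def by auto
  then have "tmeas X (vsets L G N) (\<lambda>d. \<mu> (inst {y} ((\<lambda>_. d)(y := d)) ?\<phi>'))"
  proof (rule tmeas_compose)
    show "(\<lambda>_. d)(y := d) \<in> tuples G {y}" if "d \<in> X" for d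
      using that by (auto simp: tuple_def y_def gelems_def)
    fix A assume "A \<in> tsets L G {y} N"
    then obtain \<psi> where \<psi>: "A = tset G {y} \<psi>" "\<psi> \<in> forms L G {y} N" by (elim imageE) (rule that)
    let ?\<psi>' = "subst (\<lambda>_. Free (xvar L)) \<psi>"
    have "?\<psi>' \<in> xforms L G N"
      by (rule forms_subst[OF \<psi>(2)]) (use trm_ok.intros(1)[of L G _ "xvar L"] in \<open>auto simp: y_def xvar_def\<close>)
    moreover have "x \<in> vset L G ?\<psi>' \<longleftrightarrow> (\<lambda>_. x)(y := x) \<in> A" if "x \<in> X" for x
    proof -
      have "sat G (\<lambda>_. x) [] ?\<psi>' \<longleftrightarrow> sat G (\<lambda>_. x) [] \<psi>" by (rule sat_subst) auto
      then show ?thesis using that unfolding \<psi>(1)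
        by (auto simp: vset_def holds_def tset_def tuple_def gelems_def y_def fun_upd_idem)
    qed
    ultimately show "\<exists>B\<in>vsets L G N. \<forall>x\<in>X. x \<in> B \<longleftrightarrow> (\<lambda>_. x)(y := x) \<in> A" by auto
  qed
  moreover have "inst {} b \<phi> = \<phi>" for b
  proof -
    have "subst_trm Free t = t" for t :: "('s, 'f, 'a) trm" by (induction t) (auto intro: map_idI)
    then have "subst Free \<psi> = \<psi>" for \<psi> :: "('s, 'f, 'r, 'a) fm" by (induction \<psi>) (auto intro: map_idI)
    then show ?thesis by (simp add: inst_def)
  qed
  ultimately show ?thesis using sum_subst(2)[OF \<phi> y] by simp
qed

lemma definable_charge_of:
  assumes \<mu>: "\<mu> \<in> keisler L G (univ G)" "uniformly_definable L G \<mu> M" "M \<subseteq> univ G"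
  shows "definable_charge (charge_of L G \<mu>)"
  unfolding definable_charge_def
proof (intro conjI ballI)
  show "charge X (vsets L G (univ G)) (charge_of L G \<mu>)" by (rule charge_charge_of[OF \<mu>(1)])
  fix A assume "A \<in> vsets L G (univ G)"
  then obtain \<phi> where \<phi>: "A = vset L G \<phi>" "\<phi> \<in> xforms L G (univ G)" by (elim imageE) (rule that)
  have "charge_of L G \<mu> {x\<in>X. mul x d \<in> A} = \<mu> (translate L d \<phi>)" if d: "d \<in> X" for d
  proof -
    have "insert d (univ G) = univ G" using d by (auto simp: gelems_def)
    then have "translate L d \<phi> \<in> xforms L G (univ G)" using vset_translate(1)[OF \<phi>(2) d] by simp
    from charge_of_vset[OF \<mu>(1) this] show ?thesis unfolding vset_translate(2)[OF \<phi>(2) d] \<phi>(1) .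
  qed
  moreover have "tmeas X (vsets L G (univ G)) (\<lambda>d. \<mu> (translate L d \<phi>))"
    by (rule tmeas_translate_measure[OF uniformly_definable_mono[OF \<mu>(2,3) subset_refl] \<phi>(2)])
  ultimately show "tmeas X (vsets L G (univ G)) (\<lambda>d. charge_of L G \<mu> {x\<in>X. mul x d \<in> A})"
    by (subst tmeas_cong) auto
qed

lemma conv_charge_of:
  assumes \<mu>: "\<mu> \<in> keisler L G (univ G)" and \<nu>: "\<nu> \<in> keisler L G (univ G)" and \<phi>: "\<phi> \<in> xforms L G (univ G)"
  shows "conv (charge_of L G \<mu>) (charge_of L G \<nu>) (vset L G \<phi>)
    = fint X (vsets L G (univ G)) (charge_of L G \<nu>) (\<lambda>d. \<mu> (translate L d \<phi>))"
proof -
  interpret \<nu>: charge X "vsets L G (univ G)" "charge_of L G \<nu>" by (rule charge_charge_of[OF \<nu>])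
  show ?thesis unfolding conv_def
  proof (rule \<nu>.fint_cong)
    fix d assume d: "d \<in> X"
    then have "insert d (univ G) = univ G" by (auto simp: gelems_def)
    then have "translate L d \<phi> \<in> xforms L G (univ G)" using vset_translate(1)[OF \<phi> d] by simp
    from charge_of_vset[OF \<mu> this]
    show "charge_of L G \<mu> {x\<in>X. mul x d \<in> vset L G \<phi>} = \<mu> (translate L d \<phi>)"
      unfolding vset_translate(2)[OF \<phi> d] .
  qed
qed

lemma tp_of_realisation:
  assumes q: "q \<in> xtypes L G N" and d: "realises L G d q"
  shows "q = tp L G {xvar L} (\<lambda>_. d) N" "tuple G {xvar L} (\<lambda>_. d)"
proof -
  show t: "tuple G {xvar L} (\<lambda>_. d)" using d by (simp add: realises_def tuple_def xvar_def gelems_def)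
  have q': "q \<subseteq> xforms L G N" using q by (simp add: types_def)
  have "\<psi> \<in> q \<longleftrightarrow> sat G (\<lambda>_. d) [] \<psi>" if \<psi>: "\<psi> \<in> xforms L G N" for \<psi>
  proof
    assume "\<psi> \<in> q"
    then show "sat G (\<lambda>_. d) [] \<psi>" using d by (simp add: realises_def holds_def)
  next
    assume s: "sat G (\<lambda>_. d) [] \<psi>"
    show "\<psi> \<in> q"
    proof (rule ccontr)
      assume "\<psi> \<notin> q"
      then have "Neg \<psi> \<in> q" using types_Neg[OF q \<psi>] by simp
      then have "holds G d (Neg \<psi>)" using d by (simp add: realises_def)
      then show False using s by (simp add: holds_def)
    qed
  qed
  then show "q = tp L G {xvar L} (\<lambda>_. d) N" using q' by (auto simp: tp_def)
qed

lemma ex_realisation: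
  assumes "N \<subseteq> univ G" "|N| <o \<kappa>" "q \<in> xtypes L G N"
  shows "\<exists>d. realises L G d q"
proof -
  obtain b where b: "tuple G {xvar L} b" "q = tp L G {xvar L} b N"
    using saturatedD[OF sat assms(1,2) _ assms(3)] by auto
  have "holds G (b (xvar L)) \<psi>" if "\<psi> \<in> q" for \<psi>
  proof -
    have "\<psi> \<in> xforms L G N" "sat G b [] \<psi>" using that b(2) by (auto simp: tp_def)
    then show ?thesis using sat_iff_holds[OF _ b(1)] by (auto simp: vset_def)
  qed
  moreover have "b (xvar L) \<in> X" using b(1) by (simp add: tuple_def gelems_def xvar_def)
  ultimately show ?thesis unfolding realises_def by blast
qed

text \<open>
  Over a small elementary submodel that contains \<open>M\<close> and the parameters, the fibre function is continuous.
\<close>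

lemma star_borel_of_definable:
  assumes \<mu>: "uniformly_definable L G \<mu> M" and M: "M \<subseteq> univ G" "|M| <o \<kappa>"
  shows "star_borel L \<kappa> G \<mu> \<nu>"
  unfolding star_borel_def
proof
  fix \<phi> assume \<phi>: "\<phi> \<in> xforms L G (univ G)"
  have "M \<union> params \<phi> \<subseteq> univ G" using M(1) \<phi> by (auto simp: forms_def)
  moreover have "|M \<union> params \<phi>| <o \<kappa>"
    by (rule small_Un[OF sat M(2) small_finite[OF sat finite_params]])
  ultimately obtain N where N: "elem_substruc L G N" "M \<union> params \<phi> \<subseteq> N" "|N| <o \<kappa>"
    using ex_small_elem_substruc[OF struc sat] by meson
  have Nu: "N \<subseteq> univ G" using N(1) by (simp add: elem_substruc_def)
  have \<phi>N: "\<phi> \<in> xforms L G N" using \<phi> N(2) by (auto simp: forms_def)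
  have MN: "M \<subseteq> N" using N(2) by simp
  have "tmeas X (vsets L G N) (\<lambda>d. \<mu> (translate L d \<phi>))"
    by (rule tmeas_translate_measure[OF uniformly_definable_mono[OF \<mu> MN Nu] \<phi>N])
  then have "tmeas (tuples G {xvar L}) (tsets L G {xvar L} N) (\<lambda>b. \<mu> (translate L (b (xvar L)) \<phi>))"
  proof (rule tmeas_compose)
    show "b (xvar L) \<in> X" if "b \<in> tuples G {xvar L}" for b
      using that by (simp add: tuple_def gelems_def xvar_def)
    fix A assume "A \<in> vsets L G N"
    then obtain \<psi> where \<psi>: "A = vset L G \<psi>" "\<psi> \<in> xforms L G N" by (elim imageE) (rule that)
    have "b \<in> tset G {xvar L} \<psi> \<longleftrightarrow> b (xvar L) \<in> A" if "b \<in> tuples G {xvar L}" for b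
      using sat_iff_holds[OF \<psi>(2), of b] that unfolding \<psi>(1) by (simp add: tset_def)
    then show "\<exists>B\<in>tsets L G {xvar L} N. \<forall>b\<in>tuples G {xvar L}. b \<in> B \<longleftrightarrow> b (xvar L) \<in> A"
      using \<psi>(2) by auto
  qed
  from continuous_of_tmeas[OF sat Nu N(3) _ this] obtain F where
    F: "continuous_map (type_top L G {xvar L} N) euclideanreal F"
      "\<And>b. tuple G {xvar L} b \<Longrightarrow> \<mu> (translate L (b (xvar L)) \<phi>) = F (tp L G {xvar L} b N)"
    by auto
  have val: "\<mu> (translate L d \<phi>) = F q" if "q \<in> xtypes L G N" "realises L G d q" for d q
    using F(2)[OF tp_of_realisation(2)[OF that]] tp_of_realisation(1)[OF that] by simp
  have fibre: "fibre L G \<mu> \<phi> q = F q" if q: "q \<in> xtypes L G N" for q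
    unfolding fibre_def by (rule val[OF q]) (rule someI_ex[OF ex_realisation[OF Nu N(3) q]])
  let ?Y = "subtopology (type_top L G {xvar L} N) (msupport L G \<nu> N)"
  have "F \<in> borel_measurable (borel_of_top ?Y)"
    by (rule continuous_map_borel_measurable[OF continuous_map_from_subtopology[OF F(1)]])
  then have "fibre L G \<mu> \<phi> \<in> borel_measurable (borel_of_top ?Y)"
    by (subst measurable_cong[of _ _ F]) (auto simp: borel_of_top_simps(1) fibre)
  moreover have "\<mu> (translate L d \<phi>) = fibre L G \<mu> \<phi> q"
    if "q \<in> msupport L G \<nu> N" "realises L G d q" for q d
    using that val fibre by (simp add: msupport_def)
  ultimately show "\<exists>N. admissible L \<kappa> G \<mu> \<nu> \<phi> N"
    using N by (intro exI[of _ N]) (simp add: admissible_def)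
qed

text \<open>
  An admissible \<open>N\<close> need not contain the set \<open>M\<close> over which \<open>\<mu>\<close> is definable. Pull the integral back to
  types over \<open>N \<union> M\<close>. For a type \<open>q\<close> in the support there, realised by \<open>d\<close>, the restriction of \<open>q\<close> to \<open>N\<close> lies in
  the support over \<open>N\<close> and is realised by \<open>d\<close> too, so the fibre function has the value \<open>\<mu> (\<phi>(x \<cdot> d))\<close> there. This value is
  uniformly close to a step function given by formulas over \<open>N \<union> M\<close>, and step functions have the same
  integral on both sides.
\<close>

lemma integral_fibre:
  assumes \<mu>: "uniformly_definable L G \<mu> M" and M: "M \<subseteq> univ G" "|M| <o \<kappa>"
    and \<nu>: "\<nu> \<in> keisler L G (univ G)" and N: "admissible L \<kappa> G \<mu> \<nu> \<phi> N"
    and \<phi>: "\<phi> \<in> xforms L G (univ G)"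
  shows "(LINT q | restrict_space (borel_ext L G \<nu> N) (msupport L G \<nu> N). fibre L G \<mu> \<phi> q)
    = fint X (vsets L G (univ G)) (charge_of L G \<nu>) (\<lambda>d. \<mu> (translate L d \<phi>))"
proof -
  \<comment> \<open>a mere parameter set, not a model: types and their Borel measures exist over any set\<close>
  define B where "B = N \<union> M"
  have Nu: "N \<subseteq> univ G" and small: "|N| <o \<kappa>" and par: "params \<phi> \<subseteq> N"
    and inv: "\<And>q d. q \<in> msupport L G \<nu> N \<Longrightarrow> realises L G d q \<Longrightarrow> \<mu> (translate L d \<phi>) = fibre L G \<mu> \<phi> q"
    and meas: "fibre L G \<mu> \<phi> \<in> borel_measurable
       (borel_of_top (subtopology (type_top L G {xvar L} N) (msupport L G \<nu> N)))"
    using N unfolding admissible_def elem_substruc_def by auto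
  have Bu: "B \<subseteq> univ G" and NB: "N \<subseteq> B" and MB: "M \<subseteq> B" using Nu M(1) by (auto simp: B_def)
  have smallB: "|B| <o \<kappa>" unfolding B_def by (rule small_Un[OF sat small M(2)])
  let ?f = "\<lambda>d. \<mu> (translate L d \<phi>)" and ?A = "vsets L G (univ G)"
  let ?m = "borel_ext L G \<nu> N" and ?m' = "borel_ext L G \<nu> B" and ?r = "\<lambda>p. p \<inter> xforms L G N"
  let ?S = "msupport L G \<nu> N" and ?S' = "msupport L G \<nu> B"
  let ?C = "cylinder L G {xvar L} B"
  interpret \<nu>: charge X ?A "charge_of L G \<nu>" by (rule charge_charge_of[OF \<nu>])
  note m = borel_ext(1)[OF \<nu> Nu] and m' = borel_ext(1)[OF \<nu> Bu]
  interpret p: prob_space ?m' by (rule regular_borel_probD(3)[OF m'])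
  have \<phi>B: "\<phi> \<in> xforms L G B" using \<phi> par NB by (auto simp: forms_def)
  have f: "tmeas X (vsets L G B) ?f"
    by (rule tmeas_translate_measure[OF uniformly_definable_mono[OF \<mu> MB Bu] \<phi>B])
  have BA: "vsets L G B \<subseteq> ?A" by (intro image_mono forms_mono subset_refl Bu)
  define g where "g q = indicat_real ?S q *\<^sub>R fibre L G \<mu> \<phi> q" for q
  have S: "?S \<inter> space ?m \<in> sets ?m" using msupport_props(1)[OF \<nu> Nu] by auto
  have "(\<lambda>q. q) \<in> measurable (restrict_space ?m ?S)
      (borel_of_top (subtopology (type_top L G {xvar L} N) ?S))"
  proof (rule measurable_borel_of_topI)
    have sp: "space ?m = types L G {xvar L} N" using regular_borel_probD(1)[OF m] by simp
    show "(\<lambda>q. q) \<in> space (restrict_space ?m ?S) \<rightarrow> topspace (subtopology (type_top L G {xvar L} N) ?S)"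
      by (auto simp: space_restrict_space sp)
    fix U assume "openin (subtopology (type_top L G {xvar L} N) ?S) U"
    then obtain T where T: "openin (type_top L G {xvar L} N) T" "U = T \<inter> ?S" by (auto simp: openin_subtopology)
    have "T \<in> sets ?m" using borel_of_top_simps(2)[OF T(1)] regular_borel_probD(2)[OF m] by simp
    then have "?S \<inter> T \<in> sets (restrict_space ?m ?S)" by (auto simp: sets_restrict_space)
    moreover have "(\<lambda>q. q) -` U \<inter> space (restrict_space ?m ?S) = ?S \<inter> T"
      using openin_subset[OF T(1)] by (auto simp: T(2) space_restrict_space sp)
    ultimately show "(\<lambda>q. q) -` U \<inter> space (restrict_space ?m ?S) \<in> sets (restrict_space ?m ?S)" by simp
  qed
  from measurable_compose[OF this meas]
  have "fibre L G \<mu> \<phi> \<in> borel_measurable (restrict_space ?m ?S)" .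
  then have g: "g \<in> borel_measurable ?m"
    unfolding g_def using borel_measurable_restrict_space_iff[OF S] by blast
  have sets_m: "sets ?m = sets (borel_of_top (type_top L G {xvar L} N))"
    by (rule regular_borel_probD(2)[OF m])
  have g': "g \<in> borel_measurable (borel_of_top (type_top L G {xvar L} N))"
    using g by (subst measurable_cong_sets[OF sets_m[symmetric] refl])
  have gr: "(\<lambda>q. g (?r q)) \<in> borel_measurable ?m'"
    by (rule measurable_compose[OF borel_ext_distr(2)[OF \<nu> NB Bu] g'])
  have I: "(LINT q | restrict_space ?m ?S. fibre L G \<mu> \<phi> q) = (LINT q | ?m'. g (?r q))"
  proof -
    have "(LINT q | restrict_space ?m ?S. fibre L G \<mu> \<phi> q) = (LINT q | ?m. g q)"
      unfolding g_def by (rule integral_restrict_space[OF S])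
    also have "\<dots> = (LINT q | distr ?m' (borel_of_top (type_top L G {xvar L} N)) ?r. g q)"
      by (subst borel_ext_distr(1)[OF \<nu> NB Bu]) (rule refl)
    also have "\<dots> = (LINT q | ?m'. g (?r q))"
      by (rule integral_distr[OF borel_ext_distr(2)[OF \<nu> NB Bu] g'])
    finally show ?thesis .
  qed
  have lift: "\<exists>d\<in>X. g (?r q) = ?f d \<and> (\<forall>\<psi>\<in>xforms L G B. q \<in> ?C \<psi> \<longleftrightarrow> d \<in> vset L G \<psi>)" if "q \<in> ?S'" for q
  proof -
    have q: "q \<in> xtypes L G B" and pos: "\<And>\<psi>. \<psi> \<in> q \<Longrightarrow> \<nu> \<psi> > 0" using that by (auto simp: msupport_def)
    obtain d where d: "realises L G d q" using ex_realisation[OF Bu smallB q] by blast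
    have dr: "realises L G d (?r q)" using d by (auto simp: realises_def)
    have rS: "?r q \<in> ?S" using types_restrict[OF q NB] pos by (auto simp: msupport_def)
    have "g (?r q) = ?f d" using inv[OF rS dr] rS by (simp add: g_def)
    moreover have "q \<in> ?C \<psi> \<longleftrightarrow> d \<in> vset L G \<psi>" if \<psi>: "\<psi> \<in> xforms L G B" for \<psi>
    proof -
      have "q \<in> ?C \<psi> \<longleftrightarrow> \<psi> \<in> tp L G {xvar L} (\<lambda>_. d) B"
        using q tp_of_realisation(1)[OF q d] by (simp add: cylinder_def)
      then show ?thesis
        using mem_tp[OF \<psi>] sat_iff_holds[OF \<psi> tp_of_realisation(2)[OF q d]] by simp
    qed
    moreover have "d \<in> X" using d by (simp add: realises_def)
    ultimately show ?thesis by blast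
  qed
  have AE_S': "AE q in ?m'. q \<in> ?S'"
    using msupport_props[OF \<nu> Bu] p.prob_eq_1 by blast
  have "\<bar>(LINT q | ?m'. g (?r q)) - fint X ?A (charge_of L G \<nu>) ?f\<bar> \<le> e" if "e > 0" for e
  proof -
    interpret algB: algebra X "vsets L G B" by (rule algebra_vsets)
    have "e / 2 > 0" using that by simp
    then obtain P c where P: "finite P" "P \<subseteq> vsets L G B"
      "\<And>x. x \<in> X \<Longrightarrow> \<bar>?f x - (\<Sum>S\<in>P. c S * indicator S x)\<bar> \<le> e / 2"
      by (rule algB.tmeas_step[OF f]) (rule that)
    have "\<forall>S\<in>P. \<exists>\<psi>. \<psi> \<in> xforms L G B \<and> S = vset L G \<psi>" using P(2) by auto
    from bchoice[OF this] obtain fm where fm: "\<And>S. S \<in> P \<Longrightarrow> fm S \<in> xforms L G B \<and> S = vset L G (fm S)"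
      by auto
    define s where "s q = (\<Sum>S\<in>P. c S * indicat_real (?C (fm S)) q)" for q
    have C_sets: "?C (fm S) \<in> sets ?m'" if "S \<in> P" for S
      using borel_of_top_simps(2)[OF openin_cylinder[OF conjunct1[OF fm[OF that]]]]
        regular_borel_probD(2)[OF m'] by simp
    have int_c: "integrable ?m' (\<lambda>q. c S * indicat_real (?C (fm S)) q)" if "S \<in> P" for S
      using C_sets[OF that] by (intro integrable_mult_right integrable_real_indicator) (simp_all add: p.emeasure_eq_measure)
    have int_s: "integrable ?m' s" unfolding s_def by (intro Bochner_Integration.integrable_sum int_c)
    have "(LINT q | ?m'. s q) = (\<Sum>S\<in>P. c S * charge_of L G \<nu> S)"
      unfolding s_def
    proof (subst Bochner_Integration.integral_sum[OF int_c], assumption, rule sum.cong[OF refl])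
      fix S assume S: "S \<in> P"
      have "measure ?m' (?C (fm S)) = \<nu> (fm S)" using borel_ext(2)[OF \<nu> Bu] fm[OF S] by blast
      also have "\<dots> = charge_of L G \<nu> S"
      proof -
        have "fm S \<in> xforms L G (univ G)" using fm[OF S] forms_mono[OF subset_refl Bu] by blast
        from charge_of_vset[OF \<nu> this] show ?thesis using fm[OF S] by simp
      qed
      finally show "(LINT q | ?m'. c S * indicat_real (?C (fm S)) q) = c S * charge_of L G \<nu> S"
        using C_sets[OF S] sets.sets_into_space[OF C_sets[OF S]] by (simp add: Int_absorb2)
    qed
    moreover have "\<bar>fint X ?A (charge_of L G \<nu>) ?f - (\<Sum>S\<in>P. c S * charge_of L G \<nu> S)\<bar> \<le> e / 2"
    proof -
      have "\<bar>fint X ?A (charge_of L G \<nu>) ?f - (\<Sum>S\<in>P. c S * fint X ?A (charge_of L G \<nu>) (indicator S))\<bar> \<le> e / 2"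
        by (rule mean_step_close[OF \<nu>.mean_fint tmeas_mono[OF f BA] P(1)]) (use P(2) BA in blast, rule P(3))
      moreover have "(\<Sum>S\<in>P. c S * fint X ?A (charge_of L G \<nu>) (indicator S)) = (\<Sum>S\<in>P. c S * charge_of L G \<nu> S)"
        using P(2) BA by (intro sum.cong refl) (simp add: \<nu>.fint_indicator subset_iff)
      ultimately show ?thesis by simp
    qed
    moreover have "\<bar>(LINT q | ?m'. g (?r q)) - (LINT q | ?m'. s q)\<bar> \<le> e / 2"
    proof -
      have close: "\<bar>g (?r q) - s q\<bar> \<le> e / 2" if q: "q \<in> ?S'" for q
      proof -
        obtain d where d: "d \<in> X" "g (?r q) = ?f d"
          "\<forall>\<psi>\<in>xforms L G B. q \<in> ?C \<psi> \<longleftrightarrow> d \<in> vset L G \<psi>" using lift[OF q] by blast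
        have "s q = (\<Sum>S\<in>P. c S * indicator S d)"
          unfolding s_def
        proof (rule sum.cong[OF refl])
          fix S assume "S \<in> P"
          then have "q \<in> ?C (fm S) \<longleftrightarrow> d \<in> S" using fm d(3) by metis
          then show "c S * indicat_real (?C (fm S)) q = c S * indicator S d" by (simp add: indicator_def)
        qed
        then show ?thesis using P(3)[OF d(1)] d(2) by simp
      qed
      have s_bound: "\<bar>s q\<bar> \<le> (\<Sum>S\<in>P. \<bar>c S\<bar>)" for q
        unfolding s_def by (intro order_trans[OF sum_abs] sum_mono) (auto simp: abs_mult indicator_def)
      have "integrable ?m' (\<lambda>q. g (?r q))"
      proof (rule p.integrable_const_bound[OF _ gr])
        show "AE q in ?m'. norm (g (?r q)) \<le> (\<Sum>S\<in>P. \<bar>c S\<bar>) + e / 2"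
        proof (rule AE_mp[OF AE_S'], intro AE_I2 impI)
          fix q assume "q \<in> ?S'"
          from close[OF this] s_bound[of q]
          show "norm (g (?r q)) \<le> (\<Sum>S\<in>P. \<bar>c S\<bar>) + e / 2" unfolding real_norm_def by linarith
        qed
      qed
      note int = this int_s
      have le1: "(LINT q | ?m'. g (?r q)) \<le> (LINT q | ?m'. s q + e / 2)"
        by (rule integral_mono_AE[OF int(1)])
           (use int(2) in simp, rule AE_mp[OF AE_S'], intro AE_I2 impI, drule close, linarith)
      have le2: "(LINT q | ?m'. s q) \<le> (LINT q | ?m'. g (?r q) + e / 2)"
        by (rule integral_mono_AE[OF int(2)])
           (use int(1) in simp, rule AE_mp[OF AE_S'], intro AE_I2 impI, drule close, linarith)
      have const: "(LINT q | ?m'. h q + e / 2) = (LINT q | ?m'. h q) + e / 2" if "integrable ?m' h" for h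
        using that p.prob_space by simp
      show ?thesis using le1 le2 unfolding const[OF int(1)] const[OF int(2)] by linarith
    qed
    ultimately show ?thesis by linarith
  qed
  then have "\<bar>(LINT q | ?m'. g (?r q)) - fint X ?A (charge_of L G \<nu>) ?f\<bar> \<le> 0" by (rule dense_ge)
  then show ?thesis unfolding I by simp
qed

lemma keisler_conv_eq_conv:
  assumes "\<mu> \<in> keisler L G (univ G)" "\<nu> \<in> keisler L G (univ G)"
    and "uniformly_definable L G \<mu> M" "M \<subseteq> univ G" "|M| <o \<kappa>"
    and "\<phi> \<in> xforms L G (univ G)"
  shows "keisler_conv L \<kappa> G \<mu> \<nu> \<phi> = conv (charge_of L G \<mu>) (charge_of L G \<nu>) (vset L G \<phi>)"
proof -
  have "\<exists>N. admissible L \<kappa> G \<mu> \<nu> \<phi> N"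
    using star_borel_of_definable[OF assms(3-5), of \<nu>] assms(6) by (simp add: star_borel_def)
  then have "admissible L \<kappa> G \<mu> \<nu> \<phi> (SOME N. admissible L \<kappa> G \<mu> \<nu> \<phi> N)" by (rule someI_ex)
  from integral_fibre[OF assms(3-5,2) this assms(6)]
  show ?thesis unfolding keisler_conv_def Let_def conv_charge_of[OF assms(1,2,6)] .
qed

end

section \<open>Definability and finite satisfiability of convolutions\<close>

lemma elem_substruc_mul_closed:
  assumes "elem_substruc L G M" "fun_ty L (gmul L) = Some ([gsort L, gsort L], gsort L)"
    and "a \<in> gelems L G \<inter> M" "b \<in> gelems L G \<inter> M"
  shows "fun_in G (gmul L) [a, b] \<in> gelems L G \<inter> M"
proof -
  have "is_struc L (G\<lparr>univ := M\<rparr>)" "M \<subseteq> univ G" using assms(1) by (auto simp: elem_substruc_def)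
  then have "fun_in G (gmul L) [a, b] \<in> M \<and> srt G (fun_in G (gmul L) [a, b]) = gsort L"
    using assms(2-4) unfolding is_struc_def gelems_def by (auto dest!: spec[of _ "gmul L"])
  then show ?thesis using \<open>M \<subseteq> univ G\<close> by (auto simp: gelems_def)
qed

context monster_group begin

lemma finsat_in_of_fin_sat:
  assumes "\<nu> \<in> keisler L G (univ G)" "fin_sat_in L G \<nu> M"
  shows "finsat_in (charge_of L G \<nu>) (X \<inter> M)"
  unfolding finsat_in_def
proof (intro conjI ballI impI)
  fix A assume "A \<in> vsets L G (univ G)" and pos: "charge_of L G \<nu> A > 0"
  then obtain \<phi> where \<phi>: "A = vset L G \<phi>" "\<phi> \<in> xforms L G (univ G)" by (elim imageE) (rule that)
  then have "\<nu> \<phi> > 0" using pos charge_of_vset[OF assms(1) \<phi>(2)] by simp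
  then obtain a where "a \<in> X \<inter> M" "holds G a \<phi>" using assms(2) \<phi>(2) by (auto simp: fin_sat_in_def)
  then show "A \<inter> (X \<inter> M) \<noteq> {}" by (auto simp: \<phi>(1) vset_def)
qed simp

text \<open>
  If the integral over \<open>d\<close> of \<open>\<mu> (\<phi>(x \<cdot> d))\<close> is positive, it is approximated by an average over points \<open>d\<close> of
  \<open>M\<close>, so the integrand is positive at one of them. Then \<open>\<phi>(a \<cdot> d)\<close> holds for some \<open>a \<in> M\<close>, and
  \<open>a \<cdot> d\<close> is in \<open>M\<close>.
\<close>

lemma fin_sat_in_conv:
  assumes \<mu>: "\<mu> \<in> keisler L G (univ G)" "uniformly_definable L G \<mu> M" "fin_sat_in L G \<mu> M"
    and \<nu>: "\<nu> \<in> keisler L G (univ G)" "fin_sat_in L G \<nu> M"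
    and M: "elem_substruc L G M" "|M| <o \<kappa>"
  shows "fin_sat_in L G (keisler_conv L \<kappa> G \<mu> \<nu>) M"
  unfolding fin_sat_in_def
proof (intro ballI impI)
  fix \<phi> assume \<phi>: "\<phi> \<in> xforms L G (univ G)" and pos: "keisler_conv L \<kappa> G \<mu> \<nu> \<phi> > 0"
  have Mu: "M \<subseteq> univ G" using M(1) by (simp add: elem_substruc_def)
  let ?f = "\<lambda>d. \<mu> (translate L d \<phi>)"
  interpret \<nu>: charge X "vsets L G (univ G)" "charge_of L G \<nu>" by (rule charge_charge_of[OF \<nu>(1)])
  have f: "tmeas X (vsets L G (univ G)) ?f"
    by (rule tmeas_translate_measure[OF uniformly_definable_mono[OF \<mu>(2) Mu subset_refl] \<phi>])
  define I where "I = fint X (vsets L G (univ G)) (charge_of L G \<nu>) ?f"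
  have I: "I > 0"
    using pos unfolding I_def keisler_conv_eq_conv[OF \<mu>(1) \<nu>(1) \<mu>(2) Mu M(2) \<phi>]
      conv_charge_of[OF \<mu>(1) \<nu>(1) \<phi>] .
  have fs: "X \<inter> M \<subseteq> X" "\<And>A. A \<in> vsets L G (univ G) \<Longrightarrow> charge_of L G \<nu> A > 0 \<Longrightarrow> A \<inter> (X \<inter> M) \<noteq> {}"
    using finsat_in_of_fin_sat[OF \<nu>] unfolding finsat_in_def by auto
  have "\<exists>\<rho>. represents (charge_of L G \<nu>) (X \<inter> M) {} \<rho> \<and> \<bar>avg \<rho> ?f - I\<bar> < I"
    unfolding I_def
    by (rule \<nu>.ex_represents_fint[OF f I[unfolded I_def] finite.emptyI empty_subsetI fs(1)]) (rule fs(2))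
  then obtain \<rho> where \<rho>: "represents (charge_of L G \<nu>) (X \<inter> M) {} \<rho>" "\<bar>avg \<rho> ?f - I\<bar> < I"
    by (elim exE conjE) (rule that)
  have "\<exists>d\<in>X \<inter> M. ?f d > 0"
  proof (rule ccontr)
    assume "\<not> (\<exists>d\<in>X \<inter> M. ?f d > 0)"
    then have "avg \<rho> ?f \<le> avg \<rho> (\<lambda>_. 0)" by (intro avg_mono[OF \<rho>(1)]) (simp add: not_less)
    then show False using \<rho>(2) by (simp add: avg_def)
  qed
  then obtain d where d: "d \<in> X" "d \<in> M" "?f d > 0" by auto
  then have "insert d (univ G) = univ G" by (auto simp: gelems_def)
  then have "translate L d \<phi> \<in> xforms L G (univ G)" using vset_translate(1)[OF \<phi> d(1)] by simp
  then obtain a where a: "a \<in> X \<inter> M" "holds G a (translate L d \<phi>)"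
    using \<mu>(3) d(3) unfolding fin_sat_in_def by blast
  then have "a \<in> vset L G (translate L d \<phi>)" by (simp add: vset_def)
  then have "holds G (mul a d) \<phi>" unfolding vset_translate(2)[OF \<phi> d(1)] by (simp add: vset_def)
  moreover have "mul a d \<in> X \<inter> M" using d a(1) by (intro elem_substruc_mul_closed[OF M(1) mul_ty]) auto
  ultimately show "\<exists>a\<in>X \<inter> M. holds G a \<phi>" by blast
qed

text \<open>
  As a function of \<open>d\<close> and \<open>b\<close> together, \<open>\<mu> (\<phi>(x \<cdot> d, b))\<close> is uniformly close to a step function given
  by formulas \<open>\<psi>(d, b)\<close> over \<open>M\<close>. Integrating over \<open>d\<close> leaves a linear combination of the functions
  \<open>b \<mapsto> \<nu> (\<psi>(x, b))\<close>, which are approximable because \<open>\<nu>\<close> is definable.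
\<close>

lemma uniformly_definable_conv:
  assumes \<mu>: "\<mu> \<in> keisler L G (univ G)" "uniformly_definable L G \<mu> M"
    and \<nu>: "\<nu> \<in> keisler L G (univ G)" "uniformly_definable L G \<nu> M"
    and M: "M \<subseteq> univ G" "|M| <o \<kappa>"
  shows "uniformly_definable L G (keisler_conv L \<kappa> G \<mu> \<nu>) M"
  unfolding uniformly_definable_def
proof (intro allI impI)
  fix V \<phi> assume "finite V \<and> xvar L \<notin> V \<and> \<phi> \<in> forms L G (insert (xvar L) V) M"
  then have V: "finite V" "xvar L \<notin> V" and \<phi>: "\<phi> \<in> forms L G (insert (xvar L) V) M" by auto
  let ?A = "vsets L G (univ G)"
  interpret \<nu>: charge X ?A "charge_of L G \<nu>" by (rule charge_charge_of[OF \<nu>(1)])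
  interpret T: algebra "tuples G V" "tsets L G V M" by (rule algebra_tsets)
  \<comment> \<open>an index that makes the variable \<open>y\<close> fresh\<close>
  define n where "n = Suc (Max (insert 0 (snd ` insert (xvar L) V)))"
  define y where "y = (gsort L, n)"
  have fresh: "snd z < n" if "z \<in> insert (xvar L) V" for z
    using that V(1) unfolding n_def by (intro le_imp_less_Suc Max_ge) auto
  have y: "y \<notin> insert (xvar L) V" "fst y = gsort L" using fresh[of y] by (auto simp: y_def)
  let ?\<phi>' = "subst (\<lambda>z. if z = xvar L then App (gmul L) [Free (xvar L), Free y] else Free z) \<phi>"
  define H where "H b = \<mu> (inst (insert y V) b ?\<phi>')" for b
  have H: "tmeas (tuples G (insert y V)) (tsets L G (insert y V) M) H"
    using \<mu>(2) V y(1) sum_subst(1)[OF \<phi> y] unfolding uniformly_definable_def H_def by auto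
  interpret T': algebra "tuples G (insert y V)" "tsets L G (insert y V) M" by (rule algebra_tsets)
  have inst_univ: "inst V b \<theta> \<in> xforms L G (univ G)"
    if "tuple G V b" "\<theta> \<in> forms L G (insert (xvar L) V) M" for b \<theta>
  proof -
    have "inst V b \<theta> \<in> forms L G {xvar L} (M \<union> b ` V)" by (rule inst_forms) (use that in auto)
    moreover have "M \<union> b ` V \<subseteq> univ G" using M(1) that(1) by (auto simp: tuple_def)
    ultimately show ?thesis using forms_mono[OF subset_refl, of "M \<union> b ` V" "univ G" L G "{xvar L}"] by auto
  qed
  have val: "keisler_conv L \<kappa> G \<mu> \<nu> (inst V b \<phi>) = fint X ?A (charge_of L G \<nu>) (\<lambda>d. H (b(y := d)))"
    and tm: "tmeas X ?A (\<lambda>d. H (b(y := d)))" if b: "tuple G V b" for b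
  proof -
    note \<phi>b = inst_univ[OF b \<phi>]
    have eq: "(\<lambda>d. \<mu> (translate L d (inst V b \<phi>))) = (\<lambda>d. H (b(y := d)))"
      unfolding H_def sum_subst(2)[OF \<phi> y V(2)] ..
    show "keisler_conv L \<kappa> G \<mu> \<nu> (inst V b \<phi>) = fint X ?A (charge_of L G \<nu>) (\<lambda>d. H (b(y := d)))"
      using keisler_conv_eq_conv[OF \<mu>(1) \<nu>(1) \<mu>(2) M \<phi>b] conv_charge_of[OF \<mu>(1) \<nu>(1) \<phi>b]
      unfolding eq by simp
    show "tmeas X ?A (\<lambda>d. H (b(y := d)))"
      using tmeas_translate_measure[OF uniformly_definable_mono[OF \<mu>(2) M(1) subset_refl] \<phi>b]
      unfolding eq .
  qed
  show "tmeas (tuples G V) (tsets L G V M) (\<lambda>b. keisler_conv L \<kappa> G \<mu> \<nu> (inst V b \<phi>))"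
  proof (rule tmeas_uniform_limit)
    fix \<epsilon> :: real assume "\<epsilon> > 0"
    then obtain P c where P: "finite P" "P \<subseteq> tsets L G (insert y V) M"
      "\<And>b. b \<in> tuples G (insert y V) \<Longrightarrow> \<bar>H b - (\<Sum>B\<in>P. c B * indicator B b)\<bar> \<le> \<epsilon>"
      by (rule T'.tmeas_step[OF H]) (rule that)
    have "\<forall>B\<in>P. \<exists>\<psi>. \<psi> \<in> forms L G (insert y V) M \<and> B = tset G (insert y V) \<psi>" using P(2) by auto
    from bchoice[OF this] obtain fm where
      fm: "\<And>B. B \<in> P \<Longrightarrow> fm B \<in> forms L G (insert y V) M \<and> B = tset G (insert y V) (fm B)" by auto
    define \<theta> where "\<theta> B = subst (\<lambda>z. if z = y then Free (xvar L) else Free z) (fm B)" for B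
    have \<theta>: "\<theta> B \<in> forms L G (insert (xvar L) V) M" if "B \<in> P" for B
      unfolding \<theta>_def
      by (rule forms_subst[of _ L G "insert y V" M])
         (use fm[OF that] trm_ok.intros(1)[of L G] trm_ok.intros(1)[of L G _ "xvar L"] in \<open>auto simp: y_def xvar_def\<close>)
    have slice: "vset L G (inst V b (\<theta> B)) = {d\<in>X. b(y := d) \<in> B}" if b: "tuple G V b" and B: "B \<in> P" for b B
    proof -
      have "holds G d (inst V b (\<theta> B)) \<longleftrightarrow> sat G (b(y := d)) [] (fm B)" for d
      proof -
        have "sat G (\<lambda>z. if z \<in> V then b z else d) [] (\<theta> B) \<longleftrightarrow> sat G (\<lambda>z. if z \<in> V then b z else d) [] (fm B)"
          unfolding \<theta>_def by (rule sat_subst) (use V(2) y(1) in auto)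
        also have "\<dots> \<longleftrightarrow> sat G (b(y := d)) [] (fm B)"
          by (rule sat_cong) (use fm[OF B] y(1) in \<open>auto simp: forms_def\<close>)
        finally show ?thesis by (simp add: holds_def sat_inst)
      qed
      moreover have "tuple G (insert y V) (b(y := d))" if "d \<in> X" for d
        using that b by (auto simp: tuple_def gelems_def y_def)
      ultimately show ?thesis using fm[OF B] by (auto simp: vset_def tset_def)
    qed
    let ?g = "\<lambda>b. \<Sum>B\<in>P. c B * \<nu> (inst V b (\<theta> B))"
    have "tmeas (tuples G V) (tsets L G V M) ?g"
      using \<nu>(2) V \<theta> unfolding uniformly_definable_def by (intro T.tmeas_sum[OF P(1)] T.tmeas_cmult) auto
    moreover have "\<bar>keisler_conv L \<kappa> G \<mu> \<nu> (inst V b \<phi>) - ?g b\<bar> \<le> \<epsilon>" if "b \<in> tuples G V" for b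
    proof -
      have b: "tuple G V b" using that by simp
      let ?D = "\<lambda>B. {d\<in>X. b(y := d) \<in> B}"
      have D: "?D B \<in> ?A" if "B \<in> P" for B
        using slice[OF b that] inst_univ[OF b \<theta>[OF that]] by (metis imageI)
      have tmD: "tmeas X ?A (\<lambda>d. c B * indicator (?D B) d)" if "B \<in> P" for B
        by (intro tmeas_cmult tmeas_indicator D that)
      have "fint X ?A (charge_of L G \<nu>) (\<lambda>d. \<Sum>B\<in>P. c B * indicator (?D B) d)
          = (\<Sum>B\<in>P. fint X ?A (charge_of L G \<nu>) (\<lambda>d. c B * indicator (?D B) d))"
        by (rule mean_sum[OF \<nu>.mean_fint P(1) tmD])
      also have "\<dots> = ?g b"
      proof (rule sum.cong[OF refl])
        fix B assume B: "B \<in> P"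
        have "charge_of L G \<nu> (?D B) = \<nu> (inst V b (\<theta> B))"
          using charge_of_vset[OF \<nu>(1) inst_univ[OF b \<theta>[OF B]]] slice[OF b B] by simp
        then show "fint X ?A (charge_of L G \<nu>) (\<lambda>d. c B * indicator (?D B) d) = c B * \<nu> (inst V b (\<theta> B))"
          using \<nu>.fint_cmult[OF tmeas_indicator[OF D[OF B]]] \<nu>.fint_indicator[OF D[OF B]] by simp
      qed
      moreover have "\<bar>fint X ?A (charge_of L G \<nu>) (\<lambda>d. H (b(y := d)))
          - fint X ?A (charge_of L G \<nu>) (\<lambda>d. \<Sum>B\<in>P. c B * indicator (?D B) d)\<bar> \<le> \<epsilon>"
      proof (rule mean_close[OF \<nu>.mean_fint tm[OF b] tmeas_sum[OF P(1) tmD]])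
        fix d assume d: "d \<in> X"
        then have "b(y := d) \<in> tuples G (insert y V)" using b by (auto simp: tuple_def gelems_def y_def)
        from P(3)[OF this] d
        show "\<bar>H (b(y := d)) - (\<Sum>B\<in>P. c B * indicator (?D B) d)\<bar> \<le> \<epsilon>" by (simp add: indicator_def)
      qed
      ultimately show ?thesis unfolding val[OF b] by simp
    qed
    ultimately show "\<exists>g. tmeas (tuples G V) (tsets L G V M) g \<and>
        (\<forall>b\<in>tuples G V. \<bar>keisler_conv L \<kappa> G \<mu> \<nu> (inst V b \<phi>) - g b\<bar> \<le> \<epsilon>)" by blast
  qed
qed

text \<open>
  The parameters of the formula become part of the second group of variables, where they are constant.
\<close>

lemma nip_translates:
  assumes nip: "nip L G" and A: "A \<in> vsets L G (univ G)"
  shows "\<exists>n. \<not> shattered_by X (\<lambda>x d. mul x d \<in> A) n"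
proof -
  obtain \<phi> where \<phi>: "A = vset L G \<phi>" "\<phi> \<in> xforms L G (univ G)" using A by (elim imageE) (rule that)
  define y where "y = (gsort L, 1::nat)"
  have y: "y \<notin> insert (xvar L) {}" "fst y = gsort L" by (auto simp: y_def xvar_def)
  let ?\<phi>' = "subst (\<lambda>z. if z = xvar L then App (gmul L) [Free (xvar L), Free y] else Free z) \<phi>"
  have \<phi>': "?\<phi>' \<in> forms L G {xvar L, y} (univ G)" using sum_subst(1)[OF \<phi>(2) y] by simp
  have "finite {xvar L, y}" by simp
  from ex_generalisation[OF \<phi>' subset_refl this] obtain W c \<phi>0 where W: "finite W" "W \<inter> {xvar L, y} = {}"
    "\<phi>0 \<in> forms L G ({xvar L, y} \<union> W) {}" "tuple G W c" "inst W c \<phi>0 = ?\<phi>'"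
    by (elim exE conjE) (rule that)
  have "\<phi>0 \<in> forms L G ({xvar L} \<union> insert y W) {}" using W(3) by (simp add: insert_commute)
  then have "\<not> (\<forall>n::nat. \<exists>a b. (\<forall>i<n. tuple G {xvar L} (a i)) \<and> (\<forall>I\<subseteq>{..<n}. tuple G (insert y W) (b I)) \<and>
      (\<forall>i<n. \<forall>I\<subseteq>{..<n}. sat G (\<lambda>z. if z \<in> {xvar L} then a i z else b I z) [] \<phi>0 \<longleftrightarrow> i \<in> I))"
    using nip[unfolded nip_def, rule_format, of "{xvar L}" "insert y W" \<phi>0] W(1,2) y(1) by auto
  then obtain n :: nat where n: "\<forall>a b. \<not> ((\<forall>i<n. tuple G {xvar L} (a i)) \<and> (\<forall>I\<subseteq>{..<n}. tuple G (insert y W) (b I)) \<and>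
      (\<forall>i<n. \<forall>I\<subseteq>{..<n}. sat G (\<lambda>z. if z \<in> {xvar L} then a i z else b I z) [] \<phi>0 \<longleftrightarrow> i \<in> I))"
    unfolding not_all not_ex by (elim exE) (rule that)
  have "\<not> shattered_by X (\<lambda>x d. mul x d \<in> A) n"
  proof
    assume "shattered_by X (\<lambda>x d. mul x d \<in> A) n"
    then obtain a b where a: "\<forall>i<n. a i \<in> X" and b: "\<forall>I\<subseteq>{..<n}. b I \<in> X"
      and ab: "\<forall>i<n. \<forall>I\<subseteq>{..<n}. mul (a i) (b I) \<in> A \<longleftrightarrow> i \<in> I"
      unfolding shattered_by_def by (elim exE conjE) (rule that)
    define b' where "b' I z = (if z \<in> W then c z else b I)" for I z
    have "sat G (\<lambda>z. if z \<in> {xvar L} then a i else b' I z) [] \<phi>0 \<longleftrightarrow> mul (a i) (b I) \<in> A"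
      if "i < n" "I \<subseteq> {..<n}" for i I
    proof -
      let ?v = "\<lambda>z. if z = xvar L then a i else b I"
      have "sat G (\<lambda>z. if z \<in> {xvar L} then a i else b' I z) [] \<phi>0 \<longleftrightarrow> sat G (\<lambda>z. if z \<in> W then c z else ?v z) [] \<phi>0"
        by (rule arg_cong[of _ _ "\<lambda>v. sat G v [] \<phi>0"]) (use W(2) in \<open>auto simp: b'_def\<close>)
      also have "\<dots> \<longleftrightarrow> sat G ?v [] ?\<phi>'" unfolding W(5)[symmetric] sat_inst ..
      also have "\<dots> \<longleftrightarrow> sat G (\<lambda>_. mul (a i) (b I)) [] \<phi>"
        by (rule sat_subst) (use \<phi>(2) y(1) in \<open>auto simp: forms_def\<close>)
      also have "\<dots> \<longleftrightarrow> mul (a i) (b I) \<in> A"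
        using mul_closed a b that by (simp add: \<phi>(1) vset_def holds_def)
      finally show ?thesis .
    qed
    moreover have "\<forall>i<n. tuple G {xvar L} (\<lambda>_. a i)"
      using a by (simp add: tuple_def gelems_def xvar_def)
    moreover have "\<forall>I\<subseteq>{..<n}. tuple G (insert y W) (b' I)"
      using b W(2,4) by (auto simp: tuple_def gelems_def b'_def y_def)
    ultimately show False using n[THEN spec, THEN spec, of "\<lambda>i _. a i" b'] ab by simp
  qed
  then show ?thesis by blast
qed

text \<open>
  Only the parameters of \<open>A\<close>, those of the finitely many sets in \<open>\<G>\<close> and the elements of \<open>M\<close> occur.
\<close>

lemma compact_family_translates:
  assumes M: "M \<subseteq> univ G" "|M| <o \<kappa>" and A: "A \<in> vsets L G (univ G)"
    and \<G>: "finite \<G>" "\<G> \<subseteq> vsets L G (univ G)"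
  shows "compact_family X ((\<lambda>d. {x\<in>X. mul x d \<in> A}) ` (X \<inter> M) \<union> \<G>)"
proof -
  obtain \<phi> where \<phi>: "A = vset L G \<phi>" "\<phi> \<in> xforms L G (univ G)" using A by (elim imageE) (rule that)
  obtain \<Phi> where \<Phi>: "\<Phi> \<subseteq> xforms L G (univ G)" "finite \<Phi>" "\<G> = vset L G ` \<Phi>"
    using finite_subset_image[OF \<G>] by (elim exE conjE) (rule that)
  define B where "B = M \<union> (\<Union>\<psi>\<in>insert \<phi> \<Phi>. params \<psi>)"
  have "B \<subseteq> univ G" using M(1) \<phi>(2) \<Phi>(1) by (auto simp: B_def forms_def)
  moreover have "|B| <o \<kappa>"
    unfolding B_def using \<Phi>(2) finite_params by (intro small_Un[OF sat M(2)] small_finite[OF sat] finite_UN_I) auto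
  moreover have "(\<lambda>d. {x\<in>X. mul x d \<in> A}) ` (X \<inter> M) \<union> \<G> \<subseteq> vsets L G B"
  proof (rule Un_least)
    show "(\<lambda>d. {x\<in>X. mul x d \<in> A}) ` (X \<inter> M) \<subseteq> vsets L G B"
    proof (rule image_subsetI)
      fix d assume d: "d \<in> X \<inter> M"
      then have dX: "d \<in> X" by simp
      have \<phi>B: "\<phi> \<in> xforms L G B" using \<phi>(2) by (auto simp: forms_def B_def)
      have "insert d B = B" using d by (auto simp: B_def)
      then have "translate L d \<phi> \<in> xforms L G B" using vset_translate(1)[OF \<phi>B dX] by simp
      then show "{x\<in>X. mul x d \<in> A} \<in> vsets L G B"
        unfolding \<phi>(1) vset_translate(2)[OF \<phi>B dX, symmetric] by (rule imageI)
    qed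
    show "\<G> \<subseteq> vsets L G B"
      unfolding \<Phi>(3) using \<Phi>(1) by (intro image_mono) (auto simp: forms_def B_def)
  qed
  ultimately show ?thesis by (rule compact_family_vsets[OF sat])
qed

end

theorem proposition3p23:
  fixes L :: "('s, 'f, 'r) lang" and G :: "('s, 'f, 'r, 'a) struc" and \<kappa> :: "'k rel"
    and \<mu> \<nu> :: "('s, 'f, 'r, 'a) fm \<Rightarrow> real"
  assumes "is_struc L G" and "expands_group L G" and "sufficiently_saturated L \<kappa> G"
    and "nip L G" and "abelian_struc L G"
    and "\<mu> \<in> keisler L G (univ G)" and "\<nu> \<in> keisler L G (univ G)"
    and "idem_measure L \<kappa> G \<mu>" and "dfs L \<kappa> G \<mu>"
    and "idem_measure L \<kappa> G \<nu>" and "dfs L \<kappa> G \<nu>"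
  shows "keisler_conv L \<kappa> G \<mu> \<nu> \<in> keisler L G (univ G) \<and>
    idem_measure L \<kappa> G (keisler_conv L \<kappa> G \<mu> \<nu>) \<and> dfs L \<kappa> G (keisler_conv L \<kappa> G \<mu> \<nu>)"
proof -
  interpret monster_group L G \<kappa> by (rule monster_group.intro) (rule assms)+
  note \<mu> = assms(6) and \<nu> = assms(7)
  obtain M1 where M1: "elem_substruc L G M1" "|M1| <o \<kappa>" "definable_over L G \<mu> M1" "fin_sat_in L G \<mu> M1"
    using assms(9) unfolding dfs_def by (elim exE conjE) (rule that)
  obtain M2 where M2: "elem_substruc L G M2" "|M2| <o \<kappa>" "definable_over L G \<nu> M2" "fin_sat_in L G \<nu> M2"
    using assms(11) unfolding dfs_def by (elim exE conjE) (rule that)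
  have "M1 \<union> M2 \<subseteq> univ G" using M1(1) M2(1) by (auto simp: elem_substruc_def)
  then obtain M where M: "elem_substruc L G M" "M1 \<union> M2 \<subseteq> M" "|M| <o \<kappa>"
    using ex_small_elem_substruc[OF struc sat _ small_Un[OF sat M1(2) M2(2)]] by meson
  have Mu: "M \<subseteq> univ G" using M(1) by (simp add: elem_substruc_def)
  have MM: "M1 \<subseteq> M" "M2 \<subseteq> M" using M(2) by auto
  have def: "uniformly_definable L G \<mu> M" "uniformly_definable L G \<nu> M"
    by (rule uniformly_definable_mono[OF uniformly_definable_of_definable[OF M1(3)] MM(1) Mu],
        rule uniformly_definable_mono[OF uniformly_definable_of_definable[OF M2(3)] MM(2) Mu])
  have fs: "fin_sat_in L G \<mu> M" "fin_sat_in L G \<nu> M"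
    using M1(4) M2(4) MM unfolding fin_sat_in_def by blast+
  let ?c = "keisler_conv L \<kappa> G \<mu> \<nu>" and ?m = "charge_of L G \<mu>" and ?n = "charge_of L G \<nu>"
  note m = definable_charge_of[OF \<mu> def(1) Mu] and n = definable_charge_of[OF \<nu> def(2) Mu]
  have cn: "charge X (vsets L G (univ G)) ?n" by (rule charge_charge_of[OF \<nu>])
  note conv_eq = keisler_conv_eq_conv[OF _ _ _ Mu M(3)]
  have c: "?c \<in> keisler L G (univ G)"
    by (rule keisler_of_charge[OF charge_conv[OF m cn]]) (rule conv_eq[OF \<mu> \<nu> def(1)])
  have c_def: "uniformly_definable L G ?c M"
    by (rule uniformly_definable_conv[OF \<mu> def(1) \<nu> def(2) Mu M(3)])
  have dfs: "dfs L \<kappa> G ?c"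
    unfolding dfs_def
    using M definable_of_uniformly_definable[OF sat Mu M(3) c_def] fin_sat_in_conv[OF \<mu> def(1) fs(1) \<nu> fs(2) M(1,3)]
    by blast
  have idem_charge: "conv (charge_of L G \<rho>) (charge_of L G \<rho>) A = charge_of L G \<rho> A"
    if \<rho>: "\<rho> \<in> keisler L G (univ G)" "uniformly_definable L G \<rho> M" "idem_measure L \<kappa> G \<rho>"
      and A: "A \<in> vsets L G (univ G)" for \<rho> A
  proof -
    obtain \<phi> where \<phi>: "A = vset L G \<phi>" "\<phi> \<in> xforms L G (univ G)" using A by (elim imageE) (rule that)
    have "keisler_conv L \<kappa> G \<rho> \<rho> \<phi> = \<rho> \<phi>" using \<rho>(3) \<phi>(2) by (simp add: idem_measure_def)
    then show ?thesis
      using conv_eq[OF \<rho>(1,1,2) \<phi>(2)] charge_of_vset[OF \<rho>(1) \<phi>(2)] by (simp add: \<phi>(1))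
  qed
  have comm: "mul x y = mul y x" if "x \<in> X" "y \<in> X" for x y
    using assms(5) that by (simp add: abelian_struc_def gelems_def)
  have idem: "conv (conv ?m ?n) (conv ?m ?n) A = conv ?m ?n A" if A: "A \<in> vsets L G (univ G)" for A
    by (rule conv_idempotent[OF comm m idem_charge[OF \<mu> def(1) assms(8)] n idem_charge[OF \<nu> def(2) assms(10)]
          finsat_in_of_fin_sat[OF \<nu> fs(2)] nip_translates[OF assms(4)] compact_family_translates[OF Mu M(3)] A])
  have l: "charge_of L G ?c A = conv ?m ?n A" if A: "A \<in> vsets L G (univ G)" for A
  proof -
    obtain \<phi> where \<phi>: "A = vset L G \<phi>" "\<phi> \<in> xforms L G (univ G)" using A by (elim imageE) (rule that)
    show ?thesis unfolding \<phi>(1) charge_of_vset[OF c \<phi>(2)] by (rule conv_eq[OF \<mu> \<nu> def(1) \<phi>(2)])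
  qed
  have "keisler_conv L \<kappa> G ?c ?c \<phi> = ?c \<phi>" if \<phi>: "\<phi> \<in> xforms L G (univ G)" for \<phi>
  proof -
    have v: "vset L G \<phi> \<in> vsets L G (univ G)" using \<phi> by (rule imageI)
    have "keisler_conv L \<kappa> G ?c ?c \<phi> = conv (charge_of L G ?c) (charge_of L G ?c) (vset L G \<phi>)"
      by (rule conv_eq[OF c c c_def \<phi>])
    also have "\<dots> = conv (conv ?m ?n) (conv ?m ?n) (vset L G \<phi>)"
      by (rule conv_cong[OF charge_charge_of[OF c] charge_conv[OF m cn] definable_charge_of[OF c c_def Mu] l l v])
    also have "\<dots> = conv ?m ?n (vset L G \<phi>)" by (rule idem[OF v])
    also have "\<dots> = ?c \<phi>" by (rule conv_eq[OF \<mu> \<nu> def(1) \<phi>, symmetric])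
    finally show ?thesis .
  qed
  then have "idem_measure L \<kappa> G ?c"
    unfolding idem_measure_def using star_borel_of_definable[OF c_def Mu M(3)] by blast
  then show ?thesis using c dfs by blast
qed

end
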